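(* Let $(\mathscr M,g)$ be a Lorentzian simple conformally recurrent manifold of dimension $n\ge 4$. Then there exists a coordinate domain $\mathcal O$ in $\mathscr M$ on which the manifold is a pp-wave space-time, i.e. $(\mathcal O, g|_{\mathcal O})$ is a pp-wave.
   Context: Manifolds are connected and Hausdorff, with a non-degenerate metric; $\nabla$ is the Levi-Civita connection. The local components of the Weyl tensor are $$C_{jkl}{}^m = R_{jkl}{}^m +\tfrac{1}{n-2}(\delta^m_j R_{kl}-\delta_k^m R_{jl} + g_{kl} R_j{}^m -g_{jl}R_k{}^m) -R\,\tfrac{\delta_j^m g_{kl}-\delta_k^m g_{jl}}{(n-1)(n-2)},$$ with Ricci tensor $R_{ij}=-R_{kij}{}^k$ and scalar curvature $R=R^k{}_k$. Conformally recurrent: a pseudo-Riemannian manifold of dimension $n\ge 4$ is conformally recurrent if its Weyl tensor is everywhere non-zero and $\nabla_i C_{jklm}=\alpha_i C_{jklm}$ for a non-zero 1-form $\alpha_i$ (the recurrence vector). Simple conformally recurrent: a conformally recurrent manifold $(\mathscr M,g)$ is simple if its metric is locally conformal to a conformally symmetric metric, i.e. for each $x\in\mathscr M$ there exist a neighbourhood $U_x$ and a scalar function $\sigma$ on $U_x$ such that the metric $g'_{ij}=e^{2\sigma}g_{ij}$ satisfies $\nabla'_i C'_{jklm}=0$ on $U_x$, where $\nabla'$ and $C'$ are the Levi-Civita connection and the Weyl tensor of $g'$. Brinkmann-wave: a Lorentzian manifold equipped with a null covariantly constant vector field $X$, i.e. $X^iX_i=0$, $\nabla_jX_k=0$ ($X$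 non-zero). pp-wave (space-time): a Brinkmann-wave whose Riemann tensor satisfies $R_{jk}{}^{pq}R_{pqlm}=0$. *)

theory Defs
  imports "HOL-Analysis.Analysis"
begin

subsection \<open>Smooth functions on open subsets of Euclidean space\<close>

definition partial_deriv :: "'n::finite \<Rightarrow> (real^'n \<Rightarrow> real) \<Rightarrow> real^'n \<Rightarrow> real" where
  "partial_deriv i f x = frechet_derivative f (at x) (axis i 1)"

text \<open>The next two notions are only used for open \<open>S\<close>, where \<^const>\<open>differentiable_on\<close> is
  differentiability at every point in the ordinary sense.\<close>

primrec Ck_on :: "nat \<Rightarrow> (real^'n::finite) set \<Rightarrow> (real^'n \<Rightarrow> real) \<Rightarrow> bool" where
  "Ck_on 0 S f \<longleftrightarrow> continuous_on S f"
| "Ck_on (Suc k) S f \<longleftrightarrow> f differentiable_on S \<and> (\<forall>i. Ck_on k S (partial_deriv i f))"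

definition smooth_on :: "(real^'n::finite) set \<Rightarrow> (real^'n \<Rightarrow> real) \<Rightarrow> bool" where
  "smooth_on S f \<longleftrightarrow> (\<forall>k. Ck_on k S f)"


subsection \<open>Manifolds\<close>

text \<open>A chart is a pair of its domain and its coordinate map; the values of the map outside the
  domain are irrelevant. The dimension is \<open>CARD('n)\<close>.\<close>

type_synonym ('a, 'n) chart = "'a set \<times> ('a \<Rightarrow> real^'n)"

abbreviation chart_dom :: "('a, 'n::finite) chart \<Rightarrow> 'a set" where
  "chart_dom c \<equiv> fst c"

abbreviation chart_map :: "('a, 'n::finite) chart \<Rightarrow> 'a \<Rightarrow> real^'n" where
  "chart_map c \<equiv> snd c"

definition chart_inv :: "('a, 'n::finite) chart \<Rightarrow> real^'n \<Rightarrow> 'a" where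
  "chart_inv c = inv_into (chart_dom c) (chart_map c)"

definition chart_im :: "('a, 'n::finite) chart \<Rightarrow> (real^'n) set" where
  "chart_im c = chart_map c ` chart_dom c"

definition is_chart :: "'a topology \<Rightarrow> ('a, 'n::finite) chart \<Rightarrow> bool" where
  "is_chart X c \<longleftrightarrow> openin X (chart_dom c) \<and> open (chart_im c) \<and>
     homeomorphic_map (subtopology X (chart_dom c)) (top_of_set (chart_im c)) (chart_map c)"

definition overlap :: "('a, 'n::finite) chart \<Rightarrow> ('a, 'n) chart \<Rightarrow> (real^'n) set" where
  "overlap c d = chart_map c ` (chart_dom c \<inter> chart_dom d)"

definition transition :: "('a, 'n::finite) chart \<Rightarrow> ('a, 'n) chart \<Rightarrow> real^'n \<Rightarrow> real^'n" where
  "transition c d = chart_map d \<circ> chart_inv c"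

definition compatible :: "('a, 'n::finite) chart \<Rightarrow> ('a, 'n) chart \<Rightarrow> bool" where
  "compatible c d \<longleftrightarrow>
     (\<forall>k. smooth_on (overlap c d) (\<lambda>y. transition c d y $ k)) \<and>
     (\<forall>k. smooth_on (overlap d c) (\<lambda>y. transition d c y $ k))"

text \<open>\<open>A\<close> is a maximal atlas, so that its members are exactly the coordinate systems of the
  manifold. Second countability is not assumed.\<close>

locale smooth_manifold =
  fixes X :: "'a topology" and A :: "('a, 'n::finite) chart set"
  assumes nonempty: "topspace X \<noteq> {}"
    and connected: "connected_space X"
    and Hausdorff: "Hausdorff_space X"
    and charts: "c \<in> A \<Longrightarrow> is_chart X c"
    and cover: "(\<Union>c\<in>A. chart_dom c) = topspace X"
    and compat: "c \<in> A \<Longrightarrow> d \<in> A \<Longrightarrow> compatible c d"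
    and maximal: "is_chart X c \<Longrightarrow> (\<And>d. d \<in> A \<Longrightarrow> compatible c d) \<Longrightarrow> c \<in> A"

text \<open>The coordinate systems of the open submanifold \<open>U\<close>.\<close>

definition restrict_atlas :: "('a, 'n::finite) chart set \<Rightarrow> 'a set \<Rightarrow> ('a, 'n) chart set" where
  "restrict_atlas A U = {c \<in> A. chart_dom c \<subseteq> U}"


subsection \<open>Tensor fields\<close>

text \<open>A tensor field is given by its components in every chart of the atlas, as functions of the
  coordinates, subject to the transformation law.\<close>

type_synonym ('a, 'n) vector_comps = "('a, 'n) chart \<Rightarrow> real^'n \<Rightarrow> real^'n"
type_synonym ('a, 'n) matrix_comps = "('a, 'n) chart \<Rightarrow> real^'n \<Rightarrow> real^'n^'n"

definition scalar_field ::
  "('a, 'n::finite) chart set \<Rightarrow> ('a \<Rightarrow> real) \<Rightarrow> bool" where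
  "scalar_field A f \<longleftrightarrow> (\<forall>c\<in>A. smooth_on (chart_im c) (\<lambda>y. f (chart_inv c y)))"

definition vector_field ::
  "('a, 'n::finite) chart set \<Rightarrow> ('a, 'n) vector_comps \<Rightarrow> bool" where
  "vector_field A v \<longleftrightarrow>
     (\<forall>c\<in>A. \<forall>i. smooth_on (chart_im c) (\<lambda>y. v c y $ i)) \<and>
     (\<forall>c\<in>A. \<forall>d\<in>A. \<forall>y\<in>overlap c d.
        v d (transition c d y) = jacobian (transition c d) (at y) *v v c y)"

definition one_form ::
  "('a, 'n::finite) chart set \<Rightarrow> ('a, 'n) vector_comps \<Rightarrow> bool" where
  "one_form A \<alpha> \<longleftrightarrow>
     (\<forall>c\<in>A. \<forall>i. smooth_on (chart_im c) (\<lambda>y. \<alpha> c y $ i)) \<and>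
     (\<forall>c\<in>A. \<forall>d\<in>A. \<forall>y\<in>overlap c d.
        \<alpha> c y = transpose (jacobian (transition c d) (at y)) *v \<alpha> d (transition c d y))"

definition covariant_2_tensor ::
  "('a, 'n::finite) chart set \<Rightarrow> ('a, 'n) matrix_comps \<Rightarrow> bool" where
  "covariant_2_tensor A g \<longleftrightarrow>
     (\<forall>c\<in>A. \<forall>i j. smooth_on (chart_im c) (\<lambda>y. g c y $ i $ j)) \<and>
     (\<forall>c\<in>A. \<forall>d\<in>A. \<forall>y\<in>overlap c d.
        g c y = transpose (jacobian (transition c d) (at y)) ** g d (transition c d y)
                ** jacobian (transition c d) (at y))"

locale pseudo_riemannian_manifold = smooth_manifold X A
  for X :: "'a topology" and A :: "('a, 'n::finite) chart set" +
  fixes g :: "('a, 'n) matrix_comps"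
  assumes metric_tensor: "covariant_2_tensor A g"
    and metric_symmetric: "c \<in> A \<Longrightarrow> y \<in> chart_im c \<Longrightarrow> transpose (g c y) = g c y"
    and metric_nondegenerate: "c \<in> A \<Longrightarrow> y \<in> chart_im c \<Longrightarrow> invertible (g c y)"

text \<open>Signature \<open>(-,+,\<dots>,+)\<close>.\<close>

definition lorentzian_form :: "real^'n^'n::finite \<Rightarrow> bool" where
  "lorentzian_form G \<longleftrightarrow>
     (\<exists>(P :: real^'n^'n) i0. invertible P \<and>
        transpose P ** G ** P =
          (\<chi> i j. if i \<noteq> j then 0 else if i = i0 then - 1 else 1))"

locale lorentzian_manifold = pseudo_riemannian_manifold X A g
  for X :: "'a topology" and A :: "('a, 'n::finite) chart set" and g +
  assumes lorentzian: "c \<in> A \<Longrightarrow> y \<in> chart_im c \<Longrightarrow> lorentzian_form (g c y)"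


subsection \<open>Curvature in local coordinates\<close>

text \<open>\<open>christoffel G i j m\<close> is \<open>\<Gamma>\<^sub>i\<^sub>j\<^sup>m\<close>; in \<open>riemann G j k l m\<close>, \<open>ricci_mixed G j m\<close> and
  \<open>weyl_up G j k l m\<close> the last index \<open>m\<close> is the raised one.\<close>

definition metric_inv :: "(real^'n \<Rightarrow> real^'n^'n::finite) \<Rightarrow> 'n \<Rightarrow> 'n \<Rightarrow> real^'n \<Rightarrow> real" where
  "metric_inv G i j y = matrix_inv (G y) $ i $ j"

definition christoffel ::
  "(real^'n \<Rightarrow> real^'n^'n::finite) \<Rightarrow> 'n \<Rightarrow> 'n \<Rightarrow> 'n \<Rightarrow> real^'n \<Rightarrow> real" where
  "christoffel G i j m y =
     (1/2) * (\<Sum>p\<in>UNIV. metric_inv G m p y *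
        (partial_deriv i (\<lambda>z. G z $ j $ p) y + partial_deriv j (\<lambda>z. G z $ i $ p) y
         - partial_deriv p (\<lambda>z. G z $ i $ j) y))"

text \<open>The sign is fixed by \<open>\<nabla>\<^sub>j \<nabla>\<^sub>k u\<^sub>l - \<nabla>\<^sub>k \<nabla>\<^sub>j u\<^sub>l = R\<^sub>j\<^sub>k\<^sub>l\<^sup>m u\<^sub>m\<close>; together with
  \<open>R\<^sub>i\<^sub>j = - R\<^sub>k\<^sub>i\<^sub>j\<^sup>k\<close> it makes the Ricci tensor of a round sphere positive.\<close>

definition riemann ::
  "(real^'n \<Rightarrow> real^'n^'n::finite) \<Rightarrow> 'n \<Rightarrow> 'n \<Rightarrow> 'n \<Rightarrow> 'n \<Rightarrow> real^'n \<Rightarrow> real" where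
  "riemann G j k l m y =
     partial_deriv k (christoffel G j l m) y - partial_deriv j (christoffel G k l m) y
     + (\<Sum>p\<in>UNIV. christoffel G j l p y * christoffel G k p m y
               - christoffel G k l p y * christoffel G j p m y)"

definition ricci :: "(real^'n \<Rightarrow> real^'n^'n::finite) \<Rightarrow> 'n \<Rightarrow> 'n \<Rightarrow> real^'n \<Rightarrow> real" where
  "ricci G i j y = - (\<Sum>k\<in>UNIV. riemann G k i j k y)"

definition ricci_mixed :: "(real^'n \<Rightarrow> real^'n^'n::finite) \<Rightarrow> 'n \<Rightarrow> 'n \<Rightarrow> real^'n \<Rightarrow> real" where
  "ricci_mixed G j m y = (\<Sum>p\<in>UNIV. ricci G j p y * metric_inv G p m y)"

definition scalar_curvature :: "(real^'n \<Rightarrow> real^'n^'n::finite) \<Rightarrow> real^'n \<Rightarrow> real" where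
  "scalar_curvature G y = (\<Sum>k\<in>UNIV. ricci_mixed G k k y)"

definition kronecker :: "'n \<Rightarrow> 'n \<Rightarrow> real" where
  "kronecker i j = (if i = j then 1 else 0)"

definition weyl_up ::
  "(real^'n \<Rightarrow> real^'n^'n::finite) \<Rightarrow> 'n \<Rightarrow> 'n \<Rightarrow> 'n \<Rightarrow> 'n \<Rightarrow> real^'n \<Rightarrow> real" where
  "weyl_up G j k l m y =
     (let n = real CARD('n) in
      riemann G j k l m y
      + 1 / (n - 2) *
          (kronecker j m * ricci G k l y - kronecker k m * ricci G j l y
           + G y $ k $ l * ricci_mixed G j m y - G y $ j $ l * ricci_mixed G k m y)
      - scalar_curvature G y *
          ((kronecker j m * G y $ k $ l - kronecker k m * G y $ j $ l) / ((n - 1) * (n - 2))))"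

definition weyl ::
  "(real^'n \<Rightarrow> real^'n^'n::finite) \<Rightarrow> 'n \<Rightarrow> 'n \<Rightarrow> 'n \<Rightarrow> 'n \<Rightarrow> real^'n \<Rightarrow> real" where
  "weyl G j k l m y = (\<Sum>p\<in>UNIV. weyl_up G j k l p y * G y $ p $ m)"

definition nabla_weyl ::
  "(real^'n \<Rightarrow> real^'n^'n::finite) \<Rightarrow> 'n \<Rightarrow> 'n \<Rightarrow> 'n \<Rightarrow> 'n \<Rightarrow> 'n \<Rightarrow> real^'n \<Rightarrow> real" where
  "nabla_weyl G i j k l m y =
     partial_deriv i (weyl G j k l m) y
     - (\<Sum>p\<in>UNIV. christoffel G i j p y * weyl G p k l m y
               + christoffel G i k p y * weyl G j p l m y
               + christoffel G i l p y * weyl G j k p m y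
               + christoffel G i m p y * weyl G j k l p y)"

definition lower_index ::
  "(real^'n \<Rightarrow> real^'n^'n::finite) \<Rightarrow> (real^'n \<Rightarrow> real^'n) \<Rightarrow> 'n \<Rightarrow> real^'n \<Rightarrow> real" where
  "lower_index G v k y = (\<Sum>p\<in>UNIV. G y $ k $ p * v y $ p)"

text \<open>\<open>nabla_covector G u j k\<close> is \<open>\<nabla>\<^sub>j u\<^sub>k\<close>.\<close>

definition nabla_covector ::
  "(real^'n \<Rightarrow> real^'n^'n::finite) \<Rightarrow> ('n \<Rightarrow> real^'n \<Rightarrow> real) \<Rightarrow> 'n \<Rightarrow> 'n \<Rightarrow> real^'n \<Rightarrow> real" where
  "nabla_covector G u j k y =
     partial_deriv j (u k) y - (\<Sum>p\<in>UNIV. christoffel G j k p y * u p y)"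

definition riemann_down ::
  "(real^'n \<Rightarrow> real^'n^'n::finite) \<Rightarrow> 'n \<Rightarrow> 'n \<Rightarrow> 'n \<Rightarrow> 'n \<Rightarrow> real^'n \<Rightarrow> real" where
  "riemann_down G j k l m y = (\<Sum>p\<in>UNIV. riemann G j k l p y * G y $ p $ m)"

text \<open>\<open>riemann_up2 G j k p q\<close> is \<open>R\<^sub>j\<^sub>k\<^sup>p\<^sup>q\<close>.\<close>

definition riemann_up2 ::
  "(real^'n \<Rightarrow> real^'n^'n::finite) \<Rightarrow> 'n \<Rightarrow> 'n \<Rightarrow> 'n \<Rightarrow> 'n \<Rightarrow> real^'n \<Rightarrow> real" where
  "riemann_up2 G j k p q y = (\<Sum>r\<in>UNIV. metric_inv G p r y * riemann G j k r q y)"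


subsection \<open>Conformally recurrent manifolds\<close>

locale conformally_recurrent_manifold = pseudo_riemannian_manifold X A g
  for X :: "'a topology" and A :: "('a, 'n::finite) chart set" and g +
  assumes dim_ge_4: "CARD('n) \<ge> 4"
    and weyl_nonzero: "c \<in> A \<Longrightarrow> y \<in> chart_im c \<Longrightarrow> \<exists>j k l m. weyl (g c) j k l m y \<noteq> 0"
    and recurrence: "\<exists>\<alpha>. one_form A \<alpha> \<and> (\<exists>c\<in>A. \<exists>y\<in>chart_im c. \<alpha> c y \<noteq> 0) \<and>
      (\<forall>c\<in>A. \<forall>y\<in>chart_im c. \<forall>i j k l m.
         nabla_weyl (g c) i j k l m y = \<alpha> c y $ i * weyl (g c) j k l m y)"

definition conformally_symmetric ::
  "('a, 'n::finite) chart set \<Rightarrow> ('a, 'n) matrix_comps \<Rightarrow> bool" where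
  "conformally_symmetric A g \<longleftrightarrow>
     (\<forall>c\<in>A. \<forall>y\<in>chart_im c. \<forall>i j k l m. nabla_weyl (g c) i j k l m y = 0)"

text \<open>The components of \<open>e\<^bsup>2\<sigma>\<^esup> g\<close>.\<close>

definition conformal_metric ::
  "('a \<Rightarrow> real) \<Rightarrow> ('a, 'n::finite) matrix_comps \<Rightarrow> ('a, 'n) matrix_comps" where
  "conformal_metric \<sigma> g c y = exp (2 * \<sigma> (chart_inv c y)) *\<^sub>R g c y"

locale simple_conformally_recurrent_manifold = conformally_recurrent_manifold X A g
  for X :: "'a topology" and A :: "('a, 'n::finite) chart set" and g +
  assumes simple: "x \<in> topspace X \<Longrightarrow>
    \<exists>U \<sigma>. openin X U \<and> x \<in> U \<and> scalar_field (restrict_atlas A U) \<sigma> \<and>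
      conformally_symmetric (restrict_atlas A U) (conformal_metric \<sigma> g)"


subsection \<open>Brinkmann waves and pp-waves\<close>

locale brinkmann_wave = lorentzian_manifold X A g
  for X :: "'a topology" and A :: "('a, 'n::finite) chart set" and g +
  assumes null_parallel_field:
    "\<exists>v. vector_field A v \<and>
      (\<forall>c\<in>A. \<forall>y\<in>chart_im c.
         v c y \<noteq> 0 \<and>
         (\<Sum>i\<in>UNIV. v c y $ i * lower_index (g c) (v c) i y) = 0 \<and>
         (\<forall>j k. nabla_covector (g c) (lower_index (g c) (v c)) j k y = 0))"

locale pp_wave = brinkmann_wave X A g
  for X :: "'a topology" and A :: "('a, 'n::finite) chart set" and g +
  assumes riemann_product: "c \<in> A \<Longrightarrow> y \<in> chart_im c \<Longrightarrow>
    (\<Sum>p\<in>UNIV. \<Sum>q\<in>UNIV. riemann_up2 (g c) j k p q y * riemann_down (g c) p q l m y) = 0"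

end

theory Submission
  imports Defs
begin

text \<open>
  Write \<open>\<beta> = \<alpha> - 2 d\<sigma>\<close> and let \<open>s\<close> be the gradient of \<open>\<sigma>\<close>. Since the Weyl tensor \<open>C\<^sub>j\<^sub>k\<^sub>l\<^sup>m\<close> is
  conformally invariant, conformal symmetry of \<open>e\<^bsup>2\<sigma>\<^esup> g\<close> says that for every \<open>x\<close> the infinitesimal
  rotation \<open>x \<and> s\<close> acts on \<open>C\<close> as the scalar \<open>\<beta>(x)\<close>. As \<open>C \<noteq> 0\<close>, this forces \<open>s\<close> to be null, \<open>C\<close>
  to be of type N with respect to \<open>s\<close>, and \<open>\<beta> = 2 d\<sigma>\<close>; hence \<open>\<alpha> = 4 d\<sigma>\<close>.

  Consequently \<open>C\<^sub>j\<^sub>k\<^sub>l\<^sub>m C\<^sub>p\<^sup>k\<^sub>q\<^sup>m = \<rho> \<sigma>\<^sub>j \<sigma>\<^sub>l \<sigma>\<^sub>p \<sigma>\<^sub>q\<close>, with \<open>\<rho> > 0\<close> by the Lorentzian signature, and this tensor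
  is recurrent with covector \<open>8 d\<sigma>\<close>. So \<open>e\<^bsup>-8\<sigma>\<^esup> \<rho> \<sigma>\<^sub>j \<sigma>\<^sub>l \<sigma>\<^sub>p \<sigma>\<^sub>q\<close> is parallel, and its fourth root is a parallel null
  covector \<open>u\<close> proportional to \<open>d\<sigma>\<close>. The Ricci identity gives \<open>R\<^sub>j\<^sub>k\<^sub>l\<^sup>m u\<^sub>m = 0\<close>; together with the type N
  property this yields \<open>R\<^sub>k\<^sub>l = \<kappa> u\<^sub>k u\<^sub>l\<close> and vanishing scalar curvature, so every term of the Riemann tensor
  carries a factor \<open>u\<close> in each index pair and the product of the Riemann tensor with itself vanishes.
\<close>

subsection \<open>Calculus of smooth functions\<close>

text \<open>The Weyl tensor alone yields no parallel covector: type N leaves a symmetric form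
  transverse to \<open>s\<close>, about which nothing else is known. The quadratic contraction
  collapses this form into the single number \<open>\<rho>\<close>. The form annihilates
  \<open>s\<close> and a vector transversal to \<open>s\<close>; these span a Lorentzian plane whose
  orthogonal complement is spacelike, and this makes \<open>\<rho>\<close> positive. The constants
  are linked: a square doubles the recurrence covector, 8 = 2 * 4, and the fourth root of the
  compensating factor is exp (-2\<sigma>). As \<open>\<rho>\<close> is only obtained point by point,
  the fourth root is written through components of the square, which are smooth, and
  \<open>\<rho>\<close> is never differentiated. The recurrence covector is only known to be
  non-zero somewhere, and d\<sigma> vanishes where it does; hence the domain is sought around such a
  point. The definition of a pp-wave demands a connected domain and speaks about every chart inside
  it. So the chart is shrunk to a coordinate ball, and the field constructed in it is transported to
  all smaller charts, which requires the covariance of the derivative of a covector.\<close>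

lemma partial_deriv_has_derivative:
  "(f has_derivative f') (at y) \<Longrightarrow> partial_deriv i f y = f' (axis i 1)"
  unfolding partial_deriv_def by (metis frechet_derivative_at)

lemma partial_deriv_add:
  "f differentiable at y \<Longrightarrow> g differentiable at y \<Longrightarrow>
    partial_deriv i (\<lambda>x. f x + g x) y = partial_deriv i f y + partial_deriv i g y"
  unfolding frechet_derivative_works
  by (drule (1) has_derivative_add, drule partial_deriv_has_derivative[where i = i])
     (simp add: partial_deriv_def)

lemma partial_deriv_diff:
  "f differentiable at y \<Longrightarrow> g differentiable at y \<Longrightarrow>
    partial_deriv i (\<lambda>x. f x - g x) y = partial_deriv i f y - partial_deriv i g y"
  unfolding frechet_derivative_works
  by (drule (1) has_derivative_diff, drule partial_deriv_has_derivative[where i = i])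
     (simp add: partial_deriv_def)

lemma partial_deriv_mult:
  "f differentiable at y \<Longrightarrow> g differentiable at y \<Longrightarrow>
    partial_deriv i (\<lambda>x. f x * g x) y = f y * partial_deriv i g y + partial_deriv i f y * g y"
  unfolding frechet_derivative_works
  by (drule (1) has_derivative_mult, drule partial_deriv_has_derivative[where i = i])
     (simp add: partial_deriv_def)

lemma partial_deriv_const: "partial_deriv i (\<lambda>x. c) y = 0"
  by (simp add: partial_deriv_has_derivative[OF has_derivative_const])

lemma partial_deriv_sum:
  assumes "\<And>p. p \<in> I \<Longrightarrow> f p differentiable at y"
  shows "partial_deriv i (\<lambda>x. \<Sum>p\<in>I. f p x) y = (\<Sum>p\<in>I. partial_deriv i (f p) y)"
proof -
  have "((\<lambda>x. \<Sum>p\<in>I. f p x) has_derivative (\<lambda>h. \<Sum>p\<in>I. frechet_derivative (f p) (at y) h)) (at y)"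
    using assms by (intro has_derivative_sum) (simp add: frechet_derivative_works)
  then show ?thesis
    by (subst partial_deriv_has_derivative) (auto simp: partial_deriv_def)
qed

lemma partial_deriv_compose_real:
  assumes f: "f differentiable at y" and h: "(h has_real_derivative h') (at (f y))"
  shows "partial_deriv i (\<lambda>x. h (f x)) y = h' * partial_deriv i f y"
proof -
  have "((\<lambda>x. h (f x)) has_derivative (\<lambda>v. h' * frechet_derivative f (at y) v)) (at y)"
    using has_derivative_compose[OF f[unfolded frechet_derivative_works]
        h[unfolded has_field_derivative_def]] by (simp add: mult.commute)
  then show ?thesis
    by (subst partial_deriv_has_derivative) (auto simp: partial_deriv_def)
qed

lemma partial_deriv_minus:
  "f differentiable at y \<Longrightarrow> partial_deriv i (\<lambda>x. - f x) y = - partial_deriv i f y"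
  using partial_deriv_mult[of "\<lambda>_. -1" y f i] by (simp add: partial_deriv_const)

lemma partial_deriv_cmult:
  "f differentiable at y \<Longrightarrow> partial_deriv i (\<lambda>x. c * f x) y = c * partial_deriv i f y"
  using partial_deriv_mult[of "\<lambda>_. c" y f i] by (simp add: partial_deriv_const)

text \<open>No differentiability is assumed: both sides are the same choice, since the two functions
  have the same derivatives at \<open>y\<close>, if any. Identities valid only on an open set can
  thus be differentiated freely.\<close>

lemma frechet_derivative_transform:
  fixes f g :: "real^'n::finite \<Rightarrow> 'b::real_normed_vector"
  assumes "open S" "y \<in> S" "\<And>x. x \<in> S \<Longrightarrow> f x = g x"
  shows "frechet_derivative f (at y) = frechet_derivative g (at y)"
proof -
  have "(f has_derivative D) (at y) \<longleftrightarrow> (g has_derivative D) (at y)" for D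
    using assms by (metis has_derivative_transform_within_open)
  then show ?thesis by (simp add: frechet_derivative_def)
qed

lemma partial_deriv_cong:
  assumes "open S" "y \<in> S" "\<And>x. x \<in> S \<Longrightarrow> f x = g x"
  shows "partial_deriv i f y = partial_deriv i g y"
  unfolding partial_deriv_def using frechet_derivative_transform[OF assms] by simp

lemma differentiable_onD:
  "f differentiable_on S \<Longrightarrow> open S \<Longrightarrow> y \<in> S \<Longrightarrow> f differentiable at y"
  by (simp add: differentiable_on_eq_differentiable_at)

section \<open>Closure properties of the classes C^k and of smooth functions\<close>

lemma Ck_on_cong:
  assumes "open S" "\<And>x. x \<in> S \<Longrightarrow> f x = g x"
  shows "Ck_on k S f \<longleftrightarrow> Ck_on k S g"
  using assms
proof (induction k arbitrary: f g)
  case 0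
  then show ?case by (simp cong: continuous_on_cong)
next
  case (Suc k)
  have "f differentiable_on S \<longleftrightarrow> g differentiable_on S"
    using Suc.prems(2) unfolding differentiable_on_def differentiable_def
    by (metis has_derivative_transform)
  moreover have "Ck_on k S (partial_deriv i f) \<longleftrightarrow> Ck_on k S (partial_deriv i g)" for i
    by (rule Suc.IH[OF Suc.prems(1)]) (rule partial_deriv_cong[OF Suc.prems(1) _ Suc.prems(2)])
  ultimately show ?case by simp
qed

lemma Ck_on_Suc_imp: "Ck_on (Suc k) S f \<Longrightarrow> Ck_on k S f"
proof (induction k arbitrary: f)
  case 0
  then show ?case by (simp add: differentiable_imp_continuous_on)
next
  case (Suc k)
  then show ?case by (metis Ck_on.simps(2))
qed

lemma Ck_on_subset: "Ck_on k S f \<Longrightarrow> T \<subseteq> S \<Longrightarrow> Ck_on k T f"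
  by (induction k arbitrary: f) (auto intro: continuous_on_subset differentiable_on_subset)

lemma Ck_on_const: "Ck_on k S (\<lambda>x. c)"
proof (induction k arbitrary: c)
  case (Suc k)
  have "partial_deriv i (\<lambda>x. c) = (\<lambda>x. 0)" for i :: 'a
    by (rule ext) (simp add: partial_deriv_const)
  then show ?case using Suc by simp
qed simp

lemma Ck_on_add:
  "open S \<Longrightarrow> Ck_on k S f \<Longrightarrow> Ck_on k S g \<Longrightarrow> Ck_on k S (\<lambda>x. f x + g x)"
proof (induction k arbitrary: f g)
  case 0
  then show ?case by (simp add: continuous_on_add)
next
  case (Suc k)
  have "Ck_on k S (partial_deriv i (\<lambda>x. f x + g x))" for i
    using Suc.IH[of "partial_deriv i f" "partial_deriv i g"] Suc.prems
    by (subst Ck_on_cong[where g = "\<lambda>x. partial_deriv i f x + partial_deriv i g x"])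
       (auto simp: partial_deriv_add differentiable_onD)
  then show ?case using Suc.prems by (simp add: differentiable_on_add)
qed

lemma Ck_on_mult:
  "open S \<Longrightarrow> Ck_on k S f \<Longrightarrow> Ck_on k S g \<Longrightarrow> Ck_on k S (\<lambda>x. f x * g x)"
proof (induction k arbitrary: f g)
  case 0
  then show ?case by (simp add: continuous_on_mult)
next
  case (Suc k)
  have "Ck_on k S (\<lambda>x. f x * partial_deriv i g x + partial_deriv i f x * g x)" for i
    using Suc.prems Ck_on_Suc_imp[OF Suc.prems(2)] Ck_on_Suc_imp[OF Suc.prems(3)]
    by (intro Ck_on_add Suc.IH) auto
  then have "Ck_on k S (partial_deriv i (\<lambda>x. f x * g x))" for i
    using Suc.prems
    by (subst Ck_on_cong[where g = "\<lambda>x. f x * partial_deriv i g x + partial_deriv i f x * g x"])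
       (auto simp: partial_deriv_mult differentiable_onD)
  then show ?case using Suc.prems by (simp add: differentiable_on_mult)
qed

lemma smooth_on_cong:
  "open S \<Longrightarrow> (\<And>x. x \<in> S \<Longrightarrow> f x = g x) \<Longrightarrow> smooth_on S f \<longleftrightarrow> smooth_on S g"
  unfolding smooth_on_def using Ck_on_cong by blast

lemma smooth_on_subset: "smooth_on S f \<Longrightarrow> T \<subseteq> S \<Longrightarrow> smooth_on T f"
  unfolding smooth_on_def using Ck_on_subset by blast

lemma smooth_on_const: "smooth_on S (\<lambda>x. c)"
  unfolding smooth_on_def using Ck_on_const by blast

lemma smooth_on_add:
  "open S \<Longrightarrow> smooth_on S f \<Longrightarrow> smooth_on S g \<Longrightarrow> smooth_on S (\<lambda>x. f x + g x)"
  unfolding smooth_on_def using Ck_on_add by blast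

lemma smooth_on_mult:
  "open S \<Longrightarrow> smooth_on S f \<Longrightarrow> smooth_on S g \<Longrightarrow> smooth_on S (\<lambda>x. f x * g x)"
  unfolding smooth_on_def using Ck_on_mult by blast

lemma smooth_on_minus: "open S \<Longrightarrow> smooth_on S f \<Longrightarrow> smooth_on S (\<lambda>x. - f x)"
  using smooth_on_mult[of S "\<lambda>_. -1" f] by (simp add: smooth_on_const)

lemma smooth_on_diff:
  "open S \<Longrightarrow> smooth_on S f \<Longrightarrow> smooth_on S g \<Longrightarrow> smooth_on S (\<lambda>x. f x - g x)"
  using smooth_on_add[of S f "\<lambda>x. - g x"] by (simp add: smooth_on_minus)

lemma smooth_on_sum:
  "open S \<Longrightarrow> (\<And>p. p \<in> I \<Longrightarrow> smooth_on S (f p)) \<Longrightarrow> smooth_on S (\<lambda>x. \<Sum>p\<in>I. f p x)"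
  by (induction I rule: infinite_finite_induct) (auto simp: smooth_on_const smooth_on_add)

lemma smooth_on_prod:
  "open S \<Longrightarrow> (\<And>p. p \<in> I \<Longrightarrow> smooth_on S (f p)) \<Longrightarrow> smooth_on S (\<lambda>x. \<Prod>p\<in>I. f p x)"
  by (induction I rule: infinite_finite_induct) (auto simp: smooth_on_const smooth_on_mult)

lemma smooth_on_partial_deriv: "smooth_on S f \<Longrightarrow> smooth_on S (partial_deriv i f)"
  unfolding smooth_on_def by (metis Ck_on.simps(2))

lemma smooth_on_differentiable_on: "smooth_on S f \<Longrightarrow> f differentiable_on S"
  unfolding smooth_on_def by (metis Ck_on.simps(2))

lemma smooth_on_differentiable:
  "smooth_on S f \<Longrightarrow> open S \<Longrightarrow> y \<in> S \<Longrightarrow> f differentiable at y"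
  using smooth_on_differentiable_on differentiable_onD by blast

lemma smooth_on_continuous_on: "smooth_on S f \<Longrightarrow> continuous_on S f"
  unfolding smooth_on_def by (metis Ck_on.simps(1))

lemma differentiable_compose_real:
  assumes "f differentiable at y" "(h has_real_derivative h') (at (f y))"
  shows "(\<lambda>x. h (f x)) differentiable at y"
  using has_derivative_compose[OF assms(1)[unfolded frechet_derivative_works]
        assms(2)[unfolded has_field_derivative_def]] by (blast intro: differentiableI)

text \<open>The hypothesis \<open>step\<close> stands for the smoothness of \<open>h\<close>: the
  derivative of \<open>exp\<close> or \<open>inverse\<close> is a polynomial in the function itself,
  and that of \<open>ln\<close> is \<open>inverse\<close>, treated before. So the induction on
  \<open>k\<close> closes without iterated derivatives of \<open>h\<close>.\<close>

lemma smooth_on_composeI: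
  fixes f :: "real^'n::finite \<Rightarrow> real"
  assumes S: "open S" and f: "smooth_on S f"
    and h: "\<And>x. x \<in> S \<Longrightarrow> (h has_real_derivative h' (f x)) (at (f x))"
    and step: "\<And>k. Ck_on k S (\<lambda>x. h (f x)) \<Longrightarrow> Ck_on k S (\<lambda>x. h' (f x))"
  shows "smooth_on S (\<lambda>x. h (f x))"
proof -
  have d: "(\<lambda>x. h (f x)) differentiable at x" if "x \<in> S" for x
    by (rule differentiable_compose_real[OF smooth_on_differentiable[OF f S that] h[OF that]])
  have "Ck_on k S (\<lambda>x. h (f x))" for k
  proof (induction k)
    case 0
    have "(\<lambda>x. h (f x)) differentiable_on S"
      using d by (simp add: differentiable_on_eq_differentiable_at[OF S])
    then show ?case by (simp add: differentiable_imp_continuous_on)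
  next
    case (Suc k)
    have "Ck_on k S (\<lambda>x. h' (f x) * partial_deriv i f x)" for i
      using step[OF Suc] smooth_on_partial_deriv[OF f, of i]
      by (intro Ck_on_mult S) (auto simp: smooth_on_def)
    moreover have "partial_deriv i (\<lambda>x. h (f x)) x = h' (f x) * partial_deriv i f x"
      if "x \<in> S" for i x
      by (rule partial_deriv_compose_real[OF smooth_on_differentiable[OF f S that] h[OF that]])
    ultimately have "Ck_on k S (partial_deriv i (\<lambda>x. h (f x)))" for i
      by (subst Ck_on_cong[OF S]) auto
    then show ?case using d by (simp add: differentiable_on_eq_differentiable_at[OF S])
  qed
  then show ?thesis by (simp add: smooth_on_def)
qed

lemma smooth_on_exp: "open S \<Longrightarrow> smooth_on S f \<Longrightarrow> smooth_on S (\<lambda>x. exp (f x))"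
  by (rule smooth_on_composeI[where h = exp and f = f and h' = exp]) (auto intro: DERIV_exp)

lemma smooth_on_inverse:
  assumes "open S" "smooth_on S f" "\<And>x. x \<in> S \<Longrightarrow> f x \<noteq> 0"
  shows "smooth_on S (\<lambda>x. inverse (f x))"
proof (rule smooth_on_composeI[where h = inverse and f = f and h' = "\<lambda>t. - 1 * (inverse t * inverse t)"])
  fix x assume "x \<in> S"
  then show "(inverse has_real_derivative - 1 * (inverse (f x) * inverse (f x))) (at (f x))"
    using assms(3) DERIV_inverse by (auto simp: power2_eq_square)
next
  fix k assume "Ck_on k S (\<lambda>x. inverse (f x))"
  then show "Ck_on k S (\<lambda>x. - 1 * (inverse (f x) * inverse (f x)))"
    by (intro Ck_on_mult Ck_on_const assms)
qed (use assms in auto)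

lemma smooth_on_divide:
  "open S \<Longrightarrow> smooth_on S f \<Longrightarrow> smooth_on S g \<Longrightarrow> (\<And>x. x \<in> S \<Longrightarrow> g x \<noteq> 0) \<Longrightarrow>
    smooth_on S (\<lambda>x. f x / g x)"
  unfolding divide_inverse by (intro smooth_on_mult smooth_on_inverse)

lemma smooth_on_powr:
  assumes "open S" "smooth_on S f" "\<And>x. x \<in> S \<Longrightarrow> f x > 0"
  shows "smooth_on S (\<lambda>x. f x powr a)"
proof -
  have "smooth_on S (\<lambda>x. ln (f x))"
  proof (rule smooth_on_composeI[where h = ln and f = f and h' = inverse])
    fix k show "Ck_on k S (\<lambda>x. inverse (f x))"
      using smooth_on_inverse[OF assms(1,2)] assms(3) by (force simp: smooth_on_def)
  qed (use assms in \<open>auto intro: DERIV_ln simp del: DERIV_inverse\<close>)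
  then have "smooth_on S (\<lambda>x. exp (a * ln (f x)))"
    by (intro smooth_on_exp smooth_on_mult smooth_on_const assms)
  then show ?thesis
    using assms by (subst smooth_on_cong[where g = "\<lambda>x. exp (a * ln (f x))"])
      (auto simp: powr_def less_imp_neq[symmetric])
qed

lemma partial_deriv_powr:
  assumes "f differentiable at y" "f y > 0"
  shows "partial_deriv i (\<lambda>x. f x powr a) y = a * f y powr (a - 1) * partial_deriv i f y"
  using partial_deriv_compose_real[OF assms(1) has_real_derivative_powr[OF assms(2)]] .

lemma partial_deriv_exp:
  assumes "f differentiable at y"
  shows "partial_deriv i (\<lambda>x. exp (f x)) y = exp (f y) * partial_deriv i f y"
  using partial_deriv_compose_real[OF assms DERIV_exp] .

section \<open>The chain rule in several variables\<close>

lemma frechet_derivative_vec_nth: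
  fixes \<phi> :: "real^'n::finite \<Rightarrow> real^'m::finite"
  assumes "\<And>k. (\<lambda>y. \<phi> y $ k) differentiable at x"
  shows "(\<phi> has_derivative (\<lambda>h. \<chi> k. frechet_derivative (\<lambda>y. \<phi> y $ k) (at x) h)) (at x)"
proof -
  have "((\<lambda>y. \<phi> y $ k) has_derivative frechet_derivative (\<lambda>y. \<phi> y $ k) (at x)) (at x)" for k
    using assms by (simp add: frechet_derivative_works)
  then show ?thesis
    by (subst has_derivative_componentwise_within)
       (auto simp: Basis_vec_def inner_axis)
qed

lemma linear_eq_sum_axis:
  fixes f :: "real^'n::finite \<Rightarrow> real"
  assumes "linear f"
  shows "f v = (\<Sum>k\<in>UNIV. v $ k * f (axis k 1))"
proof -
  have "f v = f (\<Sum>k\<in>UNIV. v $ k *\<^sub>R axis k 1)"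
    using basis_expansion[of v] by (simp add: scalar_mult_eq_scaleR)
  also have "\<dots> = (\<Sum>k\<in>UNIV. v $ k * f (axis k 1))"
    using assms by (simp add: linear_sum linear_cmul o_def)
  finally show ?thesis .
qed

lemma has_derivative_compose_vec:
  fixes \<phi> :: "real^'n::finite \<Rightarrow> real^'m::finite"
  assumes "f differentiable at (\<phi> x)" and "\<And>k. (\<lambda>y. \<phi> y $ k) differentiable at x"
  shows "((\<lambda>y. f (\<phi> y)) has_derivative (\<lambda>h. frechet_derivative f (at (\<phi> x))
      (\<chi> k. frechet_derivative (\<lambda>y. \<phi> y $ k) (at x) h))) (at x)"
  using has_derivative_compose[OF frechet_derivative_vec_nth[OF assms(2)]
      assms(1)[unfolded frechet_derivative_works]] .

lemma partial_deriv_compose: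
  fixes \<phi> :: "real^'n::finite \<Rightarrow> real^'m::finite"
  assumes "f differentiable at (\<phi> x)" and "\<And>k. (\<lambda>y. \<phi> y $ k) differentiable at x"
  shows "partial_deriv i (\<lambda>y. f (\<phi> y)) x =
    (\<Sum>k\<in>UNIV. partial_deriv k f (\<phi> x) * partial_deriv i (\<lambda>y. \<phi> y $ k) x)"
proof -
  have l: "linear (frechet_derivative f (at (\<phi> x)))"
    using assms(1) linear_frechet_derivative by blast
  show ?thesis
    by (subst partial_deriv_has_derivative[OF has_derivative_compose_vec[OF assms]],
        subst linear_eq_sum_axis[OF l]) (simp add: partial_deriv_def mult.commute)
qed

lemma Ck_on_sum:
  "open S \<Longrightarrow> (\<And>p. p \<in> I \<Longrightarrow> Ck_on k S (f p)) \<Longrightarrow> Ck_on k S (\<lambda>x. \<Sum>p\<in>I. f p x)"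
  by (induction I rule: infinite_finite_induct) (auto simp: Ck_on_const Ck_on_add)

text \<open>Induction over the order for all \<open>f\<close> at once: the chain rule writes a first
  derivative of the composite as a sum of products of derivatives of \<phi> with derivatives of
  \<open>f\<close> composed with \<phi>, and the latter fall under the induction hypothesis.\<close>

lemma smooth_on_compose:
  fixes \<phi> :: "real^'n::finite \<Rightarrow> real^'m::finite"
  assumes S: "open S" and T: "open T" and sub: "\<phi> ` S \<subseteq> T"
    and \<phi>: "\<And>k. smooth_on S (\<lambda>y. \<phi> y $ k)" and f: "smooth_on T f"
  shows "smooth_on S (\<lambda>y. f (\<phi> y))"
proof -
  have d: "(\<lambda>y. f (\<phi> y)) differentiable at x" if "f differentiable_on T" "x \<in> S" for f x
  proof -
    have "f differentiable at (\<phi> x)" using that T sub differentiable_onD by blast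
    from has_derivative_compose_vec[of f \<phi> x, OF this] show ?thesis
      using smooth_on_differentiable[OF \<phi> S that(2)] by (auto simp: differentiable_def)
  qed
  have "Ck_on k T f \<Longrightarrow> Ck_on k S (\<lambda>y. f (\<phi> y))" for k
  proof (induction k arbitrary: f)
    case 0
    have "continuous_on S (\<lambda>y. \<chi> k. \<phi> y $ k)"
      using \<phi> smooth_on_continuous_on by (intro continuous_on_vec_lambda) blast
    then have "continuous_on S \<phi>" by simp
    with 0 show ?case using sub by (simp add: continuous_on_compose2)
  next
    case (Suc k)
    have "Ck_on k S (\<lambda>x. \<Sum>m\<in>UNIV. partial_deriv m f (\<phi> x) * partial_deriv i (\<lambda>y. \<phi> y $ m) x)" for i
      using Suc smooth_on_partial_deriv[OF \<phi>]
      by (intro Ck_on_sum Ck_on_mult S) (auto simp: smooth_on_def)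
    moreover have "partial_deriv i (\<lambda>y. f (\<phi> y)) x =
        (\<Sum>m\<in>UNIV. partial_deriv m f (\<phi> x) * partial_deriv i (\<lambda>y. \<phi> y $ m) x)" if "x \<in> S" for i x
      by (rule partial_deriv_compose)
        (use that Suc.prems sub T differentiable_onD smooth_on_differentiable[OF \<phi> S] in auto)
    ultimately have "Ck_on k S (partial_deriv i (\<lambda>y. f (\<phi> y)))" for i
      by (subst Ck_on_cong[OF S]) auto
    moreover have "f differentiable_on T" using Suc.prems by simp
    ultimately show ?case using d[of f] by (simp add: differentiable_on_eq_differentiable_at[OF S])
  qed
  then show ?thesis using f by (simp add: smooth_on_def)
qed

section \<open>Symmetry of second partial derivatives\<close>

lemma partial_deriv_line:
  assumes "f differentiable at (p + t *\<^sub>R axis i 1)"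
  shows "((\<lambda>t. f (p + t *\<^sub>R axis i 1)) has_real_derivative partial_deriv i f (p + t *\<^sub>R axis i 1)) (at t)"
proof -
  let ?D = "frechet_derivative f (at (p + t *\<^sub>R axis i 1))"
  have l: "linear ?D" using assms linear_frechet_derivative by blast
  have "((\<lambda>t. p + t *\<^sub>R axis i (1::real)) has_derivative (\<lambda>h. h *\<^sub>R axis i 1)) (at t)"
    by (auto intro!: derivative_eq_intros)
  from has_derivative_compose[OF this assms[unfolded frechet_derivative_works]]
  have "((\<lambda>t. f (p + t *\<^sub>R axis i 1)) has_derivative (\<lambda>h. ?D (h *\<^sub>R axis i 1))) (at t)" .
  moreover have "(\<lambda>h. ?D (h *\<^sub>R axis i 1)) = (\<lambda>h. partial_deriv i f (p + t *\<^sub>R axis i 1) * h)"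
    using l by (auto simp: partial_deriv_def linear_cmul)
  ultimately show ?thesis by (simp add: has_field_derivative_def)
qed

text \<open>The mean value theorem is used twice: along \<open>i\<close> for the increment of
  \<open>f\<close> in direction \<open>j\<close>, then along \<open>j\<close> for
  \<open>partial_deriv i f\<close>.\<close>

lemma second_difference_mean_value:
  fixes f :: "real^'n::finite \<Rightarrow> real"
  assumes f: "smooth_on S f" and S: "open S" and h: "h > 0"
    and sub: "\<And>a b. 0 \<le> a \<Longrightarrow> a \<le> h \<Longrightarrow> 0 \<le> b \<Longrightarrow> b \<le> h \<Longrightarrow> x + a *\<^sub>R axis i 1 + b *\<^sub>R axis j 1 \<in> S"
  obtains a b where "0 < a" "a < h" "0 < b" "b < h"
    "f (x + h *\<^sub>R axis i 1 + h *\<^sub>R axis j 1) - f (x + h *\<^sub>R axis i 1) - (f (x + h *\<^sub>R axis j 1) - f x)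
      = h * (h * partial_deriv j (partial_deriv i f) (x + a *\<^sub>R axis i 1 + b *\<^sub>R axis j 1))"
proof -
  define \<phi> where "\<phi> t = f ((x + h *\<^sub>R axis j 1) + t *\<^sub>R axis i 1) - f (x + t *\<^sub>R axis i 1)" for t
  have d: "(\<phi> has_real_derivative partial_deriv i f ((x + h *\<^sub>R axis j 1) + t *\<^sub>R axis i 1)
      - partial_deriv i f (x + t *\<^sub>R axis i 1)) (at t)" if "0 \<le> t" "t \<le> h" for t
    unfolding \<phi>_def
    using sub[of t h] sub[of t 0] that h smooth_on_differentiable[OF f S]
    by (intro DERIV_diff partial_deriv_line) (auto simp: algebra_simps)
  obtain a where a: "0 < a" "a < h" and ae: "\<phi> h - \<phi> 0 = (h - 0) * (partial_deriv i f ((x + h *\<^sub>R axis j 1) + a *\<^sub>R axis i 1)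
      - partial_deriv i f (x + a *\<^sub>R axis i 1))"
    using MVT2[OF h d] by blast
  define \<psi> where "\<psi> t = partial_deriv i f ((x + a *\<^sub>R axis i 1) + t *\<^sub>R axis j 1)" for t
  have e: "(\<psi> has_real_derivative partial_deriv j (partial_deriv i f) ((x + a *\<^sub>R axis i 1) + t *\<^sub>R axis j 1)) (at t)"
    if "0 \<le> t" "t \<le> h" for t
    unfolding \<psi>_def
    using sub[of a t] that a smooth_on_differentiable[OF smooth_on_partial_deriv[OF f] S]
    by (intro partial_deriv_line) (auto simp: algebra_simps)
  obtain b where b: "0 < b" "b < h" and be: "\<psi> h - \<psi> 0 = (h - 0) * partial_deriv j (partial_deriv i f) ((x + a *\<^sub>R axis i 1) + b *\<^sub>R axis j 1)"
    using MVT2[OF h e] by blast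
  from that[OF a b] ae be show thesis
    by (simp add: \<phi>_def \<psi>_def algebra_simps)
qed

text \<open>Schwarz's theorem. The second difference over a small square is symmetric in
  \<open>i\<close> and \<open>j\<close>, and divided by the area it is a value of either mixed
  derivative near \<open>x\<close>. Continuity then excludes different values at
  \<open>x\<close>.\<close>

lemma partial_deriv_commute:
  fixes f :: "real^'n::finite \<Rightarrow> real"
  assumes f: "smooth_on S f" and S: "open S" and x: "x \<in> S"
  shows "partial_deriv i (partial_deriv j f) x = partial_deriv j (partial_deriv i f) x"
proof (rule ccontr)
  let ?A = "partial_deriv j (partial_deriv i f)" and ?B = "partial_deriv i (partial_deriv j f)"
  assume ne: "?B x \<noteq> ?A x"
  define e where "e = \<bar>?A x - ?B x\<bar> / 2"
  have e: "e > 0" using ne by (simp add: e_def)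
  have "continuous_on S ?A" "continuous_on S ?B"
    by (intro smooth_on_continuous_on smooth_on_partial_deriv f)+
  then have "isCont ?A x" "isCont ?B x"
    using S x continuous_on_eq_continuous_at by blast+
  then obtain d1 d2 where d1: "d1 > 0" "\<And>y. dist y x < d1 \<Longrightarrow> dist (?A y) (?A x) < e"
    and d2: "d2 > 0" "\<And>y. dist y x < d2 \<Longrightarrow> dist (?B y) (?B x) < e"
    using e by (metis continuous_at_eps_delta)
  obtain d3 where d3: "d3 > 0" "\<And>y. dist y x < d3 \<Longrightarrow> y \<in> S"
    using S x open_dist by blast
  \<comment> \<open>Points of the square have distance at most \<open>2 * h\<close> from
    \<open>x\<close>, so a third of the smallest radius is enough.\<close>
  define h where "h = min d1 (min d2 d3) / 3"
  have h: "h > 0" using d1 d2 d3 by (simp add: h_def)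
  have near: "dist (x + a *\<^sub>R axis i 1 + b *\<^sub>R axis j 1) x < d1 \<and> dist (x + a *\<^sub>R axis i 1 + b *\<^sub>R axis j 1) x < d2
      \<and> dist (x + a *\<^sub>R axis i 1 + b *\<^sub>R axis j 1) x < d3"
    if "0 \<le> a" "a \<le> h" "0 \<le> b" "b \<le> h" for a b and i j :: 'n
  proof -
    have "dist (x + a *\<^sub>R axis i 1 + b *\<^sub>R axis j 1) x = norm (a *\<^sub>R axis i 1 + b *\<^sub>R axis j (1::real))"
      by (simp add: dist_norm algebra_simps)
    also have "\<dots> \<le> norm (a *\<^sub>R axis i (1::real)) + norm (b *\<^sub>R axis j (1::real))" by (rule norm_triangle_ineq)
    also have "\<dots> \<le> 2 * h" using that by simp
    finally show ?thesis using h unfolding h_def by linarith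
  qed
  have sub: "x + a *\<^sub>R axis i 1 + b *\<^sub>R axis j 1 \<in> S"
    if "0 \<le> a" "a \<le> h" "0 \<le> b" "b \<le> h" for a b and i j :: 'n
    using near[OF that] d3 by blast
  obtain a b where ab: "0 < a" "a < h" "0 < b" "b < h"
    "f (x + h *\<^sub>R axis i 1 + h *\<^sub>R axis j 1) - f (x + h *\<^sub>R axis i 1) - (f (x + h *\<^sub>R axis j 1) - f x)
      = h * (h * ?A (x + a *\<^sub>R axis i 1 + b *\<^sub>R axis j 1))"
    using second_difference_mean_value[OF f S h sub] by blast
  obtain a' b' where ab': "0 < a'" "a' < h" "0 < b'" "b' < h"
    "f (x + h *\<^sub>R axis j 1 + h *\<^sub>R axis i 1) - f (x + h *\<^sub>R axis j 1) - (f (x + h *\<^sub>R axis i 1) - f x)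
      = h * (h * ?B (x + a' *\<^sub>R axis j 1 + b' *\<^sub>R axis i 1))"
    using second_difference_mean_value[OF f S h sub] by blast
  have "h * (h * ?A (x + a *\<^sub>R axis i 1 + b *\<^sub>R axis j 1)) = h * (h * ?B (x + a' *\<^sub>R axis j 1 + b' *\<^sub>R axis i 1))"
    using ab(5) ab'(5) by (simp add: algebra_simps)
  then have "?A (x + a *\<^sub>R axis i 1 + b *\<^sub>R axis j 1) = ?B (x + a' *\<^sub>R axis j 1 + b' *\<^sub>R axis i 1)"
    using h by simp
  moreover have "dist (?A (x + a *\<^sub>R axis i 1 + b *\<^sub>R axis j 1)) (?A x) < e"
    using d1(2) near[of a b i j] ab by simp
  moreover have "dist (?B (x + a' *\<^sub>R axis j 1 + b' *\<^sub>R axis i 1)) (?B x) < e"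
    using d2(2) near[of a' b' j i] ab' by simp
  ultimately show False unfolding e_def dist_real_def by argo
qed

subsection \<open>Algebra of the recurrence condition\<close>

text \<open>The classical octahedron argument: the cyclic identities for the four rotations of the
  arguments, combined with the antisymmetries, leave only the two terms of the claim.\<close>

lemma curvature_pair_symmetry:
  fixes C :: "'i \<Rightarrow> 'i \<Rightarrow> 'i \<Rightarrow> 'i \<Rightarrow> real"
  assumes anti12: "\<And>x y z w. C x y z w = - C y x z w"
    and anti34: "\<And>x y z w. C x y z w = - C x y w z"
    and cyclic: "\<And>x y z w. C x y z w + C y z x w + C z x y w = 0"
  shows "C x y z w = C z w x y"
  using cyclic[of x y z w] cyclic[of y z w x] cyclic[of z w x y] cyclic[of w x y z]
    anti12[of x y z w] anti12[of z x y w] anti12[of w x y z] anti12[of z w x y]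
    anti12[of w y z x] anti12[of y z x w] anti34[of z x y w] anti34[of x y z w]
    anti34[of z w x y] anti34[of y z w x] anti12[of w x z y] anti34[of w x y z]
    anti34[of y w z x] anti12[of y w x z] anti34[of w y z x] anti12[of x z w y]
  by argo

text \<open>Pointwise algebra: \<open>t\<close> is the gradient of \<sigma>, \<open>b\<close> the
  vector dual to \<alpha> - 2 d\<sigma>, and \<open>recurrence\<close> the action of the rotation
  built from \<open>v\<close> and \<open>t\<close>. The identity \<open>trace\<close> is a
  contraction of \<open>recurrence\<close>; it is stated separately because an abstract vector space
  offers no basis to contract over.\<close>

locale recurrent_curvature_form =
  fixes C :: "'v::real_vector \<Rightarrow> 'v \<Rightarrow> 'v \<Rightarrow> 'v \<Rightarrow> real"
    and q :: "'v \<Rightarrow> 'v \<Rightarrow> real" and t b :: 'v and n :: real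
  assumes C_add: "C (x + x') y z w = C x y z w + C x' y z w"
    and C_scale: "C (r *\<^sub>R x) y z w = r * C x y z w"
    and C_anti12: "C x y z w = - C y x z w"
    and C_anti34: "C x y z w = - C x y w z"
    and C_cyclic: "C x y z w + C y z x w + C z x y w = 0"
    and C_nonzero: "\<exists>x y z w. C x y z w \<noteq> 0"
    and q_add: "q (x + x') y = q x y + q x' y"
    and q_scale: "q (r *\<^sub>R x) y = r * q x y"
    and q_sym: "q x y = q y x"
    and q_nondegenerate: "(\<And>x. q u x = 0) \<Longrightarrow> u = 0"
    and t_nonzero: "t \<noteq> 0"
    and n_ge: "n \<ge> 4"
    and trace: "C b y z w = (1 - n) * C t y z w"
    and recurrence: "q b v * C x y z w =
      q t x * C v y z w + q t y * C x v z w + q t z * C x y v w + q t w * C x y z v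
      - q v x * C t y z w - q v y * C x t z w - q v z * C x y t w - q v w * C x y z t"
begin

lemma q_add_right: "q y (x + x') = q y x + q y x'"
  using q_add q_sym by metis

lemma q_scale_right: "q y (r *\<^sub>R x) = r * q y x"
  using q_scale q_sym by metis

lemma q_diff: "q (x - y) z = q x z - q y z"
  using q_add[of "x - y" y z] by simp

lemma q_diff_right: "q z (x - y) = q z x - q z y"
  using q_diff q_sym by metis

lemma C_pair: "C x y z w = C z w x y"
  by (rule curvature_pair_symmetry[where C = C, OF C_anti12 C_anti34 C_cyclic])

lemma C_diff: "C (x - x') y z w = C x y z w - C x' y z w"
  using C_add[of "x - x'" x'] by simp

lemma C_same12: "C x x z w = 0"
  using C_anti12[of x x z w] by simp

lemma C_same34: "C x y z z = 0"
  using C_anti34[of x y z z] by simp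

lemma C_zero: "C 0 y z w = 0"
  using C_scale[of 0] by simp

lemma C_lin2: "C y (x + x') z w = C y x z w + C y x' z w"
  "C y (r *\<^sub>R x) z w = r * C y x z w" "C y (x - x') z w = C y x z w - C y x' z w"
  using C_anti12[of y _ z w] by (simp_all add: C_add C_scale C_diff)

lemma C_lin34: "C y z (x + x') w = C y z x w + C y z x' w"
  "C y z (r *\<^sub>R x) w = r * C y z x w" "C y z (x - x') w = C y z x w - C y z x' w"
  "C y z w (x + x') = C y z w x + C y z w x'"
  "C y z w (r *\<^sub>R x) = r * C y z w x" "C y z w (x - x') = C y z w x - C y z w x'"
  unfolding C_pair[of y z] by (simp_all add: C_add C_scale C_diff C_lin2)

lemmas C_linear = C_add C_scale C_diff C_lin2 C_lin34

text \<open>With \<open>v\<close> equal to the repeated argument \<open>x\<close>, each non-zero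
  replacement term meets its own negative among the metric terms.\<close>

lemma F_same: "q b x * C t x t x = 0"
  using recurrence[of x t x t x] q_sym[of x t] C_same12 C_same34 by (simp add: algebra_simps)

text \<open>By \<open>F_same\<close> the quadratic form \<open>C t y t y\<close> vanishes off the
  hyperplane \<open>q b y = 0\<close>, and polarisation does the rest. For \<open>b = 0\<close>
  there is no such hyperplane, and \<open>trace\<close> steps in.\<close>

lemma F_zero: "C t y t w = 0"
proof (cases "b = 0")
  case True
  then have "(1 - n) * C t y t w = 0" using trace[of y t w] C_zero by simp
  then show ?thesis using n_ge by simp
next
  case False
  then obtain x0 where x0: "q b x0 \<noteq> 0" using q_nondegenerate by metis
  have sym: "C t x t y = C t y t x" for x y by (rule C_pair)
  have "C t y t y = 0" for y
  proof (cases "q b y = 0")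
    case True
    \<comment> \<open>Both \<open>x0 + y\<close> and \<open>x0 - y\<close> avoid the hyperplane;
      adding the quadratic form at the two points removes the cross terms.\<close>
    have "q b (x0 + y) * C t (x0 + y) t (x0 + y) = 0" "q b (x0 - y) * C t (x0 - y) t (x0 - y) = 0"
      by (rule F_same)+
    then have "C t (x0 + y) t (x0 + y) = 0" "C t (x0 - y) t (x0 - y) = 0"
      using True x0 by (auto simp: q_add_right q_diff_right)
    then show ?thesis using F_same[of x0] x0 sym[of x0 y] by (simp add: C_linear)
  qed (use F_same[of y] in simp)
  from this[of "y + w"] this[of y] this[of w] show ?thesis using sym[of y w] by (simp add: C_linear)
qed

lemma C_zero_absurd: "(\<And>x y z w. C x y z w = 0) \<Longrightarrow> False"
  using C_nonzero by blast

lemma D_cyclic: "C t x y z + C t y z x + C t z x y = 0"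
  using C_cyclic[of x y z t] C_pair[of x y z t] C_pair[of y z x t] C_pair[of z x y t]
    C_anti12[of z t x y] C_anti12[of x t y z] C_anti12[of y t z x]
  by argo

text \<open>If \<open>q t t\<close> were non-zero, two arguments \<open>t\<close> in
  \<open>recurrence\<close> would make \<open>C t\<close> antisymmetric in its second and fourth
  arguments, hence totally antisymmetric in the last three, and the cyclic identity would kill it.
  Then a single argument \<open>t\<close> gives \<open>q t t * C v y z w = 0\<close>.\<close>

lemma null: "q t t = 0"
proof (rule ccontr)
  assume ne: "q t t \<noteq> 0"
  have D: "C t y z w = 0" for y z w
  proof -
    have e: "q t t * (C v y t w + C t y v w) = 0" for v y w
      using recurrence[of v t y t w] q_sym[of v t] F_zero[of y w] F_zero[of v w] F_zero[of y v]
        C_same12[of t] C_same34[of t]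
      by (simp add: algebra_simps)
    then have "C t w v y + C t y v w = 0" for v y w
      using ne C_pair[of v y t w] e[of v y w] by simp
    from this[of w z y] this[of z y w] this[of z w y] this[of y z w] D_cyclic[of y z w]
    show ?thesis
      using C_anti34[of t w z y] C_anti34[of t y z w] C_anti34[of t z y w] C_anti34[of t w y z]
      by argo
  qed
  have "q t t * C v y z w = 0" for v y z w
    using recurrence[of v t y z w] D C_same12[of t] C_pair[of t y t w] C_anti34[of t y z t]
    by simp
  then show False using ne C_zero_absurd by simp
qed

text \<open>A non-zero \<open>C t\<close> confines \<open>q b x\<close> to the multiples -1, 0, 1 of
  \<open>q t x\<close>. Hence \<open>b = c *\<^sub>R t\<close> for such a \<open>c\<close>, whereas
  \<open>trace\<close> demands \<open>c = 1 - n\<close>, which is at most -3.\<close>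

lemma D_zero: "C t y z w = 0"
proof (rule ccontr)
  assume ne: "C t y z w \<noteq> 0"
  have rec: "(q b v + q t v) * C t y z w = q t y * C t v z w + q t z * C t y v w + q t w * C t y z v"
    for v y z w
    using recurrence[of v t y z w] null F_zero[of y] C_anti34[of t y z t] C_same12[of t]
      q_sym[of v t] F_zero[of y w] F_zero[of y z]
    by (simp add: algebra_simps)
  \<comment> \<open>Replacing a slot by \<open>x\<close> acts with eigenvalues \<open>0, q t x, 2 q t x\<close> on forms antisymmetric in two slots.\<close>
  have mult: "q b x = - q t x \<or> q b x = 0 \<or> q b x = q t x" for x
  proof (rule ccontr)
    assume "\<not> ?thesis"
    then have c: "q b x + q t x \<noteq> 0" "q b x \<noteq> 0" "q b x - q t x \<noteq> 0" by auto
    have xx: "C t x x w = 0" for w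
    proof -
      have "(q b x - q t x) * C t x x w = 0"
        using rec[of x x x w] C_same34 by (simp add: algebra_simps)
      then show ?thesis using c by simp
    qed
    then have xx': "C t x w x = 0" for w using C_anti34[of t x w x] by simp
    have "q b x * C t x z w = 0" for z w
      using rec[of x x z w] xx xx' by (simp add: algebra_simps)
    then have 1: "C t x z w = 0" for z w using c by simp
    have "q b x * C t y x w = 0" for y w
      using rec[of x y x w] 1 C_same34 by (simp add: algebra_simps)
    then have 2: "C t y x w = 0" for y w using c by simp
    have 3: "C t y z x = 0" for y z using 2 C_anti34[of t y z x] by simp
    show False using rec[of x y z w] 1 2 3 c ne by simp
  qed
  obtain N where N: "q t N \<noteq> 0" using q_nondegenerate t_nonzero by metis
  define c where "c = q b N / q t N"
  have c: "c = -1 \<or> c = 0 \<or> c = 1" using mult[of N] N by (auto simp: c_def)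
  \<comment> \<open>Modulo \<open>N\<close> every vector is orthogonal to \<open>t\<close>, and on
    such vectors all three alternatives of \<open>mult\<close> say that \<open>q b\<close>
    vanishes.\<close>
  have "q (b - c *\<^sub>R t) x = 0" for x
  proof -
    let ?x = "x - (q t x / q t N) *\<^sub>R N"
    have "q t ?x = 0" using N by (simp add: q_diff_right q_scale_right)
    then have "q b ?x = 0" using mult[of ?x] by auto
    then show ?thesis using N by (simp add: q_diff q_scale q_diff_right q_scale_right c_def field_simps)
  qed
  then have "b = c *\<^sub>R t" using q_nondegenerate[of "b - c *\<^sub>R t"] by simp
  then have "(1 - n - c) * C t y z w = 0"
    using trace[of y z w] by (simp add: C_scale algebra_simps)
  then show False using ne c n_ge by auto
qed

lemma recurrence': "q b v * C x y z w =
    q t x * C v y z w + q t y * C x v z w + q t z * C x y v w + q t w * C x y z v"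
  using recurrence[of v x y z w] D_zero C_anti12[of x t z w] C_pair[of x y t w]
    C_anti34[of x y z t] C_pair[of x y t z] by simp

text \<open>For \<open>q t x = 0\<close> the substitution of \<open>x\<close> on the right of
  \<open>recurrence'\<close> is nilpotent, because an argument already replaced by \<open>x\<close>
  is not replaced again. So its eigenvalue \<open>q b x\<close> is zero.\<close>

lemma orthogonal_imp_zero: "q t x = 0 \<Longrightarrow> q b x = 0"
proof (rule ccontr)
  assume t: "q t x = 0" and b: "q b x \<noteq> 0"
  have "q b x * C x y x w = 0" for y w
    using recurrence'[of x x y x w] t C_same12 C_same34 by simp
  then have 1: "C x y x w = 0" for y w using b by simp
  have "q b x * C x y z w = 0" for y z w
    using recurrence'[of x x y z w] t C_same12 1 C_anti34[of x y z x] by simp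
  then have 2: "C x y z w = 0" for y z w using b by simp
  then have "C y x z w = 0" "C y z x w = 0" "C y z w x = 0" for y z w
    using C_anti12[of y x z w] C_pair[of y z x w] C_anti34[of y z w x] by simp_all
  then have "q b x * C x' y z w = 0" for x' y z w using recurrence'[of x x' y z w] 2 by simp
  then show False using b C_zero_absurd by simp
qed

lemma transversal_exists: obtains N where "q t N = 1"
proof -
  obtain N where N: "q t N \<noteq> 0" using q_nondegenerate t_nonzero by metis
  then have "q t ((1 / q t N) *\<^sub>R N) = 1" by (simp add: q_scale_right)
  then show thesis using that by blast
qed

text \<open>For \<open>v\<close> orthogonal to \<open>t\<close> the left side of
  \<open>recurrence'\<close> vanishes, while an argument \<open>N\<close> is traded for
  \<open>v\<close>. Identities for fewer arguments \<open>N\<close> thus follow from the trivial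
  eigenvalue.\<close>

lemma C_orthogonal:
  assumes "q t x = 0" "q t y = 0"
  shows "C x y z w = 0"
proof -
  obtain N where N: "q t N = 1" by (rule transversal_exists)
  have rec: "0 = q t x * C v y z w + q t y * C x v z w + q t z * C x y v w + q t w * C x y z v"
    if "q t v = 0" for v x y z w
    using recurrence'[of v x y z w] orthogonal_imp_zero[OF that] by simp
  have 1: "C x k l m = 0" if "q t x = 0" "q t k = 0" "q t l = 0" "q t m = 0" for x k l m
    using rec[OF that(1), of N k l m] that N by simp
  \<comment> \<open>Two arguments \<open>N\<close> only give a relation exchanging \<open>k\<close>
    and \<open>m\<close>; together with antisymmetry in the last two arguments and the cyclic
    identity it forces zero.\<close>
  have 2: "C N k x m = 0" if "q t x = 0" "q t k = 0" "q t m = 0" for x k m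
  proof -
    have e: "C N m x k + C N k x m = 0" if "q t x = 0" "q t k = 0" "q t m = 0" for x k m
      using rec[OF that(1), of N k N m] that N C_pair[of x k N m] by simp
    have cyc: "C N k x m + C N x m k + C N m k x = 0"
      using C_cyclic[of k x m N] C_pair[of N k x m] C_pair[of N x m k] C_pair[of N m k x]
        C_anti34[of x m k N] C_anti34[of m k x N] C_anti34[of k x m N]
      by argo
    show ?thesis
      using e[of x k m] e[of k m x] e[of m k x] that cyc
        C_anti34[of N m x k] C_anti34[of N k x m] C_anti34[of N x k m]
      by argo
  qed
  define z' w' where "z' = z - q t z *\<^sub>R N" and "w' = w - q t w *\<^sub>R N"
  have o: "q t z' = 0" "q t w' = 0"
    using N by (simp_all add: z'_def w'_def q_diff_right q_scale_right)
  have "z = z' + q t z *\<^sub>R N" "w = w' + q t w *\<^sub>R N" by (simp_all add: z'_def w'_def)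
  then have "C x y z w = C x y (z' + q t z *\<^sub>R N) (w' + q t w *\<^sub>R N)" by simp
  also have "\<dots> = 0"
    using assms o 1 2 C_same34[of x y N] C_pair[of x y N w'] C_anti34[of x y z' N] C_pair[of x y N z']
    by (simp add: C_linear)
  finally show ?thesis .
qed

text \<open>Split \<open>x\<close> and \<open>y\<close> along \<open>N\<close>: the two parts
  orthogonal to \<open>t\<close> contribute nothing by \<open>C_orthogonal\<close>.\<close>

lemma type_N:
  assumes N: "q t N = 1"
  shows "C x y z w = q t x * C N y z w - q t y * C N x z w"
proof -
  define x' y' where "x' = x - q t x *\<^sub>R N" and "y' = y - q t y *\<^sub>R N"
  have "C x' y' z w = 0"
    using N by (intro C_orthogonal) (simp_all add: x'_def y'_def q_diff_right q_scale_right)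
  then show ?thesis
    using C_anti12[of x N z w] C_same12[of N z w]
    by (simp add: x'_def y'_def C_linear algebra_simps)
qed

text \<open>By \<open>type_N\<close>, substituting \<open>N\<close> into the two arguments of one
  index pair, weighted by \<open>q t\<close>, reproduces \<open>C\<close> once. There are two index
  pairs, whence the factor 2.\<close>

lemma recurrence_covector: "b = 2 *\<^sub>R t"
proof -
  obtain N where N: "q t N = 1" by (rule transversal_exists)
  have "q b N * C x y z w = 2 * C x y z w" for x y z w
  proof -
    have "C x y z w = q t z * C x y N w + q t w * C x y z N"
      using type_N[OF N, of z w x y] C_pair[of x y z w] C_pair[of N w x y] C_pair[of N z x y]
        C_anti34[of x y z N] by simp
    moreover have "C x y z w = q t x * C N y z w + q t y * C x N z w"
      using type_N[OF N, of x y z w] C_anti12[of x N z w] by simp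
    ultimately show ?thesis using recurrence'[of N x y z w] by simp
  qed
  then have 2: "q b N = 2" using C_nonzero by force
  have "q (b - 2 *\<^sub>R t) x = 0" for x
  proof -
    have "q t (x - q t x *\<^sub>R N) = 0" using N by (simp add: q_diff_right q_scale_right)
    from orthogonal_imp_zero[OF this] show ?thesis
      using 2 by (simp add: q_diff q_scale q_diff_right q_scale_right)
  qed
  then show ?thesis using q_nondegenerate[of "b - 2 *\<^sub>R t"] by simp
qed

end

subsection \<open>Curvature of a metric on an open set\<close>

lemma sum_kronecker:
  fixes w :: "'n::finite \<Rightarrow> real"
  shows "(\<Sum>p\<in>UNIV. kronecker j p * w p) = w j" "(\<Sum>p\<in>UNIV. w p * kronecker j p) = w j"
    "(\<Sum>p\<in>UNIV. kronecker p j * w p) = w j" "(\<Sum>p\<in>UNIV. w p * kronecker p j) = w j"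
proof -
  show 1: "(\<Sum>p\<in>UNIV. kronecker j p * w p) = w j"
    using sum.delta[of UNIV j w] by (simp add: kronecker_def if_distrib[of "\<lambda>u. u * _"] cong: if_cong)
  show "(\<Sum>p\<in>UNIV. w p * kronecker j p) = w j" using 1 by (simp add: mult.commute)
  show 2: "(\<Sum>p\<in>UNIV. kronecker p j * w p) = w j"
    using sum.delta[of UNIV j w] by (simp add: kronecker_def if_distrib[of "\<lambda>u. u * _"] cong: if_cong)
  show "(\<Sum>p\<in>UNIV. w p * kronecker p j) = w j" using 2 by (simp add: mult.commute)
qed

lemma kronecker_sym: "kronecker i j = kronecker j i"
  by (simp add: kronecker_def)

lemma kronecker_same: "kronecker i i = 1"
  by (simp add: kronecker_def)

lemma sum_kronecker_combination:
  fixes w f :: "'n::finite \<Rightarrow> real"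
  shows "(\<Sum>p\<in>UNIV. (kronecker j p * a + kronecker l p * b - c * f p) * w p)
    = a * w j + b * w l - c * (\<Sum>p\<in>UNIV. f p * w p)"
proof -
  have "(\<Sum>p\<in>UNIV. (kronecker j p * a + kronecker l p * b - c * f p) * w p)
    = (\<Sum>p\<in>UNIV. kronecker j p * (a * w p) + kronecker l p * (b * w p) - c * (f p * w p))"
    by (rule sum.cong) (simp_all add: algebra_simps)
  then show ?thesis
    by (simp only: sum_subtractf sum.distrib sum_kronecker sum_distrib_left)
qed

lemma matrix_inv_inverse:
  fixes M :: "real^'n::finite^'n"
  assumes "invertible M"
  shows "M ** matrix_inv M = mat 1" "matrix_inv M ** M = mat 1"
  using someI_ex[OF assms[unfolded invertible_def]] unfolding matrix_inv_def by blast+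

lemma matrix_inv_eqI:
  fixes M N :: "real^'n::finite^'n"
  assumes "N ** M = mat 1"
  shows "matrix_inv M = N"
proof -
  have "invertible M" using assms invertible_left_inverse by blast
  then have "N ** (M ** matrix_inv M) = N" by (simp add: matrix_inv_inverse)
  then show ?thesis using assms by (simp add: matrix_mul_assoc)
qed

section \<open>The Levi-Civita connection and the symmetries of the Riemann tensor\<close>

locale metric_on =
  fixes S :: "(real^'n::finite) set" and G :: "real^'n \<Rightarrow> real^'n^'n"
  assumes open_S: "open S"
    and smooth_G: "smooth_on S (\<lambda>y. G y $ i $ j)"
    and G_transpose: "y \<in> S \<Longrightarrow> transpose (G y) = G y"
    and G_invertible: "y \<in> S \<Longrightarrow> invertible (G y)"
begin

lemma G_sym: "y \<in> S \<Longrightarrow> G y $ i $ j = G y $ j $ i"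
  using G_transpose[of y] by (metis transpose_def vec_lambda_beta)

lemma inv_left: "y \<in> S \<Longrightarrow> (\<Sum>p\<in>UNIV. metric_inv G i p y * G y $ p $ j) = kronecker i j"
proof -
  assume "y \<in> S"
  then have "matrix_inv (G y) ** G y = mat 1" using G_invertible matrix_inv_inverse(2) by blast
  then have "(matrix_inv (G y) ** G y) $ i $ j = mat 1 $ i $ j" by simp
  then show ?thesis by (simp add: matrix_matrix_mult_def mat_def metric_inv_def kronecker_def)
qed

lemma inv_right: "y \<in> S \<Longrightarrow> (\<Sum>p\<in>UNIV. G y $ i $ p * metric_inv G p j y) = kronecker i j"
proof -
  assume "y \<in> S"
  then have "G y ** matrix_inv (G y) = mat 1" using G_invertible matrix_inv_inverse(1) by blast
  then have "(G y ** matrix_inv (G y)) $ i $ j = mat 1 $ i $ j" by simp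
  then show ?thesis by (simp add: matrix_matrix_mult_def mat_def metric_inv_def kronecker_def)
qed

lemma inv_sym: "y \<in> S \<Longrightarrow> metric_inv G i j y = metric_inv G j i y"
proof -
  assume y: "y \<in> S"
  have "transpose (matrix_inv (G y)) = matrix_inv (G y)"
    using G_transpose[OF y] matrix_inv_inverse(1)[OF G_invertible[OF y]]
    by (metis matrix_inv_eqI matrix_transpose_mul transpose_mat)
  then have "transpose (matrix_inv (G y)) $ i $ j = matrix_inv (G y) $ i $ j" by simp
  then show ?thesis by (simp add: transpose_def metric_inv_def)
qed

lemma inv_left': "y \<in> S \<Longrightarrow> (\<Sum>p\<in>UNIV. metric_inv G i p y * G y $ j $ p) = kronecker i j"
  using inv_left[of y i j] G_sym[of y j] by simp

lemmas smooth_intros = smooth_on_add[OF open_S] smooth_on_mult[OF open_S] smooth_on_diff[OF open_S]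
  smooth_on_minus[OF open_S] smooth_on_sum[OF open_S] smooth_on_const smooth_on_partial_deriv smooth_G

lemma smooth_det:
  assumes "\<And>i j. smooth_on S (\<lambda>y. M y $ i $ j)"
  shows "smooth_on S (\<lambda>y. det (M y))"
  unfolding det_def
  by (intro smooth_intros smooth_on_prod[OF open_S] assms)

text \<open>Cramer's rule: an entry of the inverse is a quotient of determinants, which are
  polynomials in the entries of \<open>G\<close>.\<close>

lemma smooth_metric_inv: "smooth_on S (metric_inv G i j)"
proof -
  have d: "det (G y) \<noteq> 0" if "y \<in> S" for y
    using G_invertible[OF that] invertible_det_nz by blast
  let ?M = "\<lambda>y. (\<chi> a b. if b = i then axis j 1 $ a else G y $ a $ b) :: real^'n^'n"
  have "metric_inv G i j y = det (?M y) / det (G y)" if y: "y \<in> S" for y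
  proof -
    have "G y *v (matrix_inv (G y) *v axis j 1) = axis j 1"
      using matrix_inv_inverse(1)[OF G_invertible[OF y]] by (simp add: matrix_vector_mul_assoc)
    then have "matrix_inv (G y) *v axis j 1 =
        (\<chi> k. det (\<chi> a b. if b = k then axis j 1 $ a else G y $ a $ b) / det (G y))"
      using cramer[OF d[OF y]] by blast
    then have "(matrix_inv (G y) *v axis j 1) $ i = det (?M y) / det (G y)" by simp
    then show ?thesis by (simp add: matrix_vector_mul_component metric_inv_def inner_axis)
  qed
  moreover have "smooth_on S (\<lambda>y. ?M y $ a $ b)" for a b
    by (cases "b = i") (simp_all add: smooth_intros)
  then have "smooth_on S (\<lambda>y. det (?M y) / det (G y))"
    using d smooth_G open_S by (intro smooth_on_divide smooth_det) auto
  ultimately show ?thesis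
    by (subst smooth_on_cong[OF open_S, where g = "\<lambda>y. det (?M y) / det (G y)"])
qed

lemma smooth_christoffel: "smooth_on S (christoffel G i j m)"
  unfolding christoffel_def[abs_def] by (intro smooth_intros smooth_metric_inv)

lemma smooth_riemann: "smooth_on S (riemann G j k l m)"
  unfolding riemann_def[abs_def] by (intro smooth_intros smooth_christoffel)

lemma smooth_ricci: "smooth_on S (ricci G j k)"
  unfolding ricci_def[abs_def] by (intro smooth_intros smooth_riemann)

lemma smooth_weyl_up: "smooth_on S (weyl_up G j k l m)"
  unfolding weyl_up_def[abs_def] Let_def scalar_curvature_def ricci_mixed_def divide_inverse
  by (intro smooth_intros smooth_riemann smooth_ricci smooth_metric_inv)

lemma smooth_weyl: "smooth_on S (weyl G j k l m)"
  unfolding weyl_def[abs_def] by (intro smooth_intros smooth_weyl_up)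

lemma smooth_differentiable: "smooth_on S f \<Longrightarrow> y \<in> S \<Longrightarrow> f differentiable at y"
  using smooth_on_differentiable open_S by blast

lemma christoffel_sym: "y \<in> S \<Longrightarrow> christoffel G i j m y = christoffel G j i m y"
proof -
  assume y: "y \<in> S"
  have "partial_deriv p (\<lambda>z. G z $ i $ j) y = partial_deriv p (\<lambda>z. G z $ j $ i) y" for p
    by (rule partial_deriv_cong[OF open_S y G_sym])
  then show ?thesis by (simp add: christoffel_def algebra_simps)
qed

text \<open>Christoffel symbols of the first kind. They do not involve the inverse metric and are
  linear in the derivatives of \<open>G\<close>.\<close>

definition lower_christoffel :: "'n \<Rightarrow> 'n \<Rightarrow> 'n \<Rightarrow> real^'n \<Rightarrow> real" where
  "lower_christoffel i j m y = (1/2) * (partial_deriv i (\<lambda>z. G z $ j $ m) y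
     + partial_deriv j (\<lambda>z. G z $ i $ m) y - partial_deriv m (\<lambda>z. G z $ i $ j) y)"

lemma christoffel_lower:
  assumes y: "y \<in> S"
  shows "(\<Sum>p\<in>UNIV. christoffel G i j p y * G y $ p $ m) = lower_christoffel i j m y"
proof -
  have "(\<Sum>p\<in>UNIV. christoffel G i j p y * G y $ p $ m)
      = (\<Sum>p\<in>UNIV. \<Sum>q\<in>UNIV. lower_christoffel i j q y * (metric_inv G q p y * G y $ p $ m))"
    using inv_sym[OF y]
    by (simp add: christoffel_def lower_christoffel_def sum_distrib_left sum_distrib_right mult_ac)
  also have "\<dots> = (\<Sum>q\<in>UNIV. lower_christoffel i j q y * (\<Sum>p\<in>UNIV. metric_inv G q p y * G y $ p $ m))"
    by (subst sum.swap) (simp add: sum_distrib_left)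
  finally show ?thesis using inv_left[OF y] by (simp add: sum_kronecker)
qed

lemma partial_deriv_sym:
  "y \<in> S \<Longrightarrow> partial_deriv p (\<lambda>z. G z $ i $ j) y = partial_deriv p (\<lambda>z. G z $ j $ i) y"
  by (rule partial_deriv_cong[OF open_S _ G_sym])

text \<open>Compatibility of the connection with the metric, solved for the partial
  derivative.\<close>

lemma partial_deriv_metric:
  "y \<in> S \<Longrightarrow> partial_deriv k (\<lambda>z. G z $ i $ j) y = lower_christoffel k i j y + lower_christoffel k j i y"
  using partial_deriv_sym[of y k i j] partial_deriv_sym[of y j k i] partial_deriv_sym[of y i k j]
    partial_deriv_sym[of y i j k] partial_deriv_sym[of y j i k]
  by (simp add: lower_christoffel_def algebra_simps)

lemma lower_christoffel_sym: "y \<in> S \<Longrightarrow> lower_christoffel i j m y = lower_christoffel j i m y"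
  using partial_deriv_sym[of y m i j] by (simp add: lower_christoffel_def)

lemma smooth_lower_christoffel: "smooth_on S (lower_christoffel i j m)"
  unfolding lower_christoffel_def[abs_def] by (intro smooth_intros)

text \<open>The inverse metric is parallel as well: differentiate the identity in
  \<open>inv_left\<close>, then multiply by the inverse metric from the right to isolate the
  derivative.\<close>

lemma partial_deriv_metric_inv:
  assumes y: "y \<in> S"
  shows "partial_deriv k (metric_inv G i j) y =
    - (\<Sum>p\<in>UNIV. christoffel G k p i y * metric_inv G p j y)
    - (\<Sum>p\<in>UNIV. christoffel G k p j y * metric_inv G i p y)"
proof -
  define d where "d i q = partial_deriv k (metric_inv G i q) y" for i q
  define L where "L = (\<lambda>p q. lower_christoffel k p q y)"
  define \<Gamma> where "\<Gamma> = (\<lambda>p q. christoffel G k p q y)"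
  define h where "h = (\<lambda>p q. metric_inv G p q y)"
  have 0: "(\<Sum>p\<in>UNIV. h i p * (L p m + L m p) + d i p * G y $ p $ m) = 0" for m
  proof -
    have "0 = partial_deriv k (\<lambda>x. kronecker i m) y" by (simp add: partial_deriv_const)
    also have "\<dots> = partial_deriv k (\<lambda>x. \<Sum>p\<in>UNIV. metric_inv G i p x * G x $ p $ m) y"
      by (rule partial_deriv_cong[OF open_S y]) (simp add: inv_left)
    also have "\<dots> = (\<Sum>p\<in>UNIV. partial_deriv k (\<lambda>x. metric_inv G i p x * G x $ p $ m) y)"
      by (intro partial_deriv_sum smooth_differentiable smooth_intros smooth_metric_inv y)
    also have "\<dots> = (\<Sum>p\<in>UNIV. h i p * (L p m + L m p) + d i p * G y $ p $ m)"
      using smooth_differentiable[OF smooth_metric_inv y] smooth_differentiable[OF smooth_G y]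
      by (intro sum.cong) (simp_all add: partial_deriv_mult partial_deriv_metric[OF y] d_def h_def L_def)
    finally show ?thesis by simp
  qed
  have "d i j = (\<Sum>p\<in>UNIV. d i p * (\<Sum>m\<in>UNIV. G y $ p $ m * h m j))"
    using inv_right[OF y] by (simp add: h_def sum_kronecker)
  also have "\<dots> = (\<Sum>p\<in>UNIV. \<Sum>m\<in>UNIV. d i p * G y $ p $ m * h m j)"
    by (simp add: sum_distrib_left mult_ac)
  also have "\<dots> = (\<Sum>m\<in>UNIV. \<Sum>p\<in>UNIV. d i p * G y $ p $ m * h m j)"
    by (rule sum.swap)
  also have "\<dots> = (\<Sum>m\<in>UNIV. - (\<Sum>p\<in>UNIV. h i p * (L p m + L m p)) * h m j)"
  proof (rule sum.cong[OF refl])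
    fix m
    have "(\<Sum>p\<in>UNIV. d i p * G y $ p $ m) = - (\<Sum>p\<in>UNIV. h i p * (L p m + L m p))"
      using 0[of m] by (simp add: sum.distrib)
    then show "(\<Sum>p\<in>UNIV. d i p * G y $ p $ m * h m j) = - (\<Sum>p\<in>UNIV. h i p * (L p m + L m p)) * h m j"
      by (simp only: sum_distrib_right[symmetric])
  qed
  also have "\<dots> = - (\<Sum>m\<in>UNIV. \<Sum>p\<in>UNIV. h i p * L p m * h m j) - (\<Sum>m\<in>UNIV. \<Sum>p\<in>UNIV. h i p * L m p * h m j)"
    by (simp add: algebra_simps sum.distrib sum_distrib_left sum_negf sum_subtractf)
  also have "(\<Sum>m\<in>UNIV. \<Sum>p\<in>UNIV. h i p * L m p * h m j) = (\<Sum>m\<in>UNIV. \<Gamma> m i * h m j)"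
  proof (rule sum.cong[OF refl])
    fix m
    have "(\<Sum>p\<in>UNIV. h i p * L m p) = \<Gamma> m i"
      by (simp add: L_def \<Gamma>_def h_def christoffel_def lower_christoffel_def sum_distrib_left mult_ac)
    then show "(\<Sum>p\<in>UNIV. h i p * L m p * h m j) = \<Gamma> m i * h m j" by (simp only: sum_distrib_right[symmetric])
  qed
  also have "(\<Sum>m\<in>UNIV. \<Sum>p\<in>UNIV. h i p * L p m * h m j) = (\<Sum>p\<in>UNIV. \<Gamma> p j * h i p)"
  proof (subst sum.swap, rule sum.cong[OF refl])
    fix p
    have "(\<Sum>m\<in>UNIV. L p m * h m j) = \<Gamma> p j"
      using inv_sym[OF y]
      by (simp add: L_def \<Gamma>_def h_def christoffel_def lower_christoffel_def sum_distrib_left mult_ac)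
    then show "(\<Sum>m\<in>UNIV. h i p * L p m * h m j) = \<Gamma> p j * h i p"
      by (simp add: mult.assoc sum_distrib_left[symmetric])
  qed
  finally show ?thesis by (simp add: d_def \<Gamma>_def h_def)
qed

text \<open>Lowering \<open>m\<close> under the derivative costs a derivative of the metric, half of
  which cancels the quadratic term. The resulting form makes the antisymmetry in \<open>l\<close>
  and \<open>m\<close> visible.\<close>

lemma riemann_down_eq:
  assumes y: "y \<in> S"
  shows "riemann_down G j k l m y =
    partial_deriv k (lower_christoffel j l m) y - partial_deriv j (lower_christoffel k l m) y
    - (\<Sum>p\<in>UNIV. christoffel G j l p y * lower_christoffel k m p y)
    + (\<Sum>p\<in>UNIV. christoffel G k l p y * lower_christoffel j m p y)"
proof -
  let ?\<Gamma> = "\<lambda>i j m. christoffel G i j m y" and ?L = "\<lambda>i j m. lower_christoffel i j m y"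
  let ?g = "\<lambda>i j. G y $ i $ j"
  have d: "partial_deriv k (lower_christoffel j l m) y =
      (\<Sum>p\<in>UNIV. partial_deriv k (christoffel G j l p) y * ?g p m)
      + (\<Sum>p\<in>UNIV. ?\<Gamma> j l p * ?L k p m) + (\<Sum>p\<in>UNIV. ?\<Gamma> j l p * ?L k m p)" for j k
  proof -
    have "partial_deriv k (lower_christoffel j l m) y
        = partial_deriv k (\<lambda>x. \<Sum>p\<in>UNIV. christoffel G j l p x * G x $ p $ m) y"
      by (rule partial_deriv_cong[OF open_S y]) (simp add: christoffel_lower)
    also have "\<dots> = (\<Sum>p\<in>UNIV. partial_deriv k (\<lambda>x. christoffel G j l p x * G x $ p $ m) y)"
      by (intro partial_deriv_sum smooth_differentiable smooth_intros smooth_christoffel y)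
    also have "\<dots> = (\<Sum>p\<in>UNIV. partial_deriv k (christoffel G j l p) y * ?g p m
        + ?\<Gamma> j l p * ?L k p m + ?\<Gamma> j l p * ?L k m p)"
      using smooth_differentiable[OF smooth_christoffel y] smooth_differentiable[OF smooth_G y]
      by (intro sum.cong) (simp_all add: partial_deriv_mult partial_deriv_metric[OF y] algebra_simps)
    finally show ?thesis by (simp add: sum.distrib)
  qed
  have q: "(\<Sum>p\<in>UNIV. (\<Sum>r\<in>UNIV. ?\<Gamma> j l r * ?\<Gamma> k r p) * ?g p m) = (\<Sum>p\<in>UNIV. ?\<Gamma> j l p * ?L k p m)" for j k
  proof -
    have "(\<Sum>p\<in>UNIV. (\<Sum>r\<in>UNIV. ?\<Gamma> j l r * ?\<Gamma> k r p) * ?g p m)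
        = (\<Sum>r\<in>UNIV. \<Sum>p\<in>UNIV. ?\<Gamma> j l r * (?\<Gamma> k r p * ?g p m))"
      by (simp only: sum_distrib_right mult.assoc) (rule sum.swap)
    also have "\<dots> = (\<Sum>r\<in>UNIV. ?\<Gamma> j l r * ?L k r m)"
      by (simp add: sum_distrib_left[symmetric] christoffel_lower[OF y])
    finally show ?thesis .
  qed
  have "riemann_down G j k l m y =
      (\<Sum>p\<in>UNIV. partial_deriv k (christoffel G j l p) y * ?g p m)
      - (\<Sum>p\<in>UNIV. partial_deriv j (christoffel G k l p) y * ?g p m)
      + (\<Sum>p\<in>UNIV. (\<Sum>r\<in>UNIV. ?\<Gamma> j l r * ?\<Gamma> k r p) * ?g p m)
      - (\<Sum>p\<in>UNIV. (\<Sum>r\<in>UNIV. ?\<Gamma> k l r * ?\<Gamma> j r p) * ?g p m)"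
    by (simp add: riemann_down_def riemann_def sum_subtractf sum.distrib distrib_right left_diff_distrib)
  then show ?thesis unfolding d q by simp
qed

lemma riemann_down_anti12: "riemann_down G j k l m y = - riemann_down G k j l m y"
  by (simp add: riemann_down_def riemann_def sum_negf[symmetric] algebra_simps sum_subtractf)

text \<open>Symmetrised in \<open>l\<close> and \<open>m\<close>, the derivative terms become mixed
  second derivatives of \<open>G\<close>, which commute; the quadratic terms cancel because the
  pairing of two Christoffel symbols through the metric is symmetric.\<close>

lemma riemann_down_anti34:
  assumes y: "y \<in> S"
  shows "riemann_down G j k l m y = - riemann_down G j k m l y"
proof -
  let ?\<Gamma> = "\<lambda>i j m. christoffel G i j m y" and ?L = "\<lambda>i j m. lower_christoffel i j m y"
  have s: "(\<Sum>p\<in>UNIV. ?\<Gamma> a b p * ?L c d p) = (\<Sum>p\<in>UNIV. ?\<Gamma> c d p * ?L a b p)" for a b c d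
  proof -
    have "(\<Sum>p\<in>UNIV. ?\<Gamma> a b p * ?L c d p) = (\<Sum>p\<in>UNIV. \<Sum>q\<in>UNIV. ?\<Gamma> a b p * (?\<Gamma> c d q * G y $ q $ p))"
      by (simp add: christoffel_lower[OF y, symmetric] sum_distrib_left)
    also have "\<dots> = (\<Sum>q\<in>UNIV. \<Sum>p\<in>UNIV. ?\<Gamma> c d q * (?\<Gamma> a b p * G y $ p $ q))"
      by (subst sum.swap) (simp add: G_sym[OF y] mult_ac)
    finally show ?thesis by (simp add: christoffel_lower[OF y, symmetric] sum_distrib_left)
  qed
  have d: "partial_deriv k (lower_christoffel j l m) y + partial_deriv k (lower_christoffel j m l) y
      = partial_deriv k (partial_deriv j (\<lambda>z. G z $ l $ m)) y" for j k
  proof -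
    have "partial_deriv k (\<lambda>x. lower_christoffel j l m x + lower_christoffel j m l x) y
        = partial_deriv k (partial_deriv j (\<lambda>z. G z $ l $ m)) y"
      by (rule partial_deriv_cong[OF open_S y]) (simp add: partial_deriv_metric)
    then show ?thesis
      by (simp add: partial_deriv_add smooth_differentiable[OF smooth_lower_christoffel y])
  qed
  have "partial_deriv k (partial_deriv j (\<lambda>z. G z $ l $ m)) y = partial_deriv j (partial_deriv k (\<lambda>z. G z $ l $ m)) y"
    by (rule partial_deriv_commute[OF smooth_G open_S y])
  then show ?thesis
    using d[of j k] d[of k j] s[of j l k m] s[of j m k l] unfolding riemann_down_eq[OF y] by simp
qed

lemma riemann_cyclic:
  assumes y: "y \<in> S"
  shows "riemann G j k l m y + riemann G k l j m y + riemann G l j k m y = 0"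
proof -
  have d: "partial_deriv k (christoffel G i j m) y = partial_deriv k (christoffel G j i m) y" for i j k
    by (rule partial_deriv_cong[OF open_S y christoffel_sym])
  show ?thesis
    unfolding riemann_def using d[of k j l] d[of l k j] d[of j l k]
    by (simp add: christoffel_sym[OF y, of l j] christoffel_sym[OF y, of k j]
        christoffel_sym[OF y, of l k] sum_subtractf)
qed

lemma riemann_down_cyclic:
  "y \<in> S \<Longrightarrow> riemann_down G j k l m y + riemann_down G k l j m y + riemann_down G l j k m y = 0"
  using riemann_cyclic by (simp add: riemann_down_def sum.distrib[symmetric] distrib_right[symmetric])

lemma riemann_down_pair:
  assumes y: "y \<in> S"
  shows "riemann_down G j k l m y = riemann_down G l m j k y"
  using curvature_pair_symmetry[where C = "\<lambda>j k l m. riemann_down G j k l m y"]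
    riemann_down_anti12 riemann_down_anti34[OF y] riemann_down_cyclic[OF y] by blast

end

section \<open>Ricci and Weyl tensors: symmetries and traces\<close>

context metric_on
begin

lemma riemann_up: "y \<in> S \<Longrightarrow> riemann G j k l p y = (\<Sum>m\<in>UNIV. riemann_down G j k l m y * metric_inv G m p y)"
proof -
  assume y: "y \<in> S"
  have "(\<Sum>m\<in>UNIV. riemann_down G j k l m y * metric_inv G m p y)
      = (\<Sum>q\<in>UNIV. riemann G j k l q y * (\<Sum>m\<in>UNIV. G y $ q $ m * metric_inv G m p y))"
    by (simp only: riemann_down_def sum_distrib_right sum_distrib_left mult.assoc) (rule sum.swap)
  then show ?thesis using inv_right[OF y] by (simp add: sum_kronecker)
qed

lemma ricci_eq:
  "y \<in> S \<Longrightarrow> ricci G k l y = - (\<Sum>p\<in>UNIV. \<Sum>m\<in>UNIV. riemann_down G p k l m y * metric_inv G m p y)"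
  by (simp add: ricci_def riemann_up)

lemma ricci_sym:
  assumes y: "y \<in> S"
  shows "ricci G k l y = ricci G l k y"
proof -
  have "riemann_down G p k l m y = riemann_down G m l k p y" for p m
    using riemann_down_pair[OF y, of p k l m] riemann_down_anti12[of l m p k y] riemann_down_anti34[OF y, of m l p k]
    by simp
  then have "(\<Sum>p\<in>UNIV. \<Sum>m\<in>UNIV. riemann_down G p k l m y * metric_inv G m p y)
      = (\<Sum>m\<in>UNIV. \<Sum>p\<in>UNIV. riemann_down G m l k p y * metric_inv G p m y)"
    using inv_sym[OF y] by (subst sum.swap) simp
  then show ?thesis unfolding ricci_eq[OF y] by simp
qed

lemma ricci_mixed_lower:
  assumes y: "y \<in> S"
  shows "(\<Sum>p\<in>UNIV. ricci_mixed G j p y * G y $ p $ m) = ricci G j m y"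
proof -
  have "(\<Sum>p\<in>UNIV. ricci_mixed G j p y * G y $ p $ m)
      = (\<Sum>q\<in>UNIV. ricci G j q y * (\<Sum>p\<in>UNIV. metric_inv G q p y * G y $ p $ m))"
    by (simp only: ricci_mixed_def sum_distrib_right sum_distrib_left mult.assoc) (rule sum.swap)
  then show ?thesis using inv_left[OF y] by (simp add: sum_kronecker)
qed

definition ricci_coeff :: real where
  "ricci_coeff = 1 / (real CARD('n) - 2)"

definition scalar_coeff :: "real^'n \<Rightarrow> real" where
  "scalar_coeff y = scalar_curvature G y / ((real CARD('n) - 1) * (real CARD('n) - 2))"

lemma weyl_up_coeff:
  "weyl_up G j k l p y = riemann G j k l p y
      + ricci_coeff * (kronecker j p * ricci G k l y - kronecker k p * ricci G j l y
        + G y $ k $ l * ricci_mixed G j p y - G y $ j $ l * ricci_mixed G k p y)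
      - scalar_coeff y * (kronecker j p * G y $ k $ l - kronecker k p * G y $ j $ l)"
  by (simp add: weyl_up_def Let_def ricci_coeff_def scalar_coeff_def)

lemma weyl_eq:
  assumes y: "y \<in> S"
  shows "weyl G j k l m y = riemann_down G j k l m y
    + ricci_coeff * (G y $ j $ m * ricci G k l y - G y $ k $ m * ricci G j l y
        + G y $ k $ l * ricci G j m y - G y $ j $ l * ricci G k m y)
    - scalar_coeff y * (G y $ j $ m * G y $ k $ l - G y $ k $ m * G y $ j $ l)"
proof -
  let ?a = ricci_coeff and ?b = "scalar_coeff y"
  have "weyl G j k l m y = (\<Sum>p\<in>UNIV. riemann G j k l p y * G y $ p $ m
      + ?a * ricci G k l y * (kronecker j p * G y $ p $ m) - ?a * ricci G j l y * (kronecker k p * G y $ p $ m)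
      + ?a * G y $ k $ l * (ricci_mixed G j p y * G y $ p $ m) - ?a * G y $ j $ l * (ricci_mixed G k p y * G y $ p $ m)
      - ?b * G y $ k $ l * (kronecker j p * G y $ p $ m) + ?b * G y $ j $ l * (kronecker k p * G y $ p $ m))"
    unfolding weyl_def weyl_up_coeff by (rule sum.cong) (simp_all add: algebra_simps)
  also have "\<dots> = riemann_down G j k l m y
      + ?a * ricci G k l y * G y $ j $ m - ?a * ricci G j l y * G y $ k $ m
      + ?a * G y $ k $ l * ricci G j m y - ?a * G y $ j $ l * ricci G k m y
      - ?b * G y $ k $ l * G y $ j $ m + ?b * G y $ j $ l * G y $ k $ m"
    by (simp only: sum.distrib sum_subtractf sum_distrib_left[symmetric] sum_kronecker
        ricci_mixed_lower[OF y] riemann_down_def)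
  finally show ?thesis by (simp add: algebra_simps)
qed

lemma weyl_anti12: "y \<in> S \<Longrightarrow> weyl G j k l m y = - weyl G k j l m y"
  using riemann_down_anti12[of j k l m y] by (simp add: weyl_eq algebra_simps)

lemma weyl_anti34: "y \<in> S \<Longrightarrow> weyl G j k l m y = - weyl G j k m l y"
  using riemann_down_anti34[of y j k l m] by (simp add: weyl_eq algebra_simps)

lemma weyl_cyclic: "y \<in> S \<Longrightarrow> weyl G j k l m y + weyl G k l j m y + weyl G l j k m y = 0"
  using riemann_down_cyclic[of y j k l m] ricci_sym[of y l j] ricci_sym[of y l k] ricci_sym[of y k j]
    G_sym[of y l j] G_sym[of y l k] G_sym[of y k j]
  by (simp add: weyl_eq algebra_simps)

lemma weyl_pair: "y \<in> S \<Longrightarrow> weyl G j k l m y = weyl G l m j k y"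
  using curvature_pair_symmetry[where C = "\<lambda>j k l m. weyl G j k l m y"]
    weyl_anti12 weyl_anti34 weyl_cyclic by blast

lemma weyl_up_eq: "y \<in> S \<Longrightarrow> (\<Sum>m\<in>UNIV. weyl G j k l m y * metric_inv G m p y) = weyl_up G j k l p y"
proof -
  assume y: "y \<in> S"
  have "(\<Sum>m\<in>UNIV. weyl G j k l m y * metric_inv G m p y)
      = (\<Sum>q\<in>UNIV. weyl_up G j k l q y * (\<Sum>m\<in>UNIV. G y $ q $ m * metric_inv G m p y))"
    by (simp only: weyl_def sum_distrib_right sum_distrib_left mult.assoc) (rule sum.swap)
  then show ?thesis using inv_right[OF y] by (simp add: sum_kronecker)
qed

lemma weyl_up_trace:
  assumes y: "y \<in> S" and n: "CARD('n) \<ge> 4"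
  shows "(\<Sum>j\<in>UNIV. weyl_up G j k l j y) = 0"
proof -
  let ?a = ricci_coeff and ?b = "scalar_coeff y" and ?N = "real CARD('n)"
  have t: "(\<Sum>j\<in>UNIV. G y $ j $ l * ricci_mixed G k j y) = ricci G k l y"
    using ricci_mixed_lower[OF y, of k l] by (simp add: mult.commute)
  have "(\<Sum>j\<in>UNIV. weyl_up G j k l j y) = (\<Sum>j\<in>UNIV. riemann G j k l j y
      + ?a * ricci G k l y - ?a * (kronecker k j * ricci G j l y)
      + ?a * G y $ k $ l * ricci_mixed G j j y - ?a * (G y $ j $ l * ricci_mixed G k j y)
      - ?b * G y $ k $ l + ?b * (kronecker k j * G y $ j $ l))"
    unfolding weyl_up_coeff by (rule sum.cong) (simp_all add: kronecker_same algebra_simps)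
  also have "\<dots> = - ricci G k l y + ?N * (?a * ricci G k l y) - ?a * ricci G k l y
      + ?a * G y $ k $ l * scalar_curvature G y - ?a * ricci G k l y - ?N * (?b * G y $ k $ l) + ?b * G y $ k $ l"
    by (simp add: sum.distrib sum_subtractf sum_distrib_left[symmetric] sum_kronecker t
        ricci_def scalar_curvature_def)
  \<comment> \<open>The coefficients of the Weyl tensor are made for this: both brackets vanish, the
    bound on the dimension keeping the denominators non-zero.\<close>
  also have "\<dots> = ricci G k l y * (?a * (?N - 2) - 1)
      + G y $ k $ l * (?a * scalar_curvature G y - ?b * (?N - 1))"
    by (simp add: algebra_simps)
  also have "\<dots> = 0"
    using n by (simp add: ricci_coeff_def scalar_coeff_def)
  finally show ?thesis .
qed

lemma weyl_trace14:
  assumes y: "y \<in> S" and n: "CARD('n) \<ge> 4"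
  shows "(\<Sum>i\<in>UNIV. \<Sum>j\<in>UNIV. metric_inv G i j y * weyl G j k l i y) = 0"
proof -
  have "(\<Sum>i\<in>UNIV. \<Sum>j\<in>UNIV. metric_inv G i j y * weyl G j k l i y)
      = (\<Sum>j\<in>UNIV. \<Sum>i\<in>UNIV. weyl G j k l i y * metric_inv G i j y)"
    by (subst sum.swap) (simp add: mult.commute)
  then show ?thesis using weyl_up_eq[OF y] weyl_up_trace[OF y n] by simp
qed

end

subsection \<open>Conformal change of the metric\<close>

lemma metric_inv_scale:
  assumes "invertible (G y)" "r y \<noteq> 0"
  shows "metric_inv (\<lambda>y. r y *\<^sub>R G y) i j y = metric_inv G i j y / r y"
proof -
  have "matrix_inv (r y *\<^sub>R G y) = (1 / r y) *\<^sub>R matrix_inv (G y)"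
    using assms
    by (intro matrix_inv_eqI) (simp add: matrix_scalar_ac scalar_matrix_assoc[symmetric] matrix_inv_inverse)
  then show ?thesis by (simp add: metric_inv_def)
qed

locale conformal_change = metric_on S G
  for S :: "(real^'n::finite) set" and G :: "real^'n \<Rightarrow> real^'n^'n" +
  fixes s :: "real^'n \<Rightarrow> real"
  assumes smooth_s: "smooth_on S s"
begin

definition G' :: "real^'n \<Rightarrow> real^'n^'n" where
  "G' y = exp (2 * s y) *\<^sub>R G y"

definition ds_up :: "'n \<Rightarrow> real^'n \<Rightarrow> real" where
  "ds_up m y = (\<Sum>p\<in>UNIV. metric_inv G m p y * partial_deriv p s y)"

definition hess :: "'n \<Rightarrow> 'n \<Rightarrow> real^'n \<Rightarrow> real" where
  "hess i j y = partial_deriv i (partial_deriv j s) y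
    - (\<Sum>p\<in>UNIV. christoffel G i j p y * partial_deriv p s y)"

definition ds_sq :: "real^'n \<Rightarrow> real" where
  "ds_sq y = (\<Sum>p\<in>UNIV. ds_up p y * partial_deriv p s y)"

text \<open>The difference of the Levi-Civita connections of \<open>G'\<close> and \<open>G\<close>,
  see \<open>christoffel_conf\<close>.\<close>

definition diff_tensor :: "'n \<Rightarrow> 'n \<Rightarrow> 'n \<Rightarrow> real^'n \<Rightarrow> real" where
  "diff_tensor i j m y = kronecker i m * partial_deriv j s y + kronecker j m * partial_deriv i s y
    - G y $ i $ j * ds_up m y"

lemma smooth_ds_up: "smooth_on S (ds_up m)"
  unfolding ds_up_def[abs_def] by (intro smooth_intros smooth_metric_inv smooth_s)

lemma smooth_diff_tensor: "smooth_on S (diff_tensor i j m)"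
  unfolding diff_tensor_def[abs_def] by (intro smooth_intros smooth_ds_up smooth_s)

lemma ds_lower:
  assumes y: "y \<in> S"
  shows "(\<Sum>p\<in>UNIV. G y $ i $ p * ds_up p y) = partial_deriv i s y"
proof -
  have "(\<Sum>p\<in>UNIV. G y $ i $ p * ds_up p y)
      = (\<Sum>q\<in>UNIV. (\<Sum>p\<in>UNIV. G y $ i $ p * metric_inv G p q y) * partial_deriv q s y)"
    by (simp only: ds_up_def sum_distrib_right sum_distrib_left mult.assoc) (rule sum.swap)
  then show ?thesis using inv_right[OF y] by (simp add: sum_kronecker)
qed

lemma metric_inv_conf: "y \<in> S \<Longrightarrow> metric_inv G' i j y = exp (- 2 * s y) * metric_inv G i j y"
  unfolding G'_def[abs_def]
  by (subst metric_inv_scale) (simp_all add: G_invertible exp_minus field_simps)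

lemma partial_deriv_conf:
  assumes y: "y \<in> S" and f: "smooth_on S f"
  shows "partial_deriv k (\<lambda>z. exp (2 * s z) * f z) y =
    exp (2 * s y) * (2 * partial_deriv k s y * f y + partial_deriv k f y)"
proof -
  have "smooth_on S (\<lambda>z. 2 * s z)" by (intro smooth_intros smooth_s)
  moreover from smooth_on_exp[OF open_S this] have "smooth_on S (\<lambda>z. exp (2 * s z))" .
  ultimately show ?thesis
    using smooth_differentiable[OF _ y] f smooth_s
    by (simp add: partial_deriv_mult partial_deriv_exp partial_deriv_cmult partial_deriv_const algebra_simps)
qed

lemma christoffel_conf:
  assumes y: "y \<in> S"
  shows "christoffel G' i j m y = christoffel G i j m y + diff_tensor i j m y"
proof -
  let ?e = "exp (2 * s y)" and ?h = "\<lambda>p. metric_inv G m p y"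
  let ?g = "\<lambda>i j. G y $ i $ j" and ?s = "\<lambda>i. partial_deriv i s y"
  let ?d = "\<lambda>k i j. partial_deriv k (\<lambda>z. G z $ i $ j) y"
  have d: "partial_deriv k (\<lambda>z. G' z $ i $ j) y = ?e * (2 * ?s k * ?g i j + ?d k i j)" for k i j
    using partial_deriv_conf[OF y smooth_G] by (simp add: G'_def)
  have e: "exp (- 2 * s y) * ?e = 1" by (simp flip: exp_add)
  have "christoffel G' i j m y = (1/2) * (\<Sum>p\<in>UNIV. exp (- 2 * s y) * ?e * (?h p *
      (2 * ?s i * ?g j p + ?d i j p + (2 * ?s j * ?g i p + ?d j i p) - (2 * ?s p * ?g i j + ?d p i j))))"
    unfolding christoffel_def metric_inv_conf[OF y] d by (simp add: algebra_simps)
  also have "\<dots> = (1/2) * (\<Sum>p\<in>UNIV. ?h p * (?d i j p + ?d j i p - ?d p i j)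
      + 2 * ?s i * (?h p * ?g j p) + 2 * ?s j * (?h p * ?g i p) - 2 * ?g i j * (?h p * ?s p))"
    unfolding e by (simp add: algebra_simps)
  also have "\<dots> = christoffel G i j m y + ?s i * kronecker m j + ?s j * kronecker m i - ?g i j * ds_up m y"
    by (simp add: sum.distrib sum_subtractf sum_distrib_left[symmetric] inv_left'[OF y]
        christoffel_def ds_up_def)
  finally show ?thesis by (simp add: diff_tensor_def kronecker_sym)
qed

text \<open>Equivalently, the covariant derivative of the gradient is the Hessian with one index
  raised; this rests on the inverse metric being parallel.\<close>

lemma partial_deriv_ds_up:
  assumes y: "y \<in> S"
  shows "partial_deriv k (ds_up m) y =
    (\<Sum>q\<in>UNIV. hess k q y * metric_inv G q m y) - (\<Sum>p\<in>UNIV. ds_up p y * christoffel G k p m y)"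
proof -
  let ?h = "\<lambda>p q. metric_inv G p q y" and ?s = "\<lambda>i. partial_deriv i s y"
  let ?\<Gamma> = "\<lambda>i j m. christoffel G i j m y"
  have "partial_deriv k (ds_up m) y
      = (\<Sum>q\<in>UNIV. partial_deriv k (\<lambda>x. metric_inv G m q x * partial_deriv q s x) y)"
    unfolding ds_up_def[abs_def]
    by (intro partial_deriv_sum smooth_differentiable smooth_intros smooth_metric_inv smooth_s y)
  also have "\<dots> = (\<Sum>q\<in>UNIV. ?h m q * partial_deriv k (partial_deriv q s) y
      + (- (\<Sum>p\<in>UNIV. ?\<Gamma> k p m * ?h p q) - (\<Sum>p\<in>UNIV. ?\<Gamma> k p q * ?h m p)) * ?s q)"
    using smooth_differentiable[OF smooth_metric_inv y]
      smooth_differentiable[OF smooth_on_partial_deriv[OF smooth_s] y]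
    by (simp add: partial_deriv_mult partial_deriv_metric_inv[OF y])
  also have "\<dots> = (\<Sum>q\<in>UNIV. ?h m q * partial_deriv k (partial_deriv q s) y)
      - (\<Sum>q\<in>UNIV. \<Sum>p\<in>UNIV. ?\<Gamma> k p m * ?h p q * ?s q) - (\<Sum>q\<in>UNIV. \<Sum>p\<in>UNIV. ?\<Gamma> k p q * ?h m p * ?s q)"
    by (simp add: sum.distrib sum_subtractf sum_negf sum_distrib_right left_diff_distrib)
  also have "(\<Sum>q\<in>UNIV. \<Sum>p\<in>UNIV. ?\<Gamma> k p m * ?h p q * ?s q) = (\<Sum>p\<in>UNIV. ds_up p y * ?\<Gamma> k p m)"
    by (subst sum.swap) (simp add: ds_up_def sum_distrib_left sum_distrib_right mult_ac)
  also have "(\<Sum>q\<in>UNIV. \<Sum>p\<in>UNIV. ?\<Gamma> k p q * ?h m p * ?s q) = (\<Sum>p\<in>UNIV. ?h m p * (\<Sum>q\<in>UNIV. ?\<Gamma> k p q * ?s q))"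
    by (subst sum.swap) (simp add: sum_distrib_left mult_ac)
  also have "(\<Sum>q\<in>UNIV. ?h m q * partial_deriv k (partial_deriv q s) y) - (\<Sum>p\<in>UNIV. ds_up p y * ?\<Gamma> k p m)
      - (\<Sum>p\<in>UNIV. ?h m p * (\<Sum>q\<in>UNIV. ?\<Gamma> k p q * ?s q))
    = (\<Sum>q\<in>UNIV. hess k q y * ?h q m) - (\<Sum>p\<in>UNIV. ds_up p y * ?\<Gamma> k p m)"
    by (simp add: hess_def inv_sym[OF y, of _ m] left_diff_distrib right_diff_distrib sum_subtractf mult.commute)
  finally show ?thesis .
qed

text \<open>\<open>schouten_diff\<close> is the difference of the (suitably normalised) Schouten tensors of \<open>G\<close> and \<open>G'\<close>;
  the Riemann tensor changes by its Kulkarni-Nomizu product with the metric, which cancels in the Weyl tensor.\<close>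

definition schouten_diff :: "'n \<Rightarrow> 'n \<Rightarrow> real^'n \<Rightarrow> real" where
  "schouten_diff i j y = hess i j y - partial_deriv i s y * partial_deriv j s y + 1/2 * ds_sq y * G y $ i $ j"

definition schouten_diff_up :: "'n \<Rightarrow> 'n \<Rightarrow> real^'n \<Rightarrow> real" where
  "schouten_diff_up i m y = (\<Sum>q\<in>UNIV. schouten_diff i q y * metric_inv G q m y)"

lemma schouten_diff_up_eq:
  assumes y: "y \<in> S"
  shows "schouten_diff_up i m y = (\<Sum>q\<in>UNIV. hess i q y * metric_inv G q m y)
    - partial_deriv i s y * ds_up m y + 1/2 * ds_sq y * kronecker i m"
proof -
  have "schouten_diff_up i m y = (\<Sum>q\<in>UNIV. hess i q y * metric_inv G q m y
      - partial_deriv i s y * (metric_inv G m q y * partial_deriv q s y)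
      + 1/2 * ds_sq y * (G y $ i $ q * metric_inv G q m y))"
    unfolding schouten_diff_up_def schouten_diff_def
    by (rule sum.cong) (simp_all add: algebra_simps inv_sym[OF y, of _ m])
  then show ?thesis
    by (simp only: sum.distrib sum_subtractf sum_distrib_left[symmetric] inv_right[OF y] ds_up_def)
qed

lemma diff_tensor_contract:
  "(\<Sum>p\<in>UNIV. diff_tensor j l p y * w p) =
    partial_deriv l s y * w j + partial_deriv j s y * w l - G y $ j $ l * (\<Sum>p\<in>UNIV. ds_up p y * w p)"
  unfolding diff_tensor_def by (rule sum_kronecker_combination)

lemma ds_up_diff_tensor:
  assumes y: "y \<in> S"
  shows "(\<Sum>p\<in>UNIV. ds_up p y * diff_tensor k p m y) = kronecker k m * ds_sq y"
proof -
  have "(\<Sum>p\<in>UNIV. ds_up p y * diff_tensor k p m y) = (\<Sum>p\<in>UNIV. kronecker k m * (ds_up p y * partial_deriv p s y)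
      + partial_deriv k s y * (ds_up p y * kronecker p m) - ds_up m y * (G y $ k $ p * ds_up p y))"
    unfolding diff_tensor_def by (rule sum.cong) (simp_all add: algebra_simps)
  also have "\<dots> = kronecker k m * ds_sq y + partial_deriv k s y * ds_up m y - ds_up m y * partial_deriv k s y"
    by (simp only: sum.distrib sum_subtractf sum_distrib_left[symmetric] sum_kronecker ds_lower[OF y] ds_sq_def)
  finally show ?thesis by simp
qed

lemma christoffel_diff_tensor:
  assumes y: "y \<in> S"
  shows "(\<Sum>p\<in>UNIV. christoffel G j l p y * diff_tensor k p m y) =
    kronecker k m * (\<Sum>p\<in>UNIV. christoffel G j l p y * partial_deriv p s y)
    + christoffel G j l m y * partial_deriv k s y - lower_christoffel j l k y * ds_up m y"
proof -
  have "(\<Sum>p\<in>UNIV. christoffel G j l p y * diff_tensor k p m y) =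
      (\<Sum>p\<in>UNIV. kronecker k m * (christoffel G j l p y * partial_deriv p s y)
      + partial_deriv k s y * (christoffel G j l p y * kronecker p m)
      - ds_up m y * (christoffel G j l p y * G y $ p $ k))"
    unfolding diff_tensor_def by (rule sum.cong) (simp_all add: algebra_simps G_sym[OF y, of _ k])
  also have "\<dots> = kronecker k m * (\<Sum>p\<in>UNIV. christoffel G j l p y * partial_deriv p s y)
      + partial_deriv k s y * christoffel G j l m y - ds_up m y * lower_christoffel j l k y"
    by (simp only: sum.distrib sum_subtractf sum_distrib_left[symmetric] sum_kronecker christoffel_lower[OF y])
  finally show ?thesis by (simp add: algebra_simps)
qed

lemma partial_deriv_diff_tensor:
  assumes y: "y \<in> S"
  shows "partial_deriv k (diff_tensor j l m) y =
    kronecker j m * partial_deriv k (partial_deriv l s) y + kronecker l m * partial_deriv k (partial_deriv j s) y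
    - (lower_christoffel k j l y + lower_christoffel k l j y) * ds_up m y
    - G y $ j $ l * partial_deriv k (ds_up m) y"
proof -
  have d: "partial_deriv l s differentiable at y" for l
    by (intro smooth_differentiable smooth_intros smooth_s y)
  have t: "(\<lambda>z. c * partial_deriv l s z) differentiable at y"
    "(\<lambda>z. c * partial_deriv l s z + c' * partial_deriv l' s z) differentiable at y"
    "(\<lambda>z. G z $ j $ l * ds_up m z) differentiable at y" for l l' c c'
    by (intro smooth_differentiable smooth_intros smooth_s smooth_ds_up y)+
  show ?thesis
    unfolding diff_tensor_def[abs_def]
    by (simp add: partial_deriv_diff partial_deriv_add partial_deriv_cmult partial_deriv_mult d t
        smooth_differentiable[OF smooth_G y] smooth_differentiable[OF smooth_ds_up y]
        partial_deriv_metric[OF y] algebra_simps)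
qed

lemma riemann_conf:
  assumes y: "y \<in> S"
  shows "riemann G' j k l m y = riemann G j k l m y
    + (kronecker j m * schouten_diff k l y - kronecker k m * schouten_diff j l y
       + G y $ k $ l * schouten_diff_up j m y - G y $ j $ l * schouten_diff_up k m y)"
proof -
  let ?\<Gamma> = "\<lambda>i j m. christoffel G i j m y" and ?T = "\<lambda>i j m. diff_tensor i j m y"
  let ?s = "\<lambda>i. partial_deriv i s y" and ?t = "\<lambda>i. ds_up i y" and ?g = "\<lambda>i j. G y $ i $ j"
  have d: "partial_deriv k (christoffel G' j l m) y =
      partial_deriv k (christoffel G j l m) y + partial_deriv k (diff_tensor j l m) y" for j k
  proof -
    have "partial_deriv k (christoffel G' j l m) y
        = partial_deriv k (\<lambda>x. christoffel G j l m x + diff_tensor j l m x) y"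
      by (rule partial_deriv_cong[OF open_S y christoffel_conf])
    then show ?thesis
      by (simp add: partial_deriv_add smooth_differentiable[OF _ y] smooth_christoffel smooth_diff_tensor)
  qed
  \<comment> \<open>All terms added to the curvature appear as \<open>X j k - X k j\<close>, so
    whatever in \<open>X\<close> is symmetric in \<open>j\<close> and \<open>k\<close> drops
    out.\<close>
  define X where "X j k = partial_deriv k (diff_tensor j l m) y + (\<Sum>p\<in>UNIV. ?T j l p * ?\<Gamma> k p m)
      + (\<Sum>p\<in>UNIV. ?\<Gamma> j l p * ?T k p m) + (\<Sum>p\<in>UNIV. ?T j l p * ?T k p m)" for j k
  have "riemann G' j k l m y = riemann G j k l m y + X j k - X k j"
    unfolding riemann_def d christoffel_conf[OF y] X_def
    by (simp add: distrib_left distrib_right sum.distrib sum_subtractf)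
  moreover have "X j k = kronecker j m * partial_deriv k (partial_deriv l s) y
      + kronecker l m * partial_deriv k (partial_deriv j s) y
      - (lower_christoffel k j l y + lower_christoffel k l j y) * ?t m
      - ?g j l * ((\<Sum>q\<in>UNIV. hess k q y * metric_inv G q m y) - (\<Sum>p\<in>UNIV. ?t p * ?\<Gamma> k p m))
      + (?s l * ?\<Gamma> k j m + ?s j * ?\<Gamma> k l m - ?g j l * (\<Sum>p\<in>UNIV. ?t p * ?\<Gamma> k p m))
      + (kronecker k m * (\<Sum>p\<in>UNIV. ?\<Gamma> j l p * ?s p) + ?\<Gamma> j l m * ?s k - lower_christoffel j l k y * ?t m)
      + (?s l * ?T k j m + ?s j * ?T k l m - ?g j l * (kronecker k m * ds_sq y))" for j k
    unfolding X_def partial_deriv_diff_tensor[OF y] partial_deriv_ds_up[OF y]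
      christoffel_diff_tensor[OF y] diff_tensor_contract ds_up_diff_tensor[OF y] by simp
  ultimately show ?thesis
    using partial_deriv_commute[OF smooth_s open_S y, of j k]
      christoffel_sym[OF y, of k j] lower_christoffel_sym[OF y, of k j l]
      G_sym[OF y, of k j] kronecker_sym[of l m]
    by (simp add: diff_tensor_def schouten_diff_def schouten_diff_up_eq[OF y] hess_def[of _ l] algebra_simps)
qed

lemma schouten_diff_up_lower:
  assumes y: "y \<in> S"
  shows "(\<Sum>k\<in>UNIV. G y $ k $ j * schouten_diff_up i k y) = schouten_diff i j y"
proof -
  have "(\<Sum>k\<in>UNIV. G y $ k $ j * schouten_diff_up i k y)
      = (\<Sum>k\<in>UNIV. \<Sum>q\<in>UNIV. schouten_diff i q y * (metric_inv G q k y * G y $ k $ j))"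
    by (simp add: schouten_diff_up_def sum_distrib_left mult_ac)
  also have "\<dots> = (\<Sum>q\<in>UNIV. schouten_diff i q y * (\<Sum>k\<in>UNIV. metric_inv G q k y * G y $ k $ j))"
    by (subst sum.swap) (simp add: sum_distrib_left)
  finally show ?thesis using inv_left[OF y] by (simp add: sum_kronecker)
qed

definition schouten_diff_trace :: "real^'n \<Rightarrow> real" where
  "schouten_diff_trace y = (\<Sum>k\<in>UNIV. schouten_diff_up k k y)"

lemma ricci_conf:
  assumes y: "y \<in> S"
  shows "ricci G' i j y = ricci G i j y
    - (real CARD('n) - 2) * schouten_diff i j y - G y $ i $ j * schouten_diff_trace y"
proof -
  have "ricci G' i j y = - (\<Sum>k\<in>UNIV. riemann G k i j k y + schouten_diff i j y
      - kronecker i k * schouten_diff k j y + G y $ i $ j * schouten_diff_up k k y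
      - G y $ k $ j * schouten_diff_up i k y)"
    by (simp add: ricci_def riemann_conf[OF y] kronecker_same algebra_simps)
  also have "\<dots> = ricci G i j y - (real CARD('n) * schouten_diff i j y - schouten_diff i j y
      + G y $ i $ j * schouten_diff_trace y - schouten_diff i j y)"
    by (simp add: sum.distrib sum_subtractf sum_distrib_left[symmetric] sum_kronecker ricci_def
        schouten_diff_up_lower[OF y] schouten_diff_trace_def)
  finally show ?thesis by (simp add: algebra_simps)
qed

lemma ricci_mixed_conf:
  assumes y: "y \<in> S"
  shows "ricci_mixed G' j m y = exp (- 2 * s y) * (ricci_mixed G j m y
    - (real CARD('n) - 2) * schouten_diff_up j m y - schouten_diff_trace y * kronecker j m)"
proof -
  have "ricci_mixed G' j m y = exp (- 2 * s y) * (\<Sum>p\<in>UNIV. ricci G j p y * metric_inv G p m y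
      - (real CARD('n) - 2) * (schouten_diff j p y * metric_inv G p m y)
      - schouten_diff_trace y * (G y $ j $ p * metric_inv G p m y))"
    by (simp add: ricci_mixed_def ricci_conf[OF y] metric_inv_conf[OF y] sum_distrib_left algebra_simps)
  then show ?thesis
    by (simp only: sum_subtractf sum_distrib_left[symmetric] inv_right[OF y]
        ricci_mixed_def[symmetric] schouten_diff_up_def[symmetric])
qed

lemma scalar_curvature_conf:
  assumes y: "y \<in> S"
  shows "scalar_curvature G' y = exp (- 2 * s y) * (scalar_curvature G y
    - 2 * (real CARD('n) - 1) * schouten_diff_trace y)"
proof -
  have "scalar_curvature G' y = exp (- 2 * s y) * (\<Sum>k\<in>UNIV. ricci_mixed G k k y
      - (real CARD('n) - 2) * schouten_diff_up k k y - schouten_diff_trace y)"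
    by (simp add: scalar_curvature_def ricci_mixed_conf[OF y] kronecker_same sum_distrib_left)
  also have "\<dots> = exp (- 2 * s y) * (scalar_curvature G y
      - (real CARD('n) - 2) * schouten_diff_trace y - real CARD('n) * schouten_diff_trace y)"
    by (simp add: sum_subtractf sum_distrib_left[symmetric] scalar_curvature_def schouten_diff_trace_def)
  finally show ?thesis by (simp add: algebra_simps)
qed

lemma weyl_up_conf:
  assumes y: "y \<in> S" and n: "CARD('n) \<ge> 4"
  shows "weyl_up G' j k l m y = weyl_up G j k l m y"
proof -
  define a where "a = 1 / (real CARD('n) - 2)"
  define b where "b = 1 / ((real CARD('n) - 1) * (real CARD('n) - 2))"
  define N where "N = real CARD('n)"
  let ?A = "\<lambda>i j. schouten_diff i j y" and ?U = "\<lambda>i j. schouten_diff_up i j y"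
  let ?t = "schouten_diff_trace y" and ?g = "\<lambda>i j. G y $ i $ j"
  have a: "a * (N - 2) = 1" and b: "b * (N - 1) = a" using n by (auto simp: a_def b_def N_def)
  have e: "exp (2 * s y) * exp (- 2 * s y) = 1" by (simp flip: exp_add)
  have 1: "G' y $ k $ l * ricci_mixed G' j m y = ?g k l * (ricci_mixed G j m y - (N - 2) * ?U j m - ?t * kronecker j m)"
    for k l j
    using e unfolding ricci_mixed_conf[OF y] N_def by (simp add: G'_def)
  have 2: "scalar_curvature G' y * (kronecker j m * G' y $ k $ l - kronecker k m * G' y $ j $ l)
      = (scalar_curvature G y - 2 * (N - 1) * ?t) * (kronecker j m * ?g k l - kronecker k m * ?g j l)"
  proof -
    have "scalar_curvature G' y * (kronecker j m * G' y $ k $ l - kronecker k m * G' y $ j $ l)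
      = (exp (2 * s y) * exp (- 2 * s y)) * ((scalar_curvature G y - 2 * (N - 1) * ?t) * (kronecker j m * ?g k l - kronecker k m * ?g j l))"
      unfolding scalar_curvature_conf[OF y] N_def by (simp add: G'_def algebra_simps)
    then show ?thesis unfolding e by simp
  qed
  have up: "weyl_up M j k l m y = riemann M j k l m y
      + a * (kronecker j m * ricci M k l y - kronecker k m * ricci M j l y
        + M y $ k $ l * ricci_mixed M j m y - M y $ j $ l * ricci_mixed M k m y)
      - b * (scalar_curvature M y * (kronecker j m * M y $ k $ l - kronecker k m * M y $ j $ l))" for M
    by (simp add: weyl_up_def Let_def a_def b_def)
  let ?K = "kronecker j m * ?A k l - kronecker k m * ?A j l + ?g k l * ?U j m - ?g j l * ?U k m"
  let ?k = "kronecker j m * ?g k l - kronecker k m * ?g j l"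
  \<comment> \<open>The product \<open>?K\<close> occurs with coefficient
    \<open>1 - a * (N - 2)\<close> and the trace \<open>?t\<close> with
    \<open>2 * b * (N - 1) - 2 * a\<close>; both are zero.\<close>
  have "weyl_up G' j k l m y = weyl_up G j k l m y + ?K - (a * (N - 2)) * ?K - 2 * a * ?t * ?k + 2 * (b * (N - 1)) * ?t * ?k"
    unfolding up 1 2 unfolding riemann_conf[OF y] ricci_conf[OF y] N_def[symmetric]
    by (simp add: algebra_simps)
  then show ?thesis unfolding a b by simp
qed

lemma weyl_conf:
  assumes y: "y \<in> S" and n: "CARD('n) \<ge> 4"
  shows "weyl G' j k l m y = exp (2 * s y) * weyl G j k l m y"
  by (simp add: weyl_def weyl_up_conf[OF y n] G'_def sum_distrib_left mult_ac)

text \<open>The factor 2 before the derivative of \<open>s\<close> is 4 - 2: each of the four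
  indices contributes one such term through \<open>diff_tensor\<close>, while differentiating
  \<open>exp (2 * s y)\<close> takes two back. It is the origin of \<alpha> - 2 d\<sigma>.\<close>

lemma nabla_weyl_conf:
  assumes y: "y \<in> S" and n: "CARD('n) \<ge> 4"
  shows "nabla_weyl G' i j k l m y = exp (2 * s y) * (nabla_weyl G i j k l m y
    - 2 * partial_deriv i s y * weyl G j k l m y
    - partial_deriv j s y * weyl G i k l m y - partial_deriv k s y * weyl G j i l m y
    - partial_deriv l s y * weyl G j k i m y - partial_deriv m s y * weyl G j k l i y
    + G y $ i $ j * (\<Sum>p\<in>UNIV. ds_up p y * weyl G p k l m y)
    + G y $ i $ k * (\<Sum>p\<in>UNIV. ds_up p y * weyl G j p l m y)
    + G y $ i $ l * (\<Sum>p\<in>UNIV. ds_up p y * weyl G j k p m y)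
    + G y $ i $ m * (\<Sum>p\<in>UNIV. ds_up p y * weyl G j k l p y))"
proof -
  let ?e = "exp (2 * s y)" and ?W = "\<lambda>j k l m. weyl G j k l m y" and ?T = "\<lambda>i j m. diff_tensor i j m y"
  let ?\<Gamma> = "\<lambda>i j m. christoffel G i j m y"
  have d: "partial_deriv i (weyl G' j k l m) y
      = ?e * (2 * partial_deriv i s y * ?W j k l m + partial_deriv i (weyl G j k l m) y)"
  proof -
    have "partial_deriv i (weyl G' j k l m) y = partial_deriv i (\<lambda>z. exp (2 * s z) * weyl G j k l m z) y"
      by (rule partial_deriv_cong[OF open_S y]) (simp add: weyl_conf[OF _ n])
    then show ?thesis using partial_deriv_conf[OF y smooth_weyl] by simp
  qed
  have "nabla_weyl G' i j k l m y = ?e * (2 * partial_deriv i s y * ?W j k l m + nabla_weyl G i j k l m y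
      - ((\<Sum>p\<in>UNIV. ?T i j p * ?W p k l m) + (\<Sum>p\<in>UNIV. ?T i k p * ?W j p l m)
       + (\<Sum>p\<in>UNIV. ?T i l p * ?W j k p m) + (\<Sum>p\<in>UNIV. ?T i m p * ?W j k l p)))"
    unfolding nabla_weyl_def d christoffel_conf[OF y] weyl_conf[OF y n]
    by (simp add: algebra_simps sum.distrib sum_distrib_left)
  then show ?thesis unfolding diff_tensor_contract by (simp add: algebra_simps)
qed

end

subsection \<open>Multilinear forms\<close>

lemma sum_axis: "(\<Sum>j\<in>UNIV. axis a (1::real) $ j * f j) = f a"
  using sum.delta[of UNIV a f]
  by (simp add: axis_def if_distrib[of "\<lambda>u. u * _"] eq_commute[of a] cong: if_cong)

lemma linear_axis_eq:
  fixes f g :: "real^'n::finite \<Rightarrow> real"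
  assumes "linear f" "linear g" "\<And>i. f (axis i 1) = g (axis i 1)"
  shows "f x = g x"
  using linear_eq_sum_axis[OF assms(1), of x] linear_eq_sum_axis[OF assms(2), of x] assms(3) by simp

text \<open>Lifts component identities to arbitrary vectors, one argument at a time.\<close>

lemma multilinear4_eq:
  fixes f g :: "real^'n::finite \<Rightarrow> real^'n \<Rightarrow> real^'n \<Rightarrow> real^'n \<Rightarrow> real"
  assumes "\<And>y z w. linear (\<lambda>x. f x y z w)" "\<And>x z w. linear (\<lambda>y. f x y z w)"
    "\<And>x y w. linear (\<lambda>z. f x y z w)" "\<And>x y z. linear (\<lambda>w. f x y z w)"
    "\<And>y z w. linear (\<lambda>x. g x y z w)" "\<And>x z w. linear (\<lambda>y. g x y z w)"
    "\<And>x y w. linear (\<lambda>z. g x y z w)" "\<And>x y z. linear (\<lambda>w. g x y z w)"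
    and eq: "\<And>j k l m. f (axis j 1) (axis k 1) (axis l 1) (axis m 1)
      = g (axis j 1) (axis k 1) (axis l 1) (axis m 1)"
  shows "f x y z w = g x y z w"
proof -
  let ?e = "\<lambda>i. axis i (1::real)"
  have 1: "f (?e j) (?e k) (?e l) w = g (?e j) (?e k) (?e l) w" for j k l w
    using linear_axis_eq[OF assms(4) assms(8)] eq by blast
  have 2: "f (?e j) (?e k) z w = g (?e j) (?e k) z w" for j k z w
    using linear_axis_eq[OF assms(3) assms(7)] 1 by blast
  have 3: "f (?e j) y z w = g (?e j) y z w" for j y z w
    using linear_axis_eq[OF assms(2) assms(6)] 2 by blast
  show ?thesis
    using linear_axis_eq[OF assms(1) assms(5)] 3 by blast
qed

text \<open>Turns components into a form on vectors, to which the coordinate-free algebra of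
  \<open>recurrent_curvature_form\<close> applies.\<close>

definition form4 :: "('n::finite \<Rightarrow> 'n \<Rightarrow> 'n \<Rightarrow> 'n \<Rightarrow> real) \<Rightarrow>
    real^'n \<Rightarrow> real^'n \<Rightarrow> real^'n \<Rightarrow> real^'n \<Rightarrow> real" where
  "form4 W x y z w = (\<Sum>j\<in>UNIV. x $ j * (\<Sum>k\<in>UNIV. y $ k * (\<Sum>l\<in>UNIV. z $ l * (\<Sum>m\<in>UNIV. w $ m * W j k l m))))"

lemma form4_linear:
  "form4 W (x + x') y z w = form4 W x y z w + form4 W x' y z w"
  "form4 W x (y + y') z w = form4 W x y z w + form4 W x y' z w"
  "form4 W x y (z + z') w = form4 W x y z w + form4 W x y z' w"
  "form4 W x y z (w + w') = form4 W x y z w + form4 W x y z w'"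
  "form4 W (r *\<^sub>R x) y z w = r * form4 W x y z w"
  "form4 W x (r *\<^sub>R y) z w = r * form4 W x y z w"
  "form4 W x y (r *\<^sub>R z) w = r * form4 W x y z w"
  "form4 W x y z (r *\<^sub>R w) = r * form4 W x y z w"
  by (simp_all add: form4_def distrib_right distrib_left sum.distrib sum_distrib_left mult_ac)

definition form2 :: "real^'n^'n::finite \<Rightarrow> real^'n \<Rightarrow> real^'n \<Rightarrow> real" where
  "form2 G x y = (\<Sum>i\<in>UNIV. x $ i * (\<Sum>j\<in>UNIV. y $ j * G $ i $ j))"

lemma form2_linear:
  "form2 G (x + x') y = form2 G x y + form2 G x' y"
  "form2 G x (y + y') = form2 G x y + form2 G x y'"
  "form2 G (r *\<^sub>R x) y = r * form2 G x y"
  "form2 G x (r *\<^sub>R y) = r * form2 G x y"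
  by (simp_all add: form2_def distrib_right distrib_left sum.distrib sum_distrib_left mult_ac)

subsection \<open>The recurrence condition in a chart\<close>

locale recurrent_chart = conformal_change S G s
  for S :: "(real^'n::finite) set" and G :: "real^'n \<Rightarrow> real^'n^'n" and s :: "real^'n \<Rightarrow> real" +
  fixes \<alpha> :: "real^'n \<Rightarrow> real^'n"
  assumes dim: "CARD('n) \<ge> 4"
    and recurrent: "y \<in> S \<Longrightarrow> nabla_weyl G i j k l m y = \<alpha> y $ i * weyl G j k l m y"
    and symmetric_conf: "y \<in> S \<Longrightarrow> nabla_weyl G' i j k l m y = 0"
    and weyl_nonzero: "y \<in> S \<Longrightarrow> \<exists>j k l m. weyl G j k l m y \<noteq> 0"
    and \<alpha>_nonzero: "y \<in> S \<Longrightarrow> \<alpha> y \<noteq> 0"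
begin

definition grad :: "real^'n \<Rightarrow> real^'n" where
  "grad y = (\<chi> p. ds_up p y)"

text \<open>The vector metrically dual to \<alpha> - 2 ds, in the role of \<open>b\<close>.\<close>

definition residual :: "real^'n \<Rightarrow> real^'n" where
  "residual y = (\<chi> p. \<Sum>i\<in>UNIV. metric_inv G i p y * (\<alpha> y $ i - 2 * partial_deriv i s y))"

definition W :: "real^'n \<Rightarrow> real^'n \<Rightarrow> real^'n \<Rightarrow> real^'n \<Rightarrow> real^'n \<Rightarrow> real" where
  "W y = form4 (\<lambda>j k l m. weyl G j k l m y)"

lemma recurrence_components:
  assumes y: "y \<in> S"
  shows "(\<alpha> y $ i - 2 * partial_deriv i s y) * weyl G j k l m y =
      partial_deriv j s y * weyl G i k l m y + partial_deriv k s y * weyl G j i l m y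
    + partial_deriv l s y * weyl G j k i m y + partial_deriv m s y * weyl G j k l i y
    - G y $ i $ j * (\<Sum>p\<in>UNIV. ds_up p y * weyl G p k l m y)
    - G y $ i $ k * (\<Sum>p\<in>UNIV. ds_up p y * weyl G j p l m y)
    - G y $ i $ l * (\<Sum>p\<in>UNIV. ds_up p y * weyl G j k p m y)
    - G y $ i $ m * (\<Sum>p\<in>UNIV. ds_up p y * weyl G j k l p y)"
proof -
  have "c * (a - b) = 0 \<Longrightarrow> c \<noteq> 0 \<Longrightarrow> a = b" for a b c :: real by simp
  from this[of "exp (2 * s y)"] show ?thesis
    using nabla_weyl_conf[OF y dim, of i j k l m]
    unfolding symmetric_conf[OF y] recurrent[OF y] by (simp add: left_diff_distrib)
qed

text \<open>Contract \<open>recurrence_components\<close> over \<open>i\<close> and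
  \<open>j\<close>. Trace-freeness of the Weyl tensor removes three of the gradient terms, the
  metric contracted with its inverse yields the dimension, and the cyclic identity folds the
  remaining terms together.\<close>

lemma trace_components:
  assumes y: "y \<in> S"
  shows "(\<Sum>p\<in>UNIV. residual y $ p * weyl G p k l m y) =
    (1 - real CARD('n)) * (\<Sum>p\<in>UNIV. ds_up p y * weyl G p k l m y)"
proof -
  let ?h = "\<lambda>i j. metric_inv G i j y" and ?W = "\<lambda>j k l m. weyl G j k l m y" and ?g = "\<lambda>i j. G y $ i $ j"
  let ?s = "\<lambda>i. partial_deriv i s y" and ?\<beta> = "\<lambda>i. \<alpha> y $ i - 2 * partial_deriv i s y"
  define D where "D k l m = (\<Sum>p\<in>UNIV. ds_up p y * ?W p k l m)" for k l m
  note a12 = weyl_anti12[OF y] and a34 = weyl_anti34[OF y] and pair = weyl_pair[OF y]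
  have D2: "(\<Sum>p\<in>UNIV. ds_up p y * ?W j p l m) = - D j l m" for j l m
    unfolding D_def sum_negf[symmetric] by (rule sum.cong) (simp_all add: a12[of j])
  have D4: "(\<Sum>p\<in>UNIV. ds_up p y * ?W j k l p) = - D l j k" for j k l
    unfolding D_def sum_negf[symmetric]
    by (rule sum.cong) (simp_all add: pair[of j k] a12[of l])
  have D3: "(\<Sum>p\<in>UNIV. ds_up p y * ?W j k p m) = D m j k" for j k m
    unfolding D_def by (rule sum.cong) (simp_all add: pair[of j k])
  have Da: "D k l m = - D k m l" for k l m
    unfolding D_def sum_negf[symmetric] by (rule sum.cong) (simp_all add: a34[of _ k l m])
  have Dc: "D k l m + D l m k + D m k l = 0"
  proof -
    have "?W p k l m + ?W p l m k + ?W p m k l = 0" for p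
      using weyl_cyclic[OF y, of k l m p] pair[of p k l m] pair[of p l m k] pair[of p m k l]
        a34[of l m p k] a34[of m k p l] a34[of k l p m] by simp
    then have "(\<Sum>p\<in>UNIV. ds_up p y * (?W p k l m + ?W p l m k + ?W p m k l)) = 0" by simp
    then show ?thesis by (simp add: D_def distrib_left sum.distrib)
  qed
  have tr: "(\<Sum>i\<in>UNIV. \<Sum>j\<in>UNIV. ?h i j * ?W j k l i) = 0" for k l
    by (rule weyl_trace14[OF y dim])
  have tr13: "(\<Sum>i\<in>UNIV. \<Sum>j\<in>UNIV. ?h i j * ?W j k i m) = 0" for k m
    using tr[of k m] a34[of _ k _ m] by (simp add: sum_negf)
  have tr12: "(\<Sum>i\<in>UNIV. \<Sum>j\<in>UNIV. ?h i j * ?W j i l m) = 0" for l m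
  proof -
    have "(\<Sum>i\<in>UNIV. \<Sum>j\<in>UNIV. ?h i j * ?W j i l m) = (\<Sum>j\<in>UNIV. \<Sum>i\<in>UNIV. ?h i j * ?W j i l m)"
      by (rule sum.swap)
    also have "\<dots> = - (\<Sum>j\<in>UNIV. \<Sum>i\<in>UNIV. ?h j i * ?W i j l m)"
      unfolding sum_negf[symmetric]
    proof (intro sum.cong refl)
      fix i j
      show "?h i j * ?W j i l m = - (?h j i * ?W i j l m)"
        using inv_sym[OF y, of i j] a12[of j i l m] by simp
    qed
    finally show ?thesis by simp
  qed
  have t5: "(\<Sum>i\<in>UNIV. \<Sum>j\<in>UNIV. ?h i j * ?g i j) = real CARD('n)"
  proof -
    have "(\<Sum>j\<in>UNIV. ?h i j * ?g i j) = 1" for i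
      using inv_left'[OF y, of i i] by (simp add: kronecker_same)
    then show ?thesis by simp
  qed
  have t6: "(\<Sum>i\<in>UNIV. \<Sum>j\<in>UNIV. ?h i j * ?g i c * f j) = f c" for c f
  proof -
    have "(\<Sum>i\<in>UNIV. \<Sum>j\<in>UNIV. ?h i j * ?g i c * f j) = (\<Sum>j\<in>UNIV. (\<Sum>i\<in>UNIV. ?g c i * ?h i j) * f j)"
      by (subst sum.swap) (simp add: sum_distrib_left sum_distrib_right G_sym[OF y, of c] mult_ac)
    then show ?thesis by (simp add: inv_right[OF y] sum_kronecker)
  qed
  have "(\<Sum>p\<in>UNIV. residual y $ p * ?W p k l m) = (\<Sum>i\<in>UNIV. \<Sum>j\<in>UNIV. ?h i j * (?\<beta> i * ?W j k l m))"
    by (subst sum.swap) (simp add: residual_def sum_distrib_left sum_distrib_right mult_ac)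
  also have "\<dots> = (\<Sum>i\<in>UNIV. \<Sum>j\<in>UNIV. ?h i j * ?s j * ?W i k l m
      + ?s k * (?h i j * ?W j i l m) + ?s l * (?h i j * ?W j k i m) + ?s m * (?h i j * ?W j k l i)
      - (?h i j * ?g i j) * D k l m + ?h i j * ?g i k * D j l m - ?h i j * ?g i l * D m j k
      + ?h i j * ?g i m * D l j k)"
    unfolding recurrence_components[OF y] D2 D3 D4 D_def[symmetric]
    by (intro sum.cong refl) (simp add: algebra_simps)
  also have "\<dots> = D k l m - real CARD('n) * D k l m + D k l m - D m l k + D l m k"
    by (simp only: sum.distrib sum_subtractf sum_distrib_left[symmetric] ds_up_def[symmetric] D_def[symmetric] tr tr12 tr13
        sum_distrib_right[symmetric] t5 t6 mult_zero_right add_0_right)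
  also have "\<dots> = (1 - real CARD('n)) * D k l m"
    using Dc Da[of m l k] by (simp add: algebra_simps)
  finally show ?thesis by (simp add: D_def)
qed

lemma form2_grad: "y \<in> S \<Longrightarrow> form2 (G y) (grad y) x = (\<Sum>i\<in>UNIV. partial_deriv i s y * x $ i)"
proof -
  assume y: "y \<in> S"
  have "form2 (G y) (grad y) x = (\<Sum>j\<in>UNIV. (\<Sum>i\<in>UNIV. G y $ j $ i * ds_up i y) * x $ j)"
    unfolding form2_def grad_def
    by (simp add: sum_distrib_left sum_distrib_right G_sym[OF y] mult_ac) (subst sum.swap, simp add: G_sym[OF y])
  then show ?thesis using ds_lower[OF y] by simp
qed

lemma form2_residual: "y \<in> S \<Longrightarrow>
  form2 (G y) (residual y) x = (\<Sum>i\<in>UNIV. (\<alpha> y $ i - 2 * partial_deriv i s y) * x $ i)"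
proof -
  assume y: "y \<in> S"
  let ?\<beta> = "\<lambda>i. \<alpha> y $ i - 2 * partial_deriv i s y"
  have l: "(\<Sum>i\<in>UNIV. residual y $ i * G y $ i $ j) = ?\<beta> j" for j
  proof -
    have "(\<Sum>i\<in>UNIV. residual y $ i * G y $ i $ j)
        = (\<Sum>i\<in>UNIV. \<Sum>q\<in>UNIV. ?\<beta> q * (metric_inv G q i y * G y $ i $ j))"
      by (simp add: residual_def sum_distrib_left sum_distrib_right mult_ac)
    also have "\<dots> = (\<Sum>q\<in>UNIV. ?\<beta> q * (\<Sum>i\<in>UNIV. metric_inv G q i y * G y $ i $ j))"
      by (subst sum.swap) (simp add: sum_distrib_left)
    finally show ?thesis by (simp add: inv_left[OF y] sum_kronecker)
  qed
  have "form2 (G y) (residual y) x = (\<Sum>i\<in>UNIV. \<Sum>j\<in>UNIV. (residual y $ i * G y $ i $ j) * x $ j)"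
    by (simp add: form2_def sum_distrib_left mult_ac)
  also have "\<dots> = (\<Sum>j\<in>UNIV. (\<Sum>i\<in>UNIV. residual y $ i * G y $ i $ j) * x $ j)"
    by (subst sum.swap) (simp add: sum_distrib_right)
  finally show ?thesis by (simp add: l)
qed

lemma form2_sym: "y \<in> S \<Longrightarrow> form2 (G y) u v = form2 (G y) v u"
  unfolding form2_def sum_distrib_left
  by (subst sum.swap) (simp add: G_sym mult_ac)

lemma form2_nondegenerate:
  assumes y: "y \<in> S" and "\<And>x. form2 (G y) u x = 0"
  shows "u = 0"
proof -
  have "(\<Sum>i\<in>UNIV. u $ i * G y $ i $ j) = 0" for j
    using assms(2)[of "axis j 1"] by (simp add: form2_def sum_axis)
  then have "(\<Sum>j\<in>UNIV. (\<Sum>i\<in>UNIV. u $ i * G y $ i $ j) * metric_inv G j k y) = 0" for k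
    by simp
  moreover have "(\<Sum>j\<in>UNIV. (\<Sum>i\<in>UNIV. u $ i * G y $ i $ j) * metric_inv G j k y)
      = (\<Sum>i\<in>UNIV. u $ i * (\<Sum>j\<in>UNIV. G y $ i $ j * metric_inv G j k y))" for k
    by (simp only: sum_distrib_right sum_distrib_left mult.assoc) (rule sum.swap)
  ultimately show ?thesis by (simp add: inv_right[OF y] sum_kronecker vec_eq_iff)
qed

text \<open>With a vanishing gradient, \<open>recurrence_components\<close> would leave \<alpha>
  times the Weyl tensor equal to zero, although neither vanishes.\<close>

lemma grad_nonzero:
  assumes y: "y \<in> S"
  shows "grad y \<noteq> 0"
proof
  assume "grad y = 0"
  then have t: "ds_up p y = 0" for p by (simp add: grad_def vec_eq_iff)
  then have "partial_deriv i s y = 0" for i using ds_lower[OF y, of i] by simp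
  then have "\<alpha> y $ i * weyl G j k l m y = 0" for i j k l m
    using recurrence_components[OF y, of i j k l m] t by simp
  then show False using weyl_nonzero[OF y] \<alpha>_nonzero[OF y] by (force simp: vec_eq_iff)
qed

lemma recurrent_curvature_form_W:
  assumes y: "y \<in> S"
  shows "recurrent_curvature_form (W y) (form2 (G y)) (grad y) (residual y) (real CARD('n))"
proof
  note lin = linear_iff form4_linear form2_linear algebra_simps
  note ax = form4_def form2_def sum_axis
  show "W y (x + x') z w v = W y x z w v + W y x' z w v" "W y (r *\<^sub>R x) z w v = r * W y x z w v" for x x' z w v r
    by (simp_all add: W_def form4_linear)
  show "W y x z w v = - W y z x w v" for x z w v
  proof (rule multilinear4_eq[where f = "W y" and g = "\<lambda>x z w v. - W y z x w v"])
    fix j k l m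
    show "W y (axis j 1) (axis k 1) (axis l 1) (axis m 1) = - W y (axis k 1) (axis j 1) (axis l 1) (axis m 1)"
      using weyl_anti12[OF y, of j k l m] by (simp add: W_def ax)
  qed (simp_all add: W_def lin)
  show "W y x z w v = - W y x z v w" for x z w v
  proof (rule multilinear4_eq[where f = "W y" and g = "\<lambda>x z w v. - W y x z v w"])
    fix j k l m
    show "W y (axis j 1) (axis k 1) (axis l 1) (axis m 1) = - W y (axis j 1) (axis k 1) (axis m 1) (axis l 1)"
      using weyl_anti34[OF y, of j k l m] by (simp add: W_def ax)
  qed (simp_all add: W_def lin)
  show "W y x z w v + W y z w x v + W y w x z v = 0" for x z w v
  proof (rule multilinear4_eq[where f = "\<lambda>x z w v. W y x z w v + W y z w x v + W y w x z v" and g = "\<lambda>x z w v. 0"])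
    fix j k l m
    show "W y (axis j 1) (axis k 1) (axis l 1) (axis m 1) + W y (axis k 1) (axis l 1) (axis j 1) (axis m 1) + W y (axis l 1) (axis j 1) (axis k 1) (axis m 1) = 0"
      using weyl_cyclic[OF y, of j k l m] by (simp add: W_def ax)
  qed (simp_all add: W_def lin)
  obtain j k l m where "weyl G j k l m y \<noteq> 0" using weyl_nonzero[OF y] by blast
  then have "W y (axis j 1) (axis k 1) (axis l 1) (axis m 1) \<noteq> 0" by (simp add: W_def ax)
  then show "\<exists>x z w v. W y x z w v \<noteq> 0" by blast
  show "form2 (G y) (x + x') z = form2 (G y) x z + form2 (G y) x' z"
    "form2 (G y) (r *\<^sub>R x) z = r * form2 (G y) x z" for x x' z r
    by (simp_all add: form2_linear)
  show "form2 (G y) x z = form2 (G y) z x" for x z by (rule form2_sym[OF y])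
  show "(\<And>x. form2 (G y) u x = 0) \<Longrightarrow> u = 0" for u by (rule form2_nondegenerate[OF y])
  show "grad y \<noteq> 0" by (rule grad_nonzero[OF y])
  show "real CARD('n) \<ge> 4" using dim by simp
  have z: "linear (\<lambda>z. W y x z w v)" "linear (\<lambda>z. W y x w z v)" "linear (\<lambda>z. W y x w v z)" for x w v
    by (simp_all add: W_def lin)
  show "W y (residual y) z w v = (1 - real CARD('n)) * W y (grad y) z w v" for z w v
  proof -
    let ?c = "1 - real CARD('n)"
    have "W y (residual y) (axis k 1) (axis l 1) (axis m 1) = ?c * W y (grad y) (axis k 1) (axis l 1) (axis m 1)" for k l m
      using trace_components[OF y, of k l m] by (simp add: W_def ax grad_def)
    then have 1: "W y (residual y) (axis k 1) (axis l 1) v = ?c * W y (grad y) (axis k 1) (axis l 1) v" for k l v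
      by (intro linear_axis_eq[where x = v and f = "\<lambda>v. W y (residual y) (axis k 1) (axis l 1) v"
            and g = "\<lambda>v. ?c * W y (grad y) (axis k 1) (axis l 1) v"]) (simp_all add: W_def lin)
    then have 2: "W y (residual y) (axis k 1) w v = ?c * W y (grad y) (axis k 1) w v" for k w v
      by (intro linear_axis_eq[where x = w and f = "\<lambda>w. W y (residual y) (axis k 1) w v"
            and g = "\<lambda>w. ?c * W y (grad y) (axis k 1) w v"]) (simp_all add: W_def lin)
    then show ?thesis
      by (intro linear_axis_eq[where x = z and f = "\<lambda>z. W y (residual y) z w v"
            and g = "\<lambda>z. ?c * W y (grad y) z w v"]) (simp_all add: W_def lin)
  qed
  show "form2 (G y) (residual y) v * W y x x2 x3 x4 =
      form2 (G y) (grad y) x * W y v x2 x3 x4 + form2 (G y) (grad y) x2 * W y x v x3 x4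
    + form2 (G y) (grad y) x3 * W y x x2 v x4 + form2 (G y) (grad y) x4 * W y x x2 x3 v
    - form2 (G y) v x * W y (grad y) x2 x3 x4 - form2 (G y) v x2 * W y x (grad y) x3 x4
    - form2 (G y) v x3 * W y x x2 (grad y) x4 - form2 (G y) v x4 * W y x x2 x3 (grad y)" for v x x2 x3 x4
  proof (rule multilinear4_eq[where
        f = "\<lambda>x x2 x3 x4. form2 (G y) (residual y) v * W y x x2 x3 x4" and
        g = "\<lambda>x x2 x3 x4. form2 (G y) (grad y) x * W y v x2 x3 x4 + form2 (G y) (grad y) x2 * W y x v x3 x4
    + form2 (G y) (grad y) x3 * W y x x2 v x4 + form2 (G y) (grad y) x4 * W y x x2 x3 v
    - form2 (G y) v x * W y (grad y) x2 x3 x4 - form2 (G y) v x2 * W y x (grad y) x3 x4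
    - form2 (G y) v x3 * W y x x2 (grad y) x4 - form2 (G y) v x4 * W y x x2 x3 (grad y)"])
    fix j k l m
    show "form2 (G y) (residual y) v * W y (axis j 1) (axis k 1) (axis l 1) (axis m 1) =
      form2 (G y) (grad y) (axis j 1) * W y v (axis k 1) (axis l 1) (axis m 1)
    + form2 (G y) (grad y) (axis k 1) * W y (axis j 1) v (axis l 1) (axis m 1)
    + form2 (G y) (grad y) (axis l 1) * W y (axis j 1) (axis k 1) v (axis m 1)
    + form2 (G y) (grad y) (axis m 1) * W y (axis j 1) (axis k 1) (axis l 1) v
    - form2 (G y) v (axis j 1) * W y (grad y) (axis k 1) (axis l 1) (axis m 1)
    - form2 (G y) v (axis k 1) * W y (axis j 1) (grad y) (axis l 1) (axis m 1)
    - form2 (G y) v (axis l 1) * W y (axis j 1) (axis k 1) (grad y) (axis m 1)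
    - form2 (G y) v (axis m 1) * W y (axis j 1) (axis k 1) (axis l 1) (grad y)" (is "?f v = ?g v")
    proof (rule linear_axis_eq[where x = v])
      show "linear ?f" "linear ?g" by (simp_all add: W_def lin)
      fix i
      show "?f (axis i 1) = ?g (axis i 1)"
        using recurrence_components[OF y, of i j k l m] sum_axis[of i] sum_axis[of j] sum_axis[of k] sum_axis[of l] sum_axis[of m]
        by (simp add: form2_residual[OF y] form2_grad[OF y] mult.commute[of _ "axis _ _ $ _"])
          (simp add: W_def form4_def form2_def sum_axis grad_def)
    qed
  qed (simp_all add: W_def lin)
qed

end

subsection \<open>Positivity of the trace form\<close>

text \<open>As \<tau> is null and not orthogonal to \<nu>, the two span a Lorentzian plane, and
  \<open>S\<close> lives on its spacelike orthogonal complement. Instead of adapting a frame to this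
  plane, the proof changes \<open>S\<close> by multiples of the covector \<open>m\<close> dual to
  \<tau>.\<close>

lemma minkowski_square_sum_pos:
  fixes S :: "'n::finite \<Rightarrow> 'n \<Rightarrow> real" and \<tau> \<nu> \<eta> :: "'n \<Rightarrow> real"
  assumes \<eta>: "\<And>a. \<eta> a = (if a = i0 then - 1 else 1)"
    and S_sym: "\<And>a b. S a b = S b a" and S_nonzero: "S a0 b0 \<noteq> 0"
    and S\<tau>: "\<And>a. (\<Sum>b\<in>UNIV. S a b * \<tau> b) = 0" and S\<nu>: "\<And>a. (\<Sum>b\<in>UNIV. S a b * \<nu> b) = 0"
    and null: "(\<Sum>a\<in>UNIV. \<eta> a * \<tau> a * \<tau> a) = 0" and \<tau>\<nu>: "(\<Sum>a\<in>UNIV. \<eta> a * \<tau> a * \<nu> a) \<noteq> 0"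
  shows "(\<Sum>a\<in>UNIV. \<Sum>b\<in>UNIV. \<eta> a * \<eta> b * (S a b * S a b)) > 0"
proof -
  have \<eta>2: "\<eta> a * (\<eta> a * x) = x" for a x by (simp add: \<eta>)
  \<comment> \<open>A null vector without time component has vanishing Euclidean norm.\<close>
  have \<tau>0: "\<tau> i0 \<noteq> 0"
  proof
    assume 0: "\<tau> i0 = 0"
    then have "(\<Sum>a\<in>UNIV. \<tau> a * \<tau> a) = (\<Sum>a\<in>UNIV. \<eta> a * \<tau> a * \<tau> a)"
      by (intro sum.cong) (auto simp: \<eta>)
    then have "\<tau> a = 0" for a using null by (simp add: sum_nonneg_eq_0_iff)
    then show False using \<tau>\<nu> by simp
  qed
  define m where "m a = \<eta> a * \<tau> a / \<tau> i0" for a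
  define r where "r a = S a i0" for a
  \<comment> \<open>\<open>T\<close> has the same square sum as \<open>S\<close>, because \<open>m\<close> is null and annihilated by \<open>S\<close>, but vanishes
    in the timelike direction \<open>i0\<close>, where the signs \<open>\<eta>\<close> could be negative.\<close>
  define T where "T a b = S a b + m a * r b + r a * m b + r i0 * m a * m b" for a b
  have m0: "m i0 = - 1" using \<tau>0 by (simp add: m_def \<eta>)
  have mS: "(\<Sum>b\<in>UNIV. \<eta> b * m b * S a b) = 0" for a
  proof -
    have "(\<Sum>b\<in>UNIV. \<eta> b * m b * S a b) = (\<Sum>b\<in>UNIV. S a b * \<tau> b) / \<tau> i0"
      unfolding sum_divide_distrib by (rule sum.cong) (auto simp: m_def \<eta>)
    then show ?thesis using S\<tau> by simp
  qed
  have mr: "(\<Sum>b\<in>UNIV. \<eta> b * m b * r b) = 0" using mS[of i0] S_sym by (simp add: r_def)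
  have mm: "(\<Sum>b\<in>UNIV. \<eta> b * m b * m b) = 0"
  proof -
    have "(\<Sum>b\<in>UNIV. \<eta> b * m b * m b) = (\<Sum>a\<in>UNIV. \<eta> a * \<tau> a * \<tau> a) / (\<tau> i0 * \<tau> i0)"
      unfolding sum_divide_distrib by (rule sum.cong) (auto simp: m_def \<eta>)
    then show ?thesis using null by simp
  qed
  let ?R = "\<Sum>b\<in>UNIV. \<eta> b * r b * r b"
  \<comment> \<open>Most products contain a contraction of \<open>m\<close> with \<open>m\<close>,
    \<open>r\<close> or \<open>S\<close> and vanish already in the sum over \<open>b\<close>; the
    two surviving extra terms vanish in the sum over \<open>a\<close>.\<close>
  have inner: "(\<Sum>b\<in>UNIV. \<eta> a * \<eta> b * (T a b * T a b)) =
      (\<Sum>b\<in>UNIV. \<eta> a * \<eta> b * (S a b * S a b)) + 2 * (\<Sum>b\<in>UNIV. \<eta> b * r b * (\<eta> a * m a * S a b))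
      + \<eta> a * m a * m a * ?R" for a
  proof -
    have "(\<Sum>b\<in>UNIV. \<eta> a * \<eta> b * (T a b * T a b)) = (\<Sum>b\<in>UNIV. \<eta> a * \<eta> b * (S a b * S a b)
        + 2 * (\<eta> b * r b * (\<eta> a * m a * S a b)) + 2 * \<eta> a * r a * (\<eta> b * m b * S a b)
        + 2 * \<eta> a * r i0 * m a * (\<eta> b * m b * S a b)
        + \<eta> a * m a * m a * (\<eta> b * r b * r b) + \<eta> a * r a * r a * (\<eta> b * m b * m b)
        + \<eta> a * r i0 * r i0 * m a * m a * (\<eta> b * m b * m b) + 2 * \<eta> a * m a * r a * (\<eta> b * m b * r b)
        + 2 * \<eta> a * r i0 * m a * m a * (\<eta> b * m b * r b) + 2 * \<eta> a * r i0 * r a * m a * (\<eta> b * m b * m b))"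
      by (rule sum.cong) (simp_all add: T_def algebra_simps)
    then show ?thesis
      by (simp only: sum.distrib sum_distrib_left[symmetric] mS mr mm mult_zero_right add_0_right)
  qed
  have "(\<Sum>a\<in>UNIV. \<Sum>b\<in>UNIV. \<eta> b * r b * (\<eta> a * m a * S a b)) = 0"
  proof -
    have "(\<Sum>a\<in>UNIV. \<Sum>b\<in>UNIV. \<eta> b * r b * (\<eta> a * m a * S a b))
        = (\<Sum>b\<in>UNIV. \<eta> b * r b * (\<Sum>a\<in>UNIV. \<eta> a * m a * S b a))"
      unfolding sum_distrib_left by (subst sum.swap) (simp add: S_sym)
    then show ?thesis by (simp add: mS)
  qed
  moreover have "(\<Sum>a\<in>UNIV. \<eta> a * m a * m a * ?R) = 0"
    by (simp only: sum_distrib_right[symmetric] mm mult_zero_left)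
  ultimately have eq: "(\<Sum>a\<in>UNIV. \<Sum>b\<in>UNIV. \<eta> a * \<eta> b * (T a b * T a b))
      = (\<Sum>a\<in>UNIV. \<Sum>b\<in>UNIV. \<eta> a * \<eta> b * (S a b * S a b))"
    by (simp only: inner sum.distrib sum_distrib_left[symmetric] mult_zero_right add_0_right)
  have "T a i0 = 0" "T i0 a = 0" for a
    using m0 S_sym[of i0 a] by (simp_all add: T_def r_def)
  then have "\<eta> a * \<eta> b * (T a b * T a b) = T a b * T a b" for a b
    by (cases "a = i0"; cases "b = i0") (simp_all add: \<eta>)
  with eq have eq': "(\<Sum>a\<in>UNIV. \<Sum>b\<in>UNIV. \<eta> a * \<eta> b * (S a b * S a b)) = (\<Sum>a\<in>UNIV. \<Sum>b\<in>UNIV. T a b * T a b)"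
    by simp
  moreover have "(\<Sum>a\<in>UNIV. \<Sum>b\<in>UNIV. T a b * T a b) \<noteq> 0"
  proof
    assume "(\<Sum>a\<in>UNIV. \<Sum>b\<in>UNIV. T a b * T a b) = 0"
    then have T0: "T a b = 0" for a b
      by (simp add: sum_nonneg_eq_0_iff sum_nonneg)
    \<comment> \<open>If \<open>T\<close> vanished, applying it to \<nu> would make \<open>r\<close>
      a multiple of \<open>m\<close>, and so \<open>S\<close> a multiple of the square of
      \<open>m\<close>. But \<open>S\<close> annihilates \<nu> while \<open>m\<close> does not, so
      \<open>S\<close> would be zero.\<close>
    define c where "c = (\<Sum>b\<in>UNIV. m b * \<nu> b)"
    define d where "d = (\<Sum>b\<in>UNIV. r b * \<nu> b)"
    have "c = (\<Sum>a\<in>UNIV. \<eta> a * \<tau> a * \<nu> a) / \<tau> i0"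
      unfolding c_def m_def sum_divide_distrib by simp
    then have c: "c \<noteq> 0" using \<tau>\<nu> \<tau>0 by simp
    have "m a * d + r a * c + r i0 * m a * c = 0" for a
    proof -
      have "(\<Sum>b\<in>UNIV. T a b * \<nu> b) = 0" by (simp add: T0)
      moreover have "(\<Sum>b\<in>UNIV. T a b * \<nu> b) = (\<Sum>b\<in>UNIV. S a b * \<nu> b) + m a * d + r a * c + r i0 * m a * c"
        by (simp add: T_def c_def d_def distrib_right distrib_left sum.distrib sum_distrib_left mult_ac)
      ultimately show ?thesis using S\<nu> by simp
    qed
    then have "r a * c = (- d - r i0 * c) * m a" for a by (simp add: algebra_simps add_eq_0_iff2)
    then have r: "r a = (- d - r i0 * c) / c * m a" for a using c by (simp add: field_simps)
    define e where "e = (- d - r i0 * c) / c"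
    have S: "S a b = - (2 * e + r i0) * (m a * m b)" for a b
      using T0[of a b] r[of a] r[of b] unfolding T_def e_def[symmetric] by (simp add: algebra_simps)
    have "(\<Sum>b\<in>UNIV. S i0 b * \<nu> b) = (2 * e + r i0) * c"
      unfolding c_def sum_distrib_left by (rule sum.cong) (simp_all add: S m0 algebra_simps)
    then have "2 * e + r i0 = 0" using S\<nu> c by simp
    then show False using S S_nonzero by simp
  qed
  moreover have "(\<Sum>a\<in>UNIV. \<Sum>b\<in>UNIV. T a b * T a b) \<ge> 0" by (intro sum_nonneg) simp
  ultimately show ?thesis by linarith
qed

lemma inner_transpose: "x \<bullet> (transpose A *v y) = (A *v x) \<bullet> (y :: real^'n::finite)"
  by (metis dot_lmul_matrix inner_commute transpose_matrix_vector)

lemma form2_inner: "form2 G x y = x \<bullet> (G *v y)"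
  by (simp add: form2_def inner_vec_def matrix_vector_mult_def mult.commute)

text \<open>In the orthonormal frame given by the columns of \<open>P\<close>, the inverse metric is
  \<open>P ** E ** transpose P\<close>, so the trace becomes the signed square sum of the entries of
  \<open>transpose P ** S ** P\<close>.\<close>

lemma lorentzian_trace_pos:
  fixes G S :: "real^'n::finite^'n"
  assumes G: "lorentzian_form G" and S_sym: "transpose S = S" and S_nonzero: "S \<noteq> 0"
    and St: "S *v t = 0" and SN: "S *v N = 0"
    and null: "form2 G t t = 0" and tN: "form2 G t N \<noteq> 0"
  shows "trace (S ** (matrix_inv G ** (S ** matrix_inv G))) > 0"
proof -
  obtain P :: "real^'n^'n" and i0 where P: "invertible P" and GP: "transpose P ** G ** P =
      (\<chi> i j. if i \<noteq> j then 0 else if i = i0 then - 1 else 1)"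
    using G unfolding lorentzian_form_def by blast
  define E :: "real^'n^'n" where "E = (\<chi> i j. if i \<noteq> j then 0 else if i = i0 then - 1 else 1)"
  define \<eta> :: "'n \<Rightarrow> real" where "\<eta> a = (if a = i0 then - 1 else 1)" for a
  have E: "(M ** E) $ a $ b = M $ a $ b * \<eta> b" "(E *v v) $ a = \<eta> a * v $ a" for M :: "real^'n^'n" and v a b
  proof -
    have e: "E $ a $ b = (if a = b then \<eta> b else 0)" for a b by (simp add: E_def \<eta>_def)
    show "(M ** E) $ a $ b = M $ a $ b * \<eta> b"
      by (simp add: matrix_matrix_mult_def e if_distrib[of "\<lambda>x. _ * x"] cong: if_cong)
    show "(E *v v) $ a = \<eta> a * v $ a"
      by (simp add: matrix_vector_mult_def e if_distrib[of "\<lambda>x. x * _"] eq_commute[of a] cong: if_cong)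
  qed
  have EE: "E ** E = mat 1"
    by (simp add: vec_eq_iff E(1)) (simp add: E_def \<eta>_def mat_def)
  define Q where "Q = matrix_inv P"
  have PQ: "P ** Q = mat 1" "Q ** P = mat 1" using matrix_inv_inverse[OF P] by (simp_all add: Q_def)
  have TPQ: "transpose Q ** transpose P = mat 1"
    using PQ(1) by (metis matrix_transpose_mul transpose_mat)
  have "P ** E ** transpose P ** G = P ** E ** (transpose P ** G ** P) ** Q"
    by (simp add: matrix_mul_assoc[symmetric] PQ)
  also have "\<dots> = P ** (E ** E) ** Q" unfolding GP E_def[symmetric] by (simp add: matrix_mul_assoc)
  also have "\<dots> = mat 1" by (simp add: EE PQ)
  finally have h: "matrix_inv G = P ** E ** transpose P" by (rule matrix_inv_eqI)
  define T where "T = transpose P ** S ** P"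
  have "trace (S ** (matrix_inv G ** (S ** matrix_inv G))) = trace (S ** P ** E ** T ** E ** transpose P)"
    unfolding h T_def by (simp add: matrix_mul_assoc)
  also have "\<dots> = trace (transpose P ** (S ** P ** E ** T ** E))" by (rule trace_mul_sym)
  also have "\<dots> = trace (T ** E ** T ** E)" by (simp add: T_def matrix_mul_assoc)
  also have "\<dots> = (\<Sum>a\<in>UNIV. \<Sum>b\<in>UNIV. \<eta> a * \<eta> b * (T $ a $ b * T $ b $ a))"
  proof -
    have "(T ** E ** T) $ a $ a = (\<Sum>b\<in>UNIV. (T $ a $ b * \<eta> b) * T $ b $ a)" for a
      unfolding matrix_matrix_mult_def[of "T ** E"] using E(1)[of T] by simp
    then show ?thesis
      unfolding trace_def E(1) by (simp add: sum_distrib_left sum_distrib_right mult_ac)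
  qed
  finally have eq: "trace (S ** (matrix_inv G ** (S ** matrix_inv G)))
      = (\<Sum>a\<in>UNIV. \<Sum>b\<in>UNIV. \<eta> a * \<eta> b * (T $ a $ b * T $ b $ a))" .
  have "transpose T = T" by (simp add: T_def matrix_transpose_mul S_sym matrix_mul_assoc)
  then have T_sym: "T $ a $ b = T $ b $ a" for a b by (metis transpose_def vec_lambda_beta)
  have "transpose Q ** T ** Q = (transpose Q ** transpose P) ** S ** (P ** Q)"
    by (simp add: T_def matrix_mul_assoc)
  then have "transpose Q ** T ** Q = S" by (simp add: PQ TPQ)
  then have "T \<noteq> 0" using S_nonzero by auto
  then obtain a0 b0 where T0: "T $ a0 $ b0 \<noteq> 0" by (auto simp: vec_eq_iff)
  have TQ: "T *v (Q *v v) = 0" if "S *v v = 0" for v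
  proof -
    have "T *v (Q *v v) = transpose P *v (S *v ((P ** Q) *v v))"
      by (simp add: T_def matrix_vector_mul_assoc matrix_mul_assoc)
    then show ?thesis using that by (simp add: PQ)
  qed
  have form: "form2 G u v = (\<Sum>a\<in>UNIV. \<eta> a * (Q *v u) $ a * (Q *v v) $ a)" for u v
  proof -
    have "u = P *v (Q *v u)" "v = P *v (Q *v v)" by (simp_all add: matrix_vector_mul_assoc PQ)
    then have "form2 G u v = (Q *v u) \<bullet> (transpose P *v (G *v (P *v (Q *v v))))"
      unfolding form2_inner inner_transpose by simp
    also have "\<dots> = (Q *v u) \<bullet> (E *v (Q *v v))"
      using GP by (simp add: E_def matrix_vector_mul_assoc matrix_mul_assoc)
    finally show ?thesis by (simp add: inner_vec_def E(2) mult_ac)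
  qed
  have Tv: "(\<Sum>b\<in>UNIV. T $ a $ b * (Q *v v) $ b) = 0" if "S *v v = 0" for a v
  proof -
    have "(T *v (Q *v v)) $ a = 0" using TQ[OF that] by simp
    then show ?thesis by (simp only: matrix_vector_mult_def vec_lambda_beta)
  qed
  have "(\<Sum>a\<in>UNIV. \<Sum>b\<in>UNIV. \<eta> a * \<eta> b * (T $ a $ b * T $ a $ b)) > 0"
    by (rule minkowski_square_sum_pos[where \<tau> = "\<lambda>a. (Q *v t) $ a" and \<nu> = "\<lambda>a. (Q *v N) $ a"])
       (use \<eta>_def T_sym T0 Tv[OF St] Tv[OF SN] null tN form in \<open>auto simp del: matrix_vector_mul_assoc\<close>)
  then show ?thesis using eq T_sym by simp
qed

section \<open>Recurrence of the quadratic contraction of the Weyl tensor\<close>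

context metric_on
begin

lemma sum_swap_mult:
  fixes f c :: "'n \<Rightarrow> real" and w :: "'n \<Rightarrow> 'n \<Rightarrow> real"
  shows "(\<Sum>r\<in>UNIV. f r * (\<Sum>e\<in>UNIV. c e * w e r)) = (\<Sum>e\<in>UNIV. c e * (\<Sum>r\<in>UNIV. f r * w e r))"
  unfolding sum_distrib_left by (subst sum.swap) (simp add: mult_ac)

text \<open>The factor \<open>z\<close> is a sign: the Christoffel correction enters with -1 for an
  index that has already been raised and with 1 otherwise.\<close>

lemma sum_mult_combination:
  fixes f c d b w :: "'n \<Rightarrow> real" and w1 w2 w3 :: "'n \<Rightarrow> 'n \<Rightarrow> real"
  shows "(\<Sum>r\<in>UNIV. f r * (a * w r + (\<Sum>e\<in>UNIV. c e * w1 e r) + z * (\<Sum>e\<in>UNIV. d e * w2 e r)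
      + (\<Sum>e\<in>UNIV. b e * w3 e r))) =
    a * (\<Sum>r\<in>UNIV. f r * w r) + (\<Sum>e\<in>UNIV. c e * (\<Sum>r\<in>UNIV. f r * w1 e r))
    + z * (\<Sum>e\<in>UNIV. d e * (\<Sum>r\<in>UNIV. f r * w2 e r)) + (\<Sum>e\<in>UNIV. b e * (\<Sum>r\<in>UNIV. f r * w3 e r))"
proof -
  have "(\<Sum>r\<in>UNIV. f r * (a * w r + (\<Sum>e\<in>UNIV. c e * w1 e r) + z * (\<Sum>e\<in>UNIV. d e * w2 e r)
      + (\<Sum>e\<in>UNIV. b e * w3 e r))) =
    (\<Sum>r\<in>UNIV. a * (f r * w r) + f r * (\<Sum>e\<in>UNIV. c e * w1 e r) + z * (f r * (\<Sum>e\<in>UNIV. d e * w2 e r))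
      + f r * (\<Sum>e\<in>UNIV. b e * w3 e r))"
    by (rule sum.cong) (simp_all add: distrib_left mult_ac)
  then show ?thesis
    using sum_swap_mult[of f c w1] sum_swap_mult[of f d w2] sum_swap_mult[of f b w3]
    by (simp only: sum.distrib sum_distrib_left[symmetric])
qed

text \<open>Raising an index commutes with covariant differentiation. \<open>A\<close> collects all
  of the derivative of \<open>F\<close> except the correction for the index to be raised; only that
  correction changes its sign and form.\<close>

lemma partial_deriv_raise:
  assumes y: "y \<in> S" and F: "\<And>r. smooth_on S (F r)"
    and dF: "\<And>r. partial_deriv i (F r) y = A r + (\<Sum>e\<in>UNIV. christoffel G i r e y * F e y)"
  shows "partial_deriv i (\<lambda>x. \<Sum>r\<in>UNIV. metric_inv G k r x * F r x) y =
    (\<Sum>r\<in>UNIV. metric_inv G k r y * A r)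
    - (\<Sum>e\<in>UNIV. christoffel G i e k y * (\<Sum>r\<in>UNIV. metric_inv G e r y * F r y))"
proof -
  let ?h = "\<lambda>p q. metric_inv G p q y" and ?\<Gamma> = "\<lambda>p q. christoffel G i p q y"
  have "partial_deriv i (\<lambda>x. \<Sum>r\<in>UNIV. metric_inv G k r x * F r x) y
      = (\<Sum>r\<in>UNIV. partial_deriv i (\<lambda>x. metric_inv G k r x * F r x) y)"
    by (intro partial_deriv_sum smooth_differentiable smooth_intros smooth_metric_inv F y)
  also have "\<dots> = (\<Sum>r\<in>UNIV. ?h k r * (A r + (\<Sum>e\<in>UNIV. ?\<Gamma> r e * F e y))
      + (- (\<Sum>p\<in>UNIV. ?\<Gamma> p k * ?h p r) - (\<Sum>p\<in>UNIV. ?\<Gamma> p r * ?h k p)) * F r y)"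
    using smooth_differentiable[OF smooth_metric_inv y] smooth_differentiable[OF F y]
    by (simp add: partial_deriv_mult partial_deriv_metric_inv[OF y] dF)
  also have "\<dots> = (\<Sum>r\<in>UNIV. ?h k r * A r) + (\<Sum>r\<in>UNIV. \<Sum>e\<in>UNIV. ?h k r * ?\<Gamma> r e * F e y)
      - (\<Sum>r\<in>UNIV. \<Sum>p\<in>UNIV. ?\<Gamma> p k * ?h p r * F r y) - (\<Sum>r\<in>UNIV. \<Sum>p\<in>UNIV. ?\<Gamma> p r * ?h k p * F r y)"
    by (simp add: sum.distrib sum_subtractf sum_negf sum_distrib_left sum_distrib_right
        distrib_left left_diff_distrib mult.assoc)
  also have "(\<Sum>r\<in>UNIV. \<Sum>e\<in>UNIV. ?h k r * ?\<Gamma> r e * F e y) = (\<Sum>r\<in>UNIV. \<Sum>p\<in>UNIV. ?\<Gamma> p r * ?h k p * F r y)"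
    by (subst sum.swap) (simp add: mult_ac)
  also have "(\<Sum>r\<in>UNIV. \<Sum>p\<in>UNIV. ?\<Gamma> p k * ?h p r * F r y)
      = (\<Sum>e\<in>UNIV. ?\<Gamma> e k * (\<Sum>r\<in>UNIV. ?h e r * F r y))"
    by (subst sum.swap) (simp add: sum_distrib_left mult_ac)
  finally show ?thesis by simp
qed

lemma partial_deriv_weyl:
  "partial_deriv i (weyl G j k l m) y = nabla_weyl G i j k l m y
     + (\<Sum>e\<in>UNIV. christoffel G i j e y * weyl G e k l m y) + (\<Sum>e\<in>UNIV. christoffel G i k e y * weyl G j e l m y)
     + (\<Sum>e\<in>UNIV. christoffel G i l e y * weyl G j k e m y) + (\<Sum>e\<in>UNIV. christoffel G i m e y * weyl G j k l e y)"
  by (simp add: nabla_weyl_def sum.distrib)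

text \<open>The intermediate tensor \<open>C\<^sub>p\<^sup>k\<^sub>q\<^sub>u\<close>: indices are
  raised one at a time so that \<open>partial_deriv_raise\<close> can be applied twice.\<close>

definition weyl_raised1 :: "'n \<Rightarrow> 'n \<Rightarrow> 'n \<Rightarrow> 'n \<Rightarrow> real^'n \<Rightarrow> real" where
  "weyl_raised1 p k q u y = (\<Sum>r\<in>UNIV. metric_inv G k r y * weyl G p r q u y)"

definition weyl_raised :: "'n \<Rightarrow> 'n \<Rightarrow> 'n \<Rightarrow> 'n \<Rightarrow> real^'n \<Rightarrow> real" where
  "weyl_raised p k q m y = (\<Sum>u\<in>UNIV. metric_inv G m u y * weyl_raised1 p k q u y)"

definition weyl_square :: "'n \<Rightarrow> 'n \<Rightarrow> 'n \<Rightarrow> 'n \<Rightarrow> real^'n \<Rightarrow> real" where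
  "weyl_square j l p q y = (\<Sum>k\<in>UNIV. \<Sum>m\<in>UNIV. weyl G j k l m y * weyl_raised p k q m y)"

lemma smooth_weyl_raised1: "smooth_on S (weyl_raised1 p k q m)"
  unfolding weyl_raised1_def[abs_def] by (intro smooth_intros smooth_weyl smooth_metric_inv)

lemma smooth_weyl_raised: "smooth_on S (weyl_raised p k q m)"
  unfolding weyl_raised_def[abs_def] by (intro smooth_intros smooth_weyl_raised1 smooth_metric_inv)

lemma smooth_weyl_square: "smooth_on S (weyl_square j l p q)"
  unfolding weyl_square_def[abs_def] by (intro smooth_intros smooth_weyl smooth_weyl_raised)

context
  fixes y :: "real^'n" and a :: real and i :: 'n
  assumes y: "y \<in> S" and rec: "\<And>j k l m. nabla_weyl G i j k l m y = a * weyl G j k l m y"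
begin

lemma partial_deriv_weyl_raised1:
  "partial_deriv i (weyl_raised1 p k q u) y = a * weyl_raised1 p k q u y
    + (\<Sum>e\<in>UNIV. christoffel G i p e y * weyl_raised1 e k q u y)
    - (\<Sum>e\<in>UNIV. christoffel G i e k y * weyl_raised1 p e q u y)
    + (\<Sum>e\<in>UNIV. christoffel G i q e y * weyl_raised1 p k e u y)
    + (\<Sum>e\<in>UNIV. christoffel G i u e y * weyl_raised1 p k q e y)"
proof -
  let ?A = "\<lambda>r. a * weyl G p r q u y + (\<Sum>e\<in>UNIV. christoffel G i p e y * weyl G e r q u y)
    + (\<Sum>e\<in>UNIV. christoffel G i q e y * weyl G p r e u y) + (\<Sum>e\<in>UNIV. christoffel G i u e y * weyl G p r q e y)"
  have "partial_deriv i (\<lambda>x. \<Sum>r\<in>UNIV. metric_inv G k r x * weyl G p r q u x) y =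
    (\<Sum>r\<in>UNIV. metric_inv G k r y * ?A r)
    - (\<Sum>e\<in>UNIV. christoffel G i e k y * (\<Sum>r\<in>UNIV. metric_inv G e r y * weyl G p r q u y))"
    by (rule partial_deriv_raise[OF y smooth_weyl]) (simp add: partial_deriv_weyl rec)
  also have "(\<Sum>r\<in>UNIV. metric_inv G k r y * ?A r) = a * weyl_raised1 p k q u y
    + (\<Sum>e\<in>UNIV. christoffel G i p e y * weyl_raised1 e k q u y)
    + (\<Sum>e\<in>UNIV. christoffel G i q e y * weyl_raised1 p k e u y)
    + (\<Sum>e\<in>UNIV. christoffel G i u e y * weyl_raised1 p k q e y)"
    unfolding weyl_raised1_def using sum_mult_combination[where z = 1] by simp
  finally show ?thesis unfolding weyl_raised1_def[abs_def] by simp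
qed

lemma partial_deriv_weyl_raised:
  "partial_deriv i (weyl_raised p k q m) y = a * weyl_raised p k q m y
    + (\<Sum>e\<in>UNIV. christoffel G i p e y * weyl_raised e k q m y)
    - (\<Sum>e\<in>UNIV. christoffel G i e k y * weyl_raised p e q m y)
    + (\<Sum>e\<in>UNIV. christoffel G i q e y * weyl_raised p k e m y)
    - (\<Sum>e\<in>UNIV. christoffel G i e m y * weyl_raised p k q e y)"
proof -
  let ?A = "\<lambda>u. a * weyl_raised1 p k q u y + (\<Sum>e\<in>UNIV. christoffel G i p e y * weyl_raised1 e k q u y)
    - (\<Sum>e\<in>UNIV. christoffel G i e k y * weyl_raised1 p e q u y)
    + (\<Sum>e\<in>UNIV. christoffel G i q e y * weyl_raised1 p k e u y)"
  have "partial_deriv i (\<lambda>x. \<Sum>u\<in>UNIV. metric_inv G m u x * weyl_raised1 p k q u x) y =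
    (\<Sum>u\<in>UNIV. metric_inv G m u y * ?A u)
    - (\<Sum>e\<in>UNIV. christoffel G i e m y * (\<Sum>u\<in>UNIV. metric_inv G e u y * weyl_raised1 p k q u y))"
    by (rule partial_deriv_raise[OF y smooth_weyl_raised1]) (simp add: partial_deriv_weyl_raised1)
  also have "(\<Sum>u\<in>UNIV. metric_inv G m u y * ?A u) = a * weyl_raised p k q m y
    + (\<Sum>e\<in>UNIV. christoffel G i p e y * weyl_raised e k q m y)
    - (\<Sum>e\<in>UNIV. christoffel G i e k y * weyl_raised p e q m y)
    + (\<Sum>e\<in>UNIV. christoffel G i q e y * weyl_raised p k e m y)"
    unfolding weyl_raised_def using sum_mult_combination[where z = "- 1"] by simp
  finally show ?thesis unfolding weyl_raised_def[abs_def] by simp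
qed

text \<open>Both factors are recurrent, which doubles \<open>a\<close>. The Christoffel terms of the
  contracted indices cancel, because each of these indices occurs once lowered and once
  raised.\<close>

lemma partial_deriv_weyl_square:
  "partial_deriv i (weyl_square j l p q) y = 2 * a * weyl_square j l p q y
    + (\<Sum>e\<in>UNIV. christoffel G i j e y * weyl_square e l p q y)
    + (\<Sum>e\<in>UNIV. christoffel G i l e y * weyl_square j e p q y)
    + (\<Sum>e\<in>UNIV. christoffel G i p e y * weyl_square j l e q y)
    + (\<Sum>e\<in>UNIV. christoffel G i q e y * weyl_square j l p e y)"
proof -
  let ?\<Gamma> = "\<lambda>p q. christoffel G i p q y" and ?W = "\<lambda>j k l m. weyl G j k l m y"
  let ?Y = "\<lambda>p k q m. weyl_raised p k q m y"
  have "partial_deriv i (weyl_square j l p q) y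
      = (\<Sum>k\<in>UNIV. \<Sum>m\<in>UNIV. ?W j k l m * partial_deriv i (weyl_raised p k q m) y
          + partial_deriv i (weyl G j k l m) y * ?Y p k q m)"
  proof -
    have "partial_deriv i (weyl_square j l p q) y
        = (\<Sum>k\<in>UNIV. partial_deriv i (\<lambda>x. \<Sum>m\<in>UNIV. weyl G j k l m x * weyl_raised p k q m x) y)"
      unfolding weyl_square_def[abs_def]
      by (intro partial_deriv_sum smooth_differentiable smooth_intros smooth_weyl smooth_weyl_raised y)
    also have "\<dots> = (\<Sum>k\<in>UNIV. \<Sum>m\<in>UNIV. partial_deriv i (\<lambda>x. weyl G j k l m x * weyl_raised p k q m x) y)"
      by (intro sum.cong refl partial_deriv_sum smooth_differentiable smooth_intros smooth_weyl smooth_weyl_raised y)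
    finally show ?thesis
      using smooth_differentiable[OF smooth_weyl y] smooth_differentiable[OF smooth_weyl_raised y]
      by (simp add: partial_deriv_mult)
  qed
  also have "\<dots> = (\<Sum>k\<in>UNIV. \<Sum>m\<in>UNIV. 2 * a * (?W j k l m * ?Y p k q m)
      + (\<Sum>e\<in>UNIV. ?\<Gamma> p e * (?W j k l m * ?Y e k q m)) - (\<Sum>e\<in>UNIV. ?\<Gamma> e k * ?W j k l m * ?Y p e q m)
      + (\<Sum>e\<in>UNIV. ?\<Gamma> q e * (?W j k l m * ?Y p k e m)) - (\<Sum>e\<in>UNIV. ?\<Gamma> e m * ?W j k l m * ?Y p k q e)
      + (\<Sum>e\<in>UNIV. ?\<Gamma> j e * (?W e k l m * ?Y p k q m)) + (\<Sum>e\<in>UNIV. ?\<Gamma> k e * ?W j e l m * ?Y p k q m)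
      + (\<Sum>e\<in>UNIV. ?\<Gamma> l e * (?W j k e m * ?Y p k q m)) + (\<Sum>e\<in>UNIV. ?\<Gamma> m e * ?W j k l e * ?Y p k q m))"
    unfolding partial_deriv_weyl_raised partial_deriv_weyl rec
    by (intro sum.cong refl)
      (simp add: distrib_left distrib_right right_diff_distrib sum_distrib_left sum_distrib_right mult_ac)
  also have "\<dots> = 2 * a * weyl_square j l p q y
      + (\<Sum>e\<in>UNIV. ?\<Gamma> p e * weyl_square j l e q y)
      - (\<Sum>k\<in>UNIV. \<Sum>m\<in>UNIV. \<Sum>e\<in>UNIV. ?\<Gamma> e k * ?W j k l m * ?Y p e q m)
      + (\<Sum>e\<in>UNIV. ?\<Gamma> q e * weyl_square j l p e y)
      - (\<Sum>k\<in>UNIV. \<Sum>m\<in>UNIV. \<Sum>e\<in>UNIV. ?\<Gamma> e m * ?W j k l m * ?Y p k q e)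
      + (\<Sum>e\<in>UNIV. ?\<Gamma> j e * weyl_square e l p q y)
      + (\<Sum>k\<in>UNIV. \<Sum>m\<in>UNIV. \<Sum>e\<in>UNIV. ?\<Gamma> k e * ?W j e l m * ?Y p k q m)
      + (\<Sum>e\<in>UNIV. ?\<Gamma> l e * weyl_square j e p q y)
      + (\<Sum>k\<in>UNIV. \<Sum>m\<in>UNIV. \<Sum>e\<in>UNIV. ?\<Gamma> m e * ?W j k l e * ?Y p k q m)"
  proof -
    have s: "(\<Sum>k\<in>UNIV. \<Sum>m\<in>UNIV. \<Sum>e\<in>UNIV. c e * f k m e) = (\<Sum>e\<in>UNIV. c e * (\<Sum>k\<in>UNIV. \<Sum>m\<in>UNIV. f k m e))"
      for c :: "'n \<Rightarrow> real" and f
    proof -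
      have "(\<Sum>k\<in>UNIV. \<Sum>m\<in>UNIV. \<Sum>e\<in>UNIV. c e * f k m e) = (\<Sum>k\<in>UNIV. \<Sum>e\<in>UNIV. \<Sum>m\<in>UNIV. c e * f k m e)"
        by (rule sum.cong[OF refl sum.swap])
      also have "\<dots> = (\<Sum>e\<in>UNIV. \<Sum>k\<in>UNIV. \<Sum>m\<in>UNIV. c e * f k m e)" by (rule sum.swap)
      finally show ?thesis by (simp add: sum_distrib_left)
    qed
    show ?thesis
      by (simp only: sum.distrib sum_subtractf s weyl_square_def sum_distrib_left[symmetric])
  qed
  also have "(\<Sum>k\<in>UNIV. \<Sum>m\<in>UNIV. \<Sum>e\<in>UNIV. ?\<Gamma> k e * ?W j e l m * ?Y p k q m)
      = (\<Sum>k\<in>UNIV. \<Sum>m\<in>UNIV. \<Sum>e\<in>UNIV. ?\<Gamma> e k * ?W j k l m * ?Y p e q m)"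
  proof -
    have "(\<Sum>k\<in>UNIV. \<Sum>m\<in>UNIV. \<Sum>e\<in>UNIV. ?\<Gamma> k e * ?W j e l m * ?Y p k q m)
        = (\<Sum>k\<in>UNIV. \<Sum>e\<in>UNIV. \<Sum>m\<in>UNIV. ?\<Gamma> k e * ?W j e l m * ?Y p k q m)"
      by (rule sum.cong[OF refl sum.swap])
    also have "\<dots> = (\<Sum>e\<in>UNIV. \<Sum>k\<in>UNIV. \<Sum>m\<in>UNIV. ?\<Gamma> k e * ?W j e l m * ?Y p k q m)"
      by (rule sum.swap)
    also have "\<dots> = (\<Sum>e\<in>UNIV. \<Sum>m\<in>UNIV. \<Sum>k\<in>UNIV. ?\<Gamma> k e * ?W j e l m * ?Y p k q m)"
      by (rule sum.cong[OF refl sum.swap])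
    finally show ?thesis .
  qed
  also have "(\<Sum>k\<in>UNIV. \<Sum>m\<in>UNIV. \<Sum>e\<in>UNIV. ?\<Gamma> m e * ?W j k l e * ?Y p k q m)
      = (\<Sum>k\<in>UNIV. \<Sum>m\<in>UNIV. \<Sum>e\<in>UNIV. ?\<Gamma> e m * ?W j k l m * ?Y p k q e)"
    by (rule sum.cong[OF refl sum.swap])
  finally show ?thesis by simp
qed

end

end

section \<open>The Ricci identity for a parallel covector\<close>

context metric_on
begin

text \<open>Parallelism expresses the first derivatives of \<open>u\<close> by Christoffel symbols;
  differentiating once more, the symmetry of second derivatives becomes the claim.\<close>

lemma ricci_identity_parallel:
  assumes y: "y \<in> S" and u: "\<And>k. smooth_on S (u k)"
    and par: "\<And>x j k. x \<in> S \<Longrightarrow> nabla_covector G u j k x = 0"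
  shows "(\<Sum>m\<in>UNIV. riemann G j k l m y * u m y) = 0"
proof -
  let ?\<Gamma> = "\<lambda>i j m. christoffel G i j m y"
  have d: "partial_deriv j (u k) x = (\<Sum>p\<in>UNIV. christoffel G j k p x * u p x)" if "x \<in> S" for j k x
    using par[OF that] by (simp add: nabla_covector_def)
  have dd: "partial_deriv k (partial_deriv j (u l)) y = (\<Sum>p\<in>UNIV. partial_deriv k (christoffel G j l p) y * u p y)
      + (\<Sum>q\<in>UNIV. (\<Sum>p\<in>UNIV. ?\<Gamma> j l p * ?\<Gamma> k p q) * u q y)" for j k
  proof -
    have "partial_deriv k (partial_deriv j (u l)) y = partial_deriv k (\<lambda>x. \<Sum>p\<in>UNIV. christoffel G j l p x * u p x) y"
      by (rule partial_deriv_cong[OF open_S y d])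
    also have "\<dots> = (\<Sum>p\<in>UNIV. partial_deriv k (\<lambda>x. christoffel G j l p x * u p x) y)"
      by (intro partial_deriv_sum smooth_differentiable smooth_intros smooth_christoffel u y)
    also have "\<dots> = (\<Sum>p\<in>UNIV. partial_deriv k (christoffel G j l p) y * u p y)
        + (\<Sum>p\<in>UNIV. \<Sum>q\<in>UNIV. ?\<Gamma> j l p * ?\<Gamma> k p q * u q y)"
      using smooth_differentiable[OF smooth_christoffel y] smooth_differentiable[OF u y]
      by (simp add: partial_deriv_mult d[OF y] sum.distrib sum_distrib_left mult.assoc)
    also have "(\<Sum>p\<in>UNIV. \<Sum>q\<in>UNIV. ?\<Gamma> j l p * ?\<Gamma> k p q * u q y)
        = (\<Sum>q\<in>UNIV. (\<Sum>p\<in>UNIV. ?\<Gamma> j l p * ?\<Gamma> k p q) * u q y)"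
      by (subst sum.swap) (simp add: sum_distrib_right)
    finally show ?thesis .
  qed
  show ?thesis
    using dd[of k j] dd[of j k] partial_deriv_commute[OF u open_S y, of k j l]
    by (simp add: riemann_def distrib_right left_diff_distrib sum.distrib sum_subtractf)
qed

end

section \<open>Consequences of type N for the curvature\<close>

context recurrent_chart
begin

abbreviation ds :: "'n \<Rightarrow> real^'n \<Rightarrow> real" where
  "ds i y \<equiv> partial_deriv i s y"

lemma form2_grad_axis: "y \<in> S \<Longrightarrow> form2 (G y) (grad y) (axis i 1) = ds i y"
  using sum_axis[of i "\<lambda>i. ds i y"] by (simp add: form2_grad mult.commute)

text \<open>The 4 is 2 + 2: \<open>residual\<close> is dual to \<alpha> - 2 ds and equals twice the
  gradient.\<close>

lemma recurrence_covector_eq: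
  assumes y: "y \<in> S"
  shows "\<alpha> y $ i = 4 * ds i y"
proof -
  interpret R: recurrent_curvature_form "W y" "form2 (G y)" "grad y" "residual y" "real CARD('n)"
    by (rule recurrent_curvature_form_W[OF y])
  have "form2 (G y) (residual y) (axis i 1) = 2 * ds i y"
    by (simp add: R.recurrence_covector form2_linear form2_grad_axis[OF y])
  then show ?thesis
    using sum_axis[of i "\<lambda>i. \<alpha> y $ i - 2 * ds i y"] by (simp add: form2_residual[OF y] mult.commute)
qed

lemma ds_null:
  assumes y: "y \<in> S"
  shows "(\<Sum>p\<in>UNIV. ds p y * ds_up p y) = 0"
proof -
  interpret R: recurrent_curvature_form "W y" "form2 (G y)" "grad y" "residual y" "real CARD('n)"
    by (rule recurrent_curvature_form_W[OF y])
  show ?thesis using R.null form2_grad[OF y, of "grad y"] by (simp add: grad_def)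
qed

lemma weyl_ds_up:
  assumes y: "y \<in> S"
  shows "(\<Sum>p\<in>UNIV. ds_up p y * weyl G p k l m y) = 0"
proof -
  interpret R: recurrent_curvature_form "W y" "form2 (G y)" "grad y" "residual y" "real CARD('n)"
    by (rule recurrent_curvature_form_W[OF y])
  show ?thesis
    using R.D_zero[of "axis k 1" "axis l 1" "axis m 1"] by (simp add: W_def form4_def sum_axis grad_def)
qed

lemma weyl_ds_up2: "y \<in> S \<Longrightarrow> (\<Sum>p\<in>UNIV. ds_up p y * weyl G j p l m y) = 0"
  using weyl_ds_up[of y j l m] weyl_anti12[of y j _ l m] by (simp add: sum_negf)

lemma weyl_ds_up4: "y \<in> S \<Longrightarrow> (\<Sum>p\<in>UNIV. ds_up p y * weyl G j k l p y) = 0"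
  using weyl_ds_up2[of y l j k] weyl_pair[of y j k l] by simp

lemma ds_nonzero: "y \<in> S \<Longrightarrow> \<exists>i. ds i y \<noteq> 0"
  using \<alpha>_nonzero[of y] recurrence_covector_eq[of y] by (force simp: vec_eq_iff)

text \<open>\<open>T\<close> is the Weyl tensor with the transversal vector \<open>N\<close> in its
  first and third slots; \<open>type_N\<close>, used for both index pairs, recovers the whole tensor
  from it.\<close>

lemma type_N_components:
  assumes y: "y \<in> S"
  obtains N T where "(\<Sum>i\<in>UNIV. ds i y * N $ i) = 1"
    "\<And>k m. T k m = T m k" "\<And>k. (\<Sum>m\<in>UNIV. T k m * ds_up m y) = 0" "\<And>k. (\<Sum>m\<in>UNIV. T k m * N $ m) = 0"
    "\<And>j k l m. weyl G j k l m y =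
      ds j y * (ds l y * T k m - ds m y * T k l) - ds k y * (ds l y * T j m - ds m y * T j l)"
proof -
  interpret R: recurrent_curvature_form "W y" "form2 (G y)" "grad y" "residual y" "real CARD('n)"
    by (rule recurrent_curvature_form_W[OF y])
  obtain N where N: "form2 (G y) (grad y) N = 1" by (rule R.transversal_exists)
  let ?e = "\<lambda>k. axis k (1::real)"
  define T where "T k m = W y N (?e k) N (?e m)" for k m
  have ev: "W y (?e j) (?e k) (?e l) (?e m) = weyl G j k l m y" for j k l m
    by (simp add: W_def form4_def sum_axis)
  have lin: "linear (\<lambda>x. W y N (?e k) N x)" for k by (simp add: linear_iff W_def form4_linear)
  have T: "(\<Sum>m\<in>UNIV. T k m * x $ m) = W y N (?e k) N x" for k x
    using linear_eq_sum_axis[OF lin, of k x] by (simp add: T_def mult.commute)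
  have t: "(\<Sum>m\<in>UNIV. T k m * ds_up m y) = 0" for k
    using T[of k "grad y"] R.C_pair[of N "?e k" N "grad y"] R.C_anti12[of N "grad y"] R.D_zero
    by (simp add: grad_def)
  have n: "(\<Sum>m\<in>UNIV. T k m * N $ m) = 0" for k using T[of k N] R.C_same34 by simp
  have sym: "T k m = T m k" for k m unfolding T_def by (rule R.C_pair)
  have "W y N (?e k) (?e l) (?e m) = ds l y * T k m - ds m y * T k l" for k l m
  proof -
    have "W y N (?e k) (?e l) (?e m) = W y (?e l) (?e m) N (?e k)" by (rule R.C_pair)
    also have "\<dots> = ds l y * W y N (?e m) N (?e k) - ds m y * W y N (?e l) N (?e k)"
      unfolding R.type_N[OF N, of "?e l" "?e m"] by (simp add: form2_grad_axis[OF y])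
    finally show ?thesis using sym[of k m] sym[of k l] by (simp add: T_def)
  qed
  then have "weyl G j k l m y =
      ds j y * (ds l y * T k m - ds m y * T k l) - ds k y * (ds l y * T j m - ds m y * T j l)" for j k l m
    using R.type_N[OF N, of "?e j" "?e k" "?e l" "?e m"] by (simp add: form2_grad_axis[OF y] ev)
  moreover have "(\<Sum>i\<in>UNIV. ds i y * N $ i) = 1" using N form2_grad[OF y, of N] by simp
  ultimately show thesis using that[of N T] sym t n by blast
qed

text \<open>By the Ricci identity the gradient annihilates the Riemann tensor in every slot, hence
  also the Ricci tensor. Since it annihilates the Weyl tensor too, \<open>weyl_eq\<close> becomes a
  condition on the Ricci part alone.\<close>

lemma riemann_product_zero:
  assumes y: "y \<in> S" and u: "\<And>k. smooth_on S (u k)"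
    and par: "\<And>x j k. x \<in> S \<Longrightarrow> nabla_covector G u j k x = 0"
    and uc: "\<And>k. u k y = c * ds k y" "c \<noteq> 0"
  shows "(\<Sum>p\<in>UNIV. \<Sum>q\<in>UNIV. riemann_up2 G j k p q y * riemann_down G p q l m y) = 0"
proof -
  let ?R = "\<lambda>j k l m. riemann_down G j k l m y" and ?t = "\<lambda>p. ds_up p y" and ?s = "\<lambda>i. ds i y"
  let ?g = "\<lambda>i j. G y $ i $ j" and ?h = "\<lambda>i j. metric_inv G i j y"
  have R0: "(\<Sum>p\<in>UNIV. riemann G j k l p y * ?s p) = 0" for j k l
  proof -
    have "c * (\<Sum>p\<in>UNIV. riemann G j k l p y * ?s p) = 0"
      using ricci_identity_parallel[OF y u par, of j k l] by (simp add: uc sum_distrib_left mult_ac)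
    then show ?thesis using uc(2) by simp
  qed
  have R4: "(\<Sum>m\<in>UNIV. ?t m * ?R j k l m) = 0" for j k l
  proof -
    have "(\<Sum>m\<in>UNIV. ?t m * ?R j k l m) = (\<Sum>m\<in>UNIV. \<Sum>p\<in>UNIV. riemann G j k l p y * (?g p m * ?t m))"
      by (simp add: riemann_down_def sum_distrib_left mult_ac)
    also have "\<dots> = (\<Sum>p\<in>UNIV. riemann G j k l p y * (\<Sum>m\<in>UNIV. ?g p m * ?t m))"
      by (subst sum.swap) (simp add: sum_distrib_left)
    finally show ?thesis using R0 by (simp add: ds_lower[OF y])
  qed
  have R3: "(\<Sum>l\<in>UNIV. ?t l * ?R j k l m) = 0" for j k m
    using R4[of j k m] riemann_down_anti34[OF y, of j k _ m] by (simp add: sum_negf)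
  have R1: "(\<Sum>p\<in>UNIV. ?t p * ?R p q l m) = 0" for q l m
    using R3[of l m q] riemann_down_pair[OF y, of _ q l m] by simp
  have R2: "(\<Sum>q\<in>UNIV. ?t q * ?R p q l m) = 0" for p l m
    using R4[of l m p] riemann_down_pair[OF y, of p _ l m] by simp
  have Rc: "(\<Sum>l\<in>UNIV. ?t l * ricci G k l y) = 0" for k
  proof -
    have "(\<Sum>l\<in>UNIV. ?t l * ricci G k l y) = - (\<Sum>l\<in>UNIV. \<Sum>p\<in>UNIV. \<Sum>m\<in>UNIV. ?h m p * (?t l * ?R p k l m))"
      by (simp add: ricci_eq[OF y] sum_distrib_left sum_negf mult_ac)
    also have "(\<Sum>l\<in>UNIV. \<Sum>p\<in>UNIV. \<Sum>m\<in>UNIV. ?h m p * (?t l * ?R p k l m))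
        = (\<Sum>p\<in>UNIV. \<Sum>l\<in>UNIV. \<Sum>m\<in>UNIV. ?h m p * (?t l * ?R p k l m))"
      by (rule sum.swap)
    also have "\<dots> = (\<Sum>p\<in>UNIV. \<Sum>m\<in>UNIV. \<Sum>l\<in>UNIV. ?h m p * (?t l * ?R p k l m))"
      by (rule sum.cong[OF refl sum.swap])
    also have "\<dots> = 0" by (simp add: sum_distrib_left[symmetric] R3)
    finally show ?thesis by simp
  qed
  obtain N T where N: "(\<Sum>i\<in>UNIV. ?s i * N $ i) = 1" and "\<And>k m. T k m = T m k"
    and "\<And>k. (\<Sum>m\<in>UNIV. T k m * ?t m) = 0" and "\<And>k. (\<Sum>m\<in>UNIV. T k m * N $ m) = 0"
    and WT: "\<And>j k l m. weyl G j k l m y =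
      ?s j * (?s l * T k m - ?s m * T k l) - ?s k * (?s l * T j m - ?s m * T j l)"
    by (rule type_N_components[OF y], rule that; assumption)
  \<comment> \<open>This combination is all that survives when \<open>weyl_eq\<close> is contracted
    with the gradient.\<close>
  define X where "X k l = ricci_coeff * ricci G k l y - scalar_coeff y * ?g k l" for k l
  have gt: "(\<Sum>m\<in>UNIV. ?t m * ?g j m) = ?s j" for j
    using ds_lower[OF y, of j] by (simp add: mult.commute)
  have XX: "?s j * X k l = ?s k * X j l" for j k l
  proof -
    have "0 = (\<Sum>m\<in>UNIV. ?t m * weyl G j k l m y)" using weyl_ds_up4[OF y] by simp
    also have "\<dots> = (\<Sum>m\<in>UNIV. ?t m * ?R j k l m + ricci_coeff * ricci G k l y * (?t m * ?g j m)
        - ricci_coeff * ricci G j l y * (?t m * ?g k m)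
        + ricci_coeff * ?g k l * (?t m * ricci G j m y) - ricci_coeff * ?g j l * (?t m * ricci G k m y)
        - scalar_coeff y * ?g k l * (?t m * ?g j m) + scalar_coeff y * ?g j l * (?t m * ?g k m))"
      unfolding weyl_eq[OF y] by (rule sum.cong) (simp_all add: algebra_simps)
    also have "\<dots> = ricci_coeff * ricci G k l y * ?s j - ricci_coeff * ricci G j l y * ?s k
        - scalar_coeff y * ?g k l * ?s j + scalar_coeff y * ?g j l * ?s k"
      by (simp add: sum.distrib sum_subtractf sum_distrib_left[symmetric] R4 Rc gt)
    finally show ?thesis by (simp add: X_def algebra_simps)
  qed
  have X_sym: "X k l = X l k" for k l
    using ricci_sym[OF y, of k l] G_sym[OF y, of k l] by (simp add: X_def)
  \<comment> \<open>Contracting \<open>XX\<close> with \<open>N\<close> factors \<open>X\<close>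
    into ds and \<xi>; the symmetry of \<open>X\<close> then makes \<xi> a multiple of ds as
    well.\<close>
  define \<xi> where "\<xi> l = (\<Sum>j\<in>UNIV. X j l * N $ j)" for l
  have X1: "X k l = ?s k * \<xi> l" for k l
  proof -
    have "X k l = (\<Sum>j\<in>UNIV. ?s j * N $ j) * X k l" by (simp add: N)
    also have "\<dots> = (\<Sum>j\<in>UNIV. ?s j * X k l * N $ j)" by (simp add: sum_distrib_left sum_distrib_right mult_ac)
    also have "\<dots> = ?s k * \<xi> l" unfolding XX[of _ k l] by (simp add: \<xi>_def sum_distrib_left mult_ac)
    finally show ?thesis .
  qed
  define \<kappa> where "\<kappa> = (\<Sum>j\<in>UNIV. \<xi> j * N $ j)"
  have "\<xi> l = \<kappa> * ?s l" for l
  proof -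
    have "X j l = ?s l * \<xi> j" for j using X_sym[of j l] X1[of l j] by simp
    then have "\<xi> l = (\<Sum>j\<in>UNIV. ?s l * \<xi> j * N $ j)" unfolding \<xi>_def[of l] by simp
    then show ?thesis by (simp add: \<kappa>_def sum_distrib_left sum_distrib_right mult_ac)
  qed
  then have X: "X k l = \<kappa> * ?s k * ?s l" for k l using X1 by simp
  \<comment> \<open>Contract \<open>X\<close> with the gradient in two ways: the rank-one form gives
    0 as the gradient is null, the definition gives \<open>- scalar_coeff y\<close> times ds as the
    Ricci tensor annihilates it.\<close>
  have b: "scalar_coeff y = 0"
  proof -
    have "(\<Sum>l\<in>UNIV. ?t l * X k l) = - scalar_coeff y * ?s k" for k
    proof -
      have "(\<Sum>l\<in>UNIV. ?t l * X k l) = (\<Sum>l\<in>UNIV. ricci_coeff * (?t l * ricci G k l y)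
          - scalar_coeff y * (?t l * ?g k l))"
        by (rule sum.cong) (simp_all add: X_def algebra_simps)
      then show ?thesis by (simp add: sum_subtractf sum_distrib_left[symmetric] Rc gt)
    qed
    moreover have "(\<Sum>l\<in>UNIV. ?t l * X k l) = \<kappa> * ?s k * (\<Sum>l\<in>UNIV. ?s l * ?t l)" for k
      by (simp add: X sum_distrib_left mult_ac)
    ultimately have "scalar_coeff y * ?s k = 0" for k using ds_null[OF y] by simp
    then show ?thesis using ds_nonzero[OF y] by force
  qed
  have ric: "ricci_coeff * ricci G k l y = \<kappa> * ?s k * ?s l" for k l using X[of k l] b by (simp add: X_def)
  \<comment> \<open>\<open>B\<close> absorbs both the Weyl and the Ricci contribution, so that the
    Riemann tensor becomes an antisymmetrised product of ds and \<open>B\<close>.\<close>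
  define B where "B j k m = ?s j * (T k m + \<kappa> * ?g k m) - ?s k * (T j m + \<kappa> * ?g j m)" for j k m
  have RB: "?R j k l m = ?s l * B j k m - ?s m * B j k l" for j k l m
  proof -
    have "?R j k l m = weyl G j k l m y - (?g j m * (ricci_coeff * ricci G k l y) - ?g k m * (ricci_coeff * ricci G j l y)
        + ?g k l * (ricci_coeff * ricci G j m y) - ?g j l * (ricci_coeff * ricci G k m y))"
      using weyl_eq[OF y, of j k l m] b by (simp add: algebra_simps)
    then show ?thesis unfolding ric WT B_def by (simp add: algebra_simps)
  qed
  define B' where "B' p = (\<Sum>m\<in>UNIV. B j k m * ?h m p)" for p
  have up: "riemann_up2 G j k p q y = ?t p * B' q - ?t q * B' p" for p q
  proof -
    have st: "(\<Sum>m\<in>UNIV. ?s m * ?h m q) = ?t q" for q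
      by (simp add: ds_up_def inv_sym[OF y, of q] mult.commute)
    have r: "riemann G j k r q y = ?s r * B' q - B j k r * ?t q" for r
    proof -
      have "riemann G j k r q y = (\<Sum>m\<in>UNIV. ?s r * (B j k m * ?h m q) - B j k r * (?s m * ?h m q))"
        unfolding riemann_up[OF y] RB by (rule sum.cong) (simp_all add: algebra_simps)
      then show ?thesis by (simp add: sum_subtractf sum_distrib_left[symmetric] st B'_def)
    qed
    have "riemann_up2 G j k p q y = (\<Sum>r\<in>UNIV. B' q * (?h p r * ?s r) - ?t q * (B j k r * ?h r p))"
      unfolding riemann_up2_def r by (rule sum.cong) (simp_all add: algebra_simps inv_sym[OF y, of p])
    then show ?thesis by (simp add: sum_subtractf sum_distrib_left[symmetric] B'_def ds_up_def[of p])
  qed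
  \<comment> \<open>In either term one summation index is a contraction of the gradient with the
    Riemann tensor.\<close>
  have "(\<Sum>p\<in>UNIV. \<Sum>q\<in>UNIV. riemann_up2 G j k p q y * ?R p q l m)
      = (\<Sum>p\<in>UNIV. \<Sum>q\<in>UNIV. B' q * (?t p * ?R p q l m)) - (\<Sum>p\<in>UNIV. \<Sum>q\<in>UNIV. B' p * (?t q * ?R p q l m))"
    unfolding up left_diff_distrib sum_subtractf by (simp add: mult_ac)
  also have "(\<Sum>p\<in>UNIV. \<Sum>q\<in>UNIV. B' q * (?t p * ?R p q l m)) = 0"
    by (subst sum.swap) (simp add: sum_distrib_left[symmetric] R1)
  also have "(\<Sum>p\<in>UNIV. \<Sum>q\<in>UNIV. B' p * (?t q * ?R p q l m)) = 0"
    by (simp add: sum_distrib_left[symmetric] R2)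
  finally show ?thesis by simp
qed

end

section \<open>The parallel covector in one chart\<close>

locale lorentzian_recurrent_chart = recurrent_chart S G s \<alpha>
  for S :: "(real^'n::finite) set" and G :: "real^'n \<Rightarrow> real^'n^'n" and s :: "real^'n \<Rightarrow> real"
    and \<alpha> :: "real^'n \<Rightarrow> real^'n" +
  assumes lorentzian: "y \<in> S \<Longrightarrow> lorentzian_form (G y)"
begin

text \<open>With the type N form inserted, every term in which the gradient meets the Weyl tensor,
  or ds meets the raised \<open>T\<close>, vanishes. What remains is the full contraction of
  \<open>T\<close> with itself, positive by \<open>lorentzian_trace_pos\<close>.\<close>

lemma weyl_square_eq:
  assumes y: "y \<in> S"
  obtains \<rho> where "\<rho> > 0" "\<And>j l p q. weyl_square j l p q y = \<rho> * (ds j y * ds l y * ds p y * ds q y)"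
proof -
  let ?t = "\<lambda>p. ds_up p y" and ?s = "\<lambda>i. ds i y" and ?h = "\<lambda>i j. metric_inv G i j y"
  let ?W = "\<lambda>j k l m. weyl G j k l m y"
  obtain N T where N: "(\<Sum>i\<in>UNIV. ?s i * N $ i) = 1" and T_sym: "\<And>k m. T k m = T m k"
    and Tt: "\<And>k. (\<Sum>m\<in>UNIV. T k m * ?t m) = 0" and TN: "\<And>k. (\<Sum>m\<in>UNIV. T k m * N $ m) = 0"
    and WT: "\<And>j k l m. ?W j k l m =
      ?s j * (?s l * T k m - ?s m * T k l) - ?s k * (?s l * T j m - ?s m * T j l)"
    by (rule type_N_components[OF y], rule that; assumption)
  define M where "M = (\<chi> k m. T k m)"
  have "M *v grad y = 0" "M *v N = 0"
    using Tt TN by (simp_all add: M_def matrix_vector_mult_def grad_def vec_eq_iff)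
  moreover have "M \<noteq> 0"
  proof
    assume "M = 0"
    then have "T k m = 0" for k m by (simp add: M_def vec_eq_iff)
    then show False using WT weyl_nonzero[OF y] by simp
  qed
  moreover have "transpose M = M" using T_sym by (simp add: M_def transpose_def vec_eq_iff)
  moreover have "form2 (G y) (grad y) (grad y) = 0"
    using ds_null[OF y] by (simp add: form2_grad[OF y]) (simp add: grad_def)
  moreover have "form2 (G y) (grad y) N \<noteq> 0" using N by (simp add: form2_grad[OF y])
  ultimately have pos: "trace (M ** (matrix_inv (G y) ** (M ** matrix_inv (G y)))) > 0"
    by (intro lorentzian_trace_pos[where t = "grad y" and N = N] lorentzian[OF y])
  \<comment> \<open>\<open>T1\<close> and \<open>T2\<close> are \<open>T\<close> with one and with
    both indices raised, in parallel to \<open>weyl_raised1\<close> and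
    \<open>weyl_raised\<close>.\<close>
  define T1 where "T1 k u = (\<Sum>r\<in>UNIV. ?h k r * T r u)" for k u
  define T2 where "T2 k m = (\<Sum>u\<in>UNIV. ?h m u * T1 k u)" for k m
  define \<rho> where "\<rho> = (\<Sum>k\<in>UNIV. \<Sum>m\<in>UNIV. T k m * T2 k m)"
  have "trace (M ** (matrix_inv (G y) ** (M ** matrix_inv (G y)))) = \<rho>"
  proof -
    have "(matrix_inv (G y) ** (M ** matrix_inv (G y))) $ m $ k = T2 k m" for m k
      using T_sym inv_sym[OF y, of _ k]
      by (simp add: matrix_matrix_mult_def T2_def T1_def M_def metric_inv_def[symmetric] mult.commute)
    then show ?thesis unfolding trace_def matrix_matrix_mult_def[of M] by (simp add: \<rho>_def M_def)
  qed
  with pos have \<rho>: "\<rho> > 0" by simp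
  have hs: "(\<Sum>r\<in>UNIV. ?h k r * ?s r) = ?t k" for k by (simp add: ds_up_def)
  have r1: "weyl_raised1 p k q u y = ?s p * (?s q * T1 k u - ?s u * T1 k q) - ?t k * (?s q * T p u - ?s u * T p q)" for p k q u
  proof -
    have "weyl_raised1 p k q u y = (\<Sum>r\<in>UNIV. ?s p * ?s q * (?h k r * T r u) - ?s p * ?s u * (?h k r * T r q)
        - (?s q * T p u - ?s u * T p q) * (?h k r * ?s r))"
      unfolding weyl_raised1_def WT by (rule sum.cong) (simp_all add: algebra_simps)
    then show ?thesis
      unfolding sum_subtractf sum_distrib_left[symmetric] hs T1_def[symmetric] by (simp add: algebra_simps)
  qed
  define T3 where "T3 p m = (\<Sum>u\<in>UNIV. ?h m u * T p u)" for p m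
  have r2: "weyl_raised p k q m y = ?s p * (?s q * T2 k m - ?t m * T1 k q) - ?t k * (?s q * T3 p m - ?t m * T p q)" for p k q m
  proof -
    have "weyl_raised p k q m y = (\<Sum>u\<in>UNIV. ?s p * ?s q * (?h m u * T1 k u) - ?s p * T1 k q * (?h m u * ?s u)
        - ?t k * ?s q * (?h m u * T p u) + ?t k * T p q * (?h m u * ?s u))"
      unfolding weyl_raised_def r1 by (rule sum.cong) (simp_all add: algebra_simps)
    then show ?thesis
      unfolding sum_subtractf sum.distrib sum_distrib_left[symmetric] hs T2_def[symmetric] T3_def[symmetric]
      by (simp add: algebra_simps)
  qed
  have T1s: "(\<Sum>k\<in>UNIV. ?s k * T1 k u) = 0" for u
  proof -
    have "(\<Sum>k\<in>UNIV. ?s k * T1 k u) = (\<Sum>k\<in>UNIV. \<Sum>r\<in>UNIV. T u r * (?h r k * ?s k))"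
      using T_sym[of _ u] inv_sym[OF y] by (simp add: T1_def sum_distrib_left mult_ac)
    also have "\<dots> = (\<Sum>r\<in>UNIV. T u r * (\<Sum>k\<in>UNIV. ?h r k * ?s k))"
      by (subst sum.swap) (simp add: sum_distrib_left)
    finally show ?thesis by (simp add: hs Tt)
  qed
  have T2s: "(\<Sum>k\<in>UNIV. ?s k * T2 k m) = 0" for m
  proof -
    have "(\<Sum>k\<in>UNIV. ?s k * T2 k m) = (\<Sum>u\<in>UNIV. ?h m u * (\<Sum>k\<in>UNIV. ?s k * T1 k u))"
      unfolding T2_def sum_distrib_left by (subst sum.swap) (simp add: mult_ac)
    then show ?thesis by (simp add: T1s)
  qed
  have T2_sym: "T2 k m = T2 m k" for k m
  proof -
    have "T2 k m = (\<Sum>u\<in>UNIV. \<Sum>r\<in>UNIV. ?h m u * (?h k r * T r u))" by (simp add: T2_def T1_def sum_distrib_left)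
    also have "\<dots> = (\<Sum>r\<in>UNIV. \<Sum>u\<in>UNIV. ?h k r * (?h m u * T u r))"
      using T_sym by (subst sum.swap) (simp add: mult_ac)
    finally show ?thesis by (simp add: T2_def T1_def sum_distrib_left)
  qed
  have "weyl_square j l p q y = \<rho> * (?s j * ?s l * ?s p * ?s q)" for j l p q
  proof -
    have "weyl_square j l p q y = (\<Sum>k\<in>UNIV. \<Sum>m\<in>UNIV. ?s p * ?s q * (?W j k l m * T2 k m)
        - ?s p * T1 k q * (?t m * ?W j k l m) - (?s q * T3 p m - ?t m * T p q) * (?t k * ?W j k l m))"
      unfolding weyl_square_def r2 by (intro sum.cong refl) (simp add: algebra_simps)
    also have "\<dots> = ?s p * ?s q * (\<Sum>k\<in>UNIV. \<Sum>m\<in>UNIV. ?W j k l m * T2 k m)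
        - (\<Sum>k\<in>UNIV. \<Sum>m\<in>UNIV. (?s q * T3 p m - ?t m * T p q) * (?t k * ?W j k l m))"
      by (simp add: sum_subtractf sum_distrib_left[symmetric] weyl_ds_up4[OF y])
    also have "(\<Sum>k\<in>UNIV. \<Sum>m\<in>UNIV. (?s q * T3 p m - ?t m * T p q) * (?t k * ?W j k l m)) = 0"
      by (subst sum.swap) (simp add: sum_distrib_left[symmetric] weyl_ds_up2[OF y])
    also have "(\<Sum>k\<in>UNIV. \<Sum>m\<in>UNIV. ?W j k l m * T2 k m) = ?s j * ?s l * \<rho>"
    proof -
      have "(\<Sum>k\<in>UNIV. \<Sum>m\<in>UNIV. ?W j k l m * T2 k m) = (\<Sum>k\<in>UNIV. \<Sum>m\<in>UNIV. ?s j * ?s l * (T k m * T2 k m)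
          - ?s j * T k l * (?s m * T2 m k) - (?s l * T j m - ?s m * T j l) * (?s k * T2 k m))"
        unfolding WT by (intro sum.cong refl) (simp add: algebra_simps T2_sym)
      also have "\<dots> = ?s j * ?s l * \<rho> - (\<Sum>k\<in>UNIV. \<Sum>m\<in>UNIV. (?s l * T j m - ?s m * T j l) * (?s k * T2 k m))"
        by (simp add: sum_subtractf sum_distrib_left[symmetric] T2s \<rho>_def)
      also have "(\<Sum>k\<in>UNIV. \<Sum>m\<in>UNIV. (?s l * T j m - ?s m * T j l) * (?s k * T2 k m)) = 0"
        by (subst sum.swap) (simp add: sum_distrib_left[symmetric] T2s)
      finally show ?thesis by simp
    qed
    finally show ?thesis by (simp add: mult_ac)
  qed
  then show thesis using that \<rho> by blast
qed

text \<open>By \<open>weyl_square_eq\<close> this is \<open>(e\<^bsup>-8s\<^esup> \<rho>)\<^bsup>1/4\<^esup> ds\<close> up to sign, wherever the \<open>a\<close>-th component of \<open>ds\<close> is non-zero.\<close>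

definition parallel_covector :: "'n \<Rightarrow> 'n \<Rightarrow> real^'n \<Rightarrow> real" where
  "parallel_covector a j y = exp (- (2 * s y)) * (weyl_square j a a a y * weyl_square a a a a y powr (- (3/4)))"

context
  fixes a :: 'n
  assumes a: "\<And>y. y \<in> S \<Longrightarrow> ds a y \<noteq> 0"
begin

lemma weyl_square_pos: "y \<in> S \<Longrightarrow> weyl_square a a a a y > 0"
proof -
  assume y: "y \<in> S"
  obtain \<rho> where \<rho>: "\<rho> > 0" "\<And>j l p q. weyl_square j l p q y = \<rho> * (ds j y * ds l y * ds p y * ds q y)"
    using weyl_square_eq[OF y] by blast
  have "ds a y * ds a y > 0" using a[OF y] by (auto simp: zero_less_mult_iff linorder_neq_iff)
  then have "(ds a y * ds a y) * (ds a y * ds a y) > 0" by simp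
  then show ?thesis using \<rho> by (simp add: mult.assoc)
qed

lemma smooth_parallel_covector: "smooth_on S (parallel_covector a j)"
  unfolding parallel_covector_def[abs_def]
  by (intro smooth_intros smooth_on_exp[OF open_S] smooth_on_powr[OF open_S] smooth_weyl_square
      smooth_s weyl_square_pos)

lemma parallel_covector_eq:
  assumes y: "y \<in> S"
  shows "\<exists>c. c \<noteq> 0 \<and> (\<forall>j. parallel_covector a j y = c * ds j y)"
proof -
  obtain \<rho> where \<rho>: "\<rho> > 0" "\<And>j l p q. weyl_square j l p q y = \<rho> * (ds j y * ds l y * ds p y * ds q y)"
    using weyl_square_eq[OF y] by blast
  let ?c = "exp (- (2 * s y)) * \<rho> * (ds a y * ds a y * ds a y) * weyl_square a a a a y powr (- (3/4))"
  have "?c \<noteq> 0" using \<rho> a[OF y] weyl_square_pos[OF y] by simp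
  moreover have "parallel_covector a j y = ?c * ds j y" for j
    by (simp add: parallel_covector_def \<rho>(2)[of j])
  ultimately show ?thesis by blast
qed

text \<open>The number \<rho> belongs to the point \<open>y\<close> alone; it only simplifies
  values, while all derivatives are taken of components of \<open>weyl_square\<close>.\<close>

lemma nabla_parallel_covector:
  assumes y: "y \<in> S"
  shows "nabla_covector G (parallel_covector a) i j y = 0"
proof -
  obtain \<rho> where \<rho>: "\<rho> > 0" "\<And>j l p q. weyl_square j l p q y = \<rho> * (ds j y * ds l y * ds p y * ds q y)"
    using weyl_square_eq[OF y] by blast
  let ?V = "weyl_square" and ?\<Gamma> = "\<lambda>p q. christoffel G i p q y" and ?s = "\<lambda>i. ds i y"
  define w where "w = ?V a a a a y"
  have w: "w > 0" using weyl_square_pos[OF y] by (simp add: w_def)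
  define \<gamma> where "\<gamma> = (\<Sum>e\<in>UNIV. ?\<Gamma> a e * ?s e)"
  have rec: "nabla_weyl G i j k l m y = (4 * ?s i) * weyl G j k l m y" for j k l m
    using recurrent[OF y] recurrence_covector_eq[OF y] by simp
  have dV: "partial_deriv i (?V j a a a) y = 8 * ?s i * ?V j a a a y
      + (\<Sum>e\<in>UNIV. ?\<Gamma> j e * ?V e a a a y) + 3 * \<rho> * ?s j * ?s a * ?s a * \<gamma>" for j
  proof -
    have "(\<Sum>e\<in>UNIV. ?\<Gamma> a e * ?V j e a a y) = \<rho> * ?s j * ?s a * ?s a * \<gamma>"
      "(\<Sum>e\<in>UNIV. ?\<Gamma> a e * ?V j a e a y) = \<rho> * ?s j * ?s a * ?s a * \<gamma>"
      "(\<Sum>e\<in>UNIV. ?\<Gamma> a e * ?V j a a e y) = \<rho> * ?s j * ?s a * ?s a * \<gamma>"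
      unfolding \<rho>(2) \<gamma>_def by (simp_all add: sum_distrib_left mult_ac)
    then show ?thesis unfolding partial_deriv_weyl_square[OF y rec] by simp
  qed
  have "(\<Sum>e\<in>UNIV. ?\<Gamma> a e * ?V e a a a y) = \<rho> * ?s a * ?s a * ?s a * \<gamma>"
    unfolding \<rho>(2) \<gamma>_def by (simp add: sum_distrib_left mult_ac)
  then have dw: "partial_deriv i (?V a a a a) y = 8 * ?s i * w + 4 * \<rho> * ?s a * ?s a * ?s a * \<gamma>"
    using dV[of a] by (simp add: w_def)
  let ?e = "exp (- (2 * s y))" and ?p = "w powr (- (3/4))"
  have dif: "s differentiable at y" "?V j l p q differentiable at y" for j l p q
    using smooth_differentiable[OF smooth_s y] smooth_differentiable[OF smooth_weyl_square y] by auto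
  have dif2: "(\<lambda>x. ?V a a a a x powr (- (3/4))) differentiable at y"
    "(\<lambda>x. exp (- (2 * s x))) differentiable at y" "(\<lambda>x. - (2 * s x)) differentiable at y"
    "(\<lambda>x. 2 * s x) differentiable at y"
    "(\<lambda>x. ?V j a a a x * ?V a a a a x powr (- (3/4))) differentiable at y"
    for j
  proof -
    have 1: "smooth_on S (\<lambda>x. 2 * s x)" by (intro smooth_intros smooth_s)
    have 2: "smooth_on S (\<lambda>x. - (2 * s x))" by (intro smooth_intros smooth_s)
    have 3: "smooth_on S (\<lambda>x. exp (- (2 * s x)))" by (rule smooth_on_exp[OF open_S 2])
    have 4: "smooth_on S (\<lambda>x. ?V a a a a x powr (- (3/4)))"
      by (rule smooth_on_powr[OF open_S smooth_weyl_square weyl_square_pos])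
    have 5: "smooth_on S (\<lambda>x. ?V j a a a x * ?V a a a a x powr (- (3/4)))"
      by (rule smooth_on_mult[OF open_S smooth_weyl_square 4])
    show "(\<lambda>x. ?V a a a a x powr (- (3/4))) differentiable at y"
      "(\<lambda>x. exp (- (2 * s x))) differentiable at y" "(\<lambda>x. - (2 * s x)) differentiable at y"
      "(\<lambda>x. 2 * s x) differentiable at y"
      "(\<lambda>x. ?V j a a a x * ?V a a a a x powr (- (3/4))) differentiable at y"
      using 1 2 3 4 5 smooth_differentiable[OF _ y] by blast+
  qed
  have powr: "w powr (- (3/4) - 1) = ?p / w"
    using w powr_diff[of w "- (3/4)" 1] by simp
  \<comment> \<open>The exponents are tuned: the multiples of \<open>?s i\<close> add up to 8 -
    (3/4) 8 - 2 = 0, those of \<gamma> to 3 - (3/4) 4 = 0. Only the Christoffel term of the index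
    \<open>j\<close> remains.\<close>
  have "partial_deriv i (parallel_covector a j) y = ?e * (?V j a a a y * (- (3/4) * (?p / w) * partial_deriv i (?V a a a a) y)
      + partial_deriv i (?V j a a a) y * ?p) + - (2 * ?s i) * ?e * (?V j a a a y * ?p)"
    unfolding parallel_covector_def[abs_def]
    using weyl_square_pos[OF y] powr
    by (simp add: partial_deriv_mult partial_deriv_exp partial_deriv_minus partial_deriv_cmult
        partial_deriv_const partial_deriv_powr dif dif2 w_def)
  also have "\<dots> = ?e * ?p * (\<Sum>e\<in>UNIV. ?\<Gamma> j e * ?V e a a a y)"
  proof -
    have wr: "w = \<rho> * (?s a * ?s a * ?s a * ?s a)" by (simp add: w_def \<rho>(2))
    have q: "?V j a a a y * partial_deriv i (?V a a a a) y / w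
        = 8 * ?s i * ?V j a a a y + 4 * \<rho> * ?s j * ?s a * ?s a * \<gamma>"
    proof -
      have "?V j a a a y * (4 * \<rho> * ?s a * ?s a * ?s a * \<gamma>) = (4 * \<rho> * ?s j * ?s a * ?s a * \<gamma>) * w"
        by (simp add: \<rho>(2) wr)
      then have "?V j a a a y * partial_deriv i (?V a a a a) y
          = (8 * ?s i * ?V j a a a y + 4 * \<rho> * ?s j * ?s a * ?s a * \<gamma>) * w"
        unfolding dw by (simp add: algebra_simps)
      then show ?thesis using w by simp
    qed
    let ?X = "?V j a a a y * (- (3/4) * (?p / w) * partial_deriv i (?V a a a a) y)"
    have "?e * ?X = ?e * ?p * (- (3/4) * (?V j a a a y * partial_deriv i (?V a a a a) y / w))"
      by simp
    then have Z: "?e * ?X = ?e * ?p * (- (3/4) * (8 * ?s i * ?V j a a a y + 4 * \<rho> * ?s j * ?s a * ?s a * \<gamma>))"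
      unfolding q .
    have "?e * (?X + partial_deriv i (?V j a a a) y * ?p) + - (2 * ?s i) * ?e * (?V j a a a y * ?p)
        = ?e * ?X + ?e * (partial_deriv i (?V j a a a) y * ?p) + - (2 * ?s i) * ?e * (?V j a a a y * ?p)"
      by (simp only: distrib_left)
    also have "\<dots> = ?e * ?p * (\<Sum>e\<in>UNIV. ?\<Gamma> j e * ?V e a a a y)"
      unfolding Z unfolding dV by (simp add: algebra_simps)
    finally show ?thesis .
  qed
  also have "\<dots> = (\<Sum>e\<in>UNIV. ?\<Gamma> j e * parallel_covector a e y)"
    by (simp add: parallel_covector_def w_def sum_distrib_left sum_distrib_right mult_ac)
  finally show ?thesis by (simp add: nabla_covector_def)
qed

end

end

subsection \<open>Covariant derivatives under coordinate changes\<close>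

text \<open>Describing \<open>u\<close> by the vector \<open>v\<close> with \<open>u = G v\<close> replaces the Christoffel symbols by their lowered
  form, so that the inverse metrics and the inverse of the Jacobian never enter.\<close>

lemma nabla_covector_transform:
  fixes G K :: "real^'n::finite \<Rightarrow> real^'n^'n" and \<phi> :: "real^'n \<Rightarrow> real^'n" and u u' :: "'n \<Rightarrow> real^'n \<Rightarrow> real"
    and v :: "real^'n"
  defines "J k i \<equiv> partial_deriv i (\<lambda>y. \<phi> y $ k)"
  assumes G: "metric_on S G" and K: "metric_on T K" and sub: "\<phi> ` S \<subseteq> T"
    and \<phi>: "\<And>k. smooth_on S (\<lambda>y. \<phi> y $ k)" and u': "\<And>k. smooth_on T (u' k)"
    and G_eq: "\<And>y i j. y \<in> S \<Longrightarrow> G y $ i $ j = (\<Sum>k\<in>UNIV. \<Sum>l\<in>UNIV. J k i y * J l j y * K (\<phi> y) $ k $ l)"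
    and u_eq: "\<And>y j. y \<in> S \<Longrightarrow> u j y = (\<Sum>k\<in>UNIV. J k j y * u' k (\<phi> y))"
    and y: "y \<in> S" and uv: "\<And>p. u p y = (\<Sum>m\<in>UNIV. G y $ p $ m * v $ m)"
    and uv': "\<And>k. u' k (\<phi> y) = (\<Sum>l\<in>UNIV. K (\<phi> y) $ k $ l * (\<Sum>m\<in>UNIV. J l m y * v $ m))"
  shows "nabla_covector G u i j y =
    (\<Sum>k\<in>UNIV. \<Sum>l\<in>UNIV. J k i y * J l j y * nabla_covector K u' k l (\<phi> y))"
proof -
  interpret G: metric_on S G by (rule G)
  interpret K: metric_on T K by (rule K)
  have \<phi>y: "\<phi> y \<in> T" using y sub by blast
  have sJ: "smooth_on S (J k i)" for k i unfolding J_def by (rule smooth_on_partial_deriv[OF \<phi>])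
  have dJ: "J k i differentiable at y" for k i by (rule G.smooth_differentiable[OF sJ y])
  have comp: "smooth_on S (\<lambda>y. f (\<phi> y))" if "smooth_on T f" for f
    by (rule smooth_on_compose[OF G.open_S K.open_S sub \<phi> that])
  have chain: "partial_deriv p (\<lambda>y. f (\<phi> y)) y = (\<Sum>m\<in>UNIV. partial_deriv m f (\<phi> y) * J m p y)"
    if "smooth_on T f" for f p
    unfolding J_def
    by (rule partial_deriv_compose) (rule K.smooth_differentiable[OF that \<phi>y], rule G.smooth_differentiable[OF \<phi> y])
  define H where "H k i j = partial_deriv i (J k j) y" for k i j
  have H_sym: "H k i j = H k j i" for k i j
    unfolding H_def J_def by (rule partial_deriv_commute[OF \<phi> G.open_S y])
  define j' where "j' k i = J k i y" for k i
  define w where "w n = (\<Sum>m\<in>UNIV. j' n m * v $ m)" for n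
  define Hv where "Hv l i = (\<Sum>m\<in>UNIV. H l i m * v $ m)" for l i
  let ?K = "\<lambda>k l. K (\<phi> y) $ k $ l" and ?dK = "\<lambda>m k l. partial_deriv m (\<lambda>z. K z $ k $ l) (\<phi> y)"
  let ?u' = "\<lambda>k. u' k (\<phi> y)" and ?du' = "\<lambda>m k. partial_deriv m (u' k) (\<phi> y)"
  have K_sym: "?K k l = ?K l k" for k l by (rule K.G_sym[OF \<phi>y])
  have dG: "partial_deriv p (\<lambda>z. G z $ i $ j) y = (\<Sum>k\<in>UNIV. \<Sum>l\<in>UNIV. H k p i * j' l j * ?K k l
      + j' k i * H l p j * ?K k l + j' k i * j' l j * (\<Sum>m\<in>UNIV. ?dK m k l * j' m p))" for p i j
  proof -
    have "partial_deriv p (\<lambda>z. G z $ i $ j) y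
        = partial_deriv p (\<lambda>z. \<Sum>k\<in>UNIV. \<Sum>l\<in>UNIV. J k i z * J l j z * K (\<phi> z) $ k $ l) y"
      by (rule partial_deriv_cong[OF G.open_S y G_eq])
    also have "\<dots> = (\<Sum>k\<in>UNIV. partial_deriv p (\<lambda>z. \<Sum>l\<in>UNIV. J k i z * J l j z * K (\<phi> z) $ k $ l) y)"
      by (intro partial_deriv_sum G.smooth_differentiable G.smooth_intros sJ comp[OF K.smooth_G] y)
    also have "\<dots> = (\<Sum>k\<in>UNIV. \<Sum>l\<in>UNIV. partial_deriv p (\<lambda>z. J k i z * J l j z * K (\<phi> z) $ k $ l) y)"
      by (intro sum.cong refl partial_deriv_sum G.smooth_differentiable G.smooth_intros sJ comp[OF K.smooth_G] y)
    also have "\<dots> = (\<Sum>k\<in>UNIV. \<Sum>l\<in>UNIV. H k p i * j' l j * ?K k l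
      + j' k i * H l p j * ?K k l + j' k i * j' l j * (\<Sum>m\<in>UNIV. ?dK m k l * j' m p))"
    proof (intro sum.cong refl)
      fix k l
      have 1: "(\<lambda>z. J k i z * J l j z) differentiable at y"
        by (intro G.smooth_differentiable G.smooth_intros sJ y)
      have 2: "(\<lambda>z. K (\<phi> z) $ k $ l) differentiable at y"
        by (rule G.smooth_differentiable[OF comp[OF K.smooth_G] y])
      show "partial_deriv p (\<lambda>z. J k i z * J l j z * K (\<phi> z) $ k $ l) y = H k p i * j' l j * ?K k l
          + j' k i * H l p j * ?K k l + j' k i * j' l j * (\<Sum>m\<in>UNIV. ?dK m k l * j' m p)"
        by (simp add: partial_deriv_mult 1 2 dJ chain[OF K.smooth_G] H_def j'_def algebra_simps)
    qed
    finally show ?thesis .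
  qed
  let ?S2 = "\<lambda>f. \<Sum>k\<in>UNIV. \<Sum>l\<in>UNIV. (f k l :: real)"
  have move: "(\<Sum>m\<in>UNIV. ?S2 (f m) * v $ m) = ?S2 (\<lambda>k l. \<Sum>m\<in>UNIV. f m k l * v $ m)" for f :: "'n \<Rightarrow> 'n \<Rightarrow> 'n \<Rightarrow> real"
  proof -
    have "(\<Sum>m\<in>UNIV. ?S2 (f m) * v $ m) = (\<Sum>m\<in>UNIV. \<Sum>k\<in>UNIV. \<Sum>l\<in>UNIV. f m k l * v $ m)"
      by (simp add: sum_distrib_right)
    also have "\<dots> = (\<Sum>k\<in>UNIV. \<Sum>m\<in>UNIV. \<Sum>l\<in>UNIV. f m k l * v $ m)" by (rule sum.swap)
    also have "\<dots> = ?S2 (\<lambda>k l. \<Sum>m\<in>UNIV. f m k l * v $ m)" by (rule sum.cong[OF refl sum.swap])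
    finally show ?thesis .
  qed
  have e1: "(\<Sum>m\<in>UNIV. partial_deriv i (\<lambda>z. G z $ j $ m) y * v $ m)
      = ?S2 (\<lambda>k l. H k i j * w l * ?K k l) + ?S2 (\<lambda>k l. j' k j * Hv l i * ?K k l)
        + ?S2 (\<lambda>k l. j' k j * w l * (\<Sum>m\<in>UNIV. ?dK m k l * j' m i))" for i j
  proof -
    have "(\<Sum>m\<in>UNIV. partial_deriv i (\<lambda>z. G z $ j $ m) y * v $ m) = ?S2 (\<lambda>k l. \<Sum>m\<in>UNIV.
        (H k i j * ?K k l) * (j' l m * v $ m) + (j' k j * ?K k l) * (H l i m * v $ m)
        + (j' k j * (\<Sum>m\<in>UNIV. ?dK m k l * j' m i)) * (j' l m * v $ m))"
      unfolding dG move by (intro sum.cong refl) (simp add: algebra_simps)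
    also have "\<dots> = ?S2 (\<lambda>k l. (H k i j * ?K k l) * w l + (j' k j * ?K k l) * Hv l i
        + (j' k j * (\<Sum>m\<in>UNIV. ?dK m k l * j' m i)) * w l)"
      by (simp only: sum.distrib sum_distrib_left[symmetric] w_def[symmetric] Hv_def[symmetric])
    finally show ?thesis by (simp add: sum.distrib mult_ac)
  qed
  have e2: "(\<Sum>m\<in>UNIV. partial_deriv m (\<lambda>z. G z $ i $ j) y * v $ m)
      = ?S2 (\<lambda>k l. Hv k i * j' l j * ?K k l) + ?S2 (\<lambda>k l. j' k i * Hv l j * ?K k l)
        + ?S2 (\<lambda>k l. j' k i * j' l j * (\<Sum>m\<in>UNIV. ?dK m k l * w m))"
  proof -
    have s: "(\<Sum>p\<in>UNIV. (\<Sum>m\<in>UNIV. ?dK m k l * j' m p) * v $ p) = (\<Sum>m\<in>UNIV. ?dK m k l * w m)" for k l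
    proof -
      have "(\<Sum>p\<in>UNIV. (\<Sum>m\<in>UNIV. ?dK m k l * j' m p) * v $ p)
          = (\<Sum>p\<in>UNIV. \<Sum>m\<in>UNIV. ?dK m k l * (j' m p * v $ p))"
        by (simp add: sum_distrib_right mult.assoc)
      also have "\<dots> = (\<Sum>m\<in>UNIV. \<Sum>p\<in>UNIV. ?dK m k l * (j' m p * v $ p))" by (rule sum.swap)
      finally show ?thesis by (simp add: w_def sum_distrib_left)
    qed
    have "(\<Sum>p\<in>UNIV. partial_deriv p (\<lambda>z. G z $ i $ j) y * v $ p) = ?S2 (\<lambda>k l. \<Sum>p\<in>UNIV.
        (j' l j * ?K k l) * (H k i p * v $ p) + (j' k i * ?K k l) * (H l j p * v $ p)
        + (j' k i * j' l j) * ((\<Sum>m\<in>UNIV. ?dK m k l * j' m p) * v $ p))"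
      unfolding dG move using H_sym[of _ _ i] H_sym[of _ _ j]
      by (intro sum.cong refl) (simp add: algebra_simps)
    also have "\<dots> = ?S2 (\<lambda>k l. (j' l j * ?K k l) * Hv k i + (j' k i * ?K k l) * Hv l j
        + (j' k i * j' l j) * (\<Sum>m\<in>UNIV. ?dK m k l * w m))"
      by (simp only: sum.distrib sum_distrib_left[symmetric] s Hv_def[symmetric])
    finally show ?thesis by (simp add: sum.distrib mult_ac)
  qed
  \<comment> \<open>The symmetry of \<open>K\<close> makes the terms with \<open>Hv\<close> cancel
    in the lowered Christoffel symbols; second derivatives of \<phi> survive only in combination
    with \<open>u'\<close>.\<close>
  have c: "?S2 (\<lambda>k l. j' k j * Hv l i * ?K k l) = ?S2 (\<lambda>k l. Hv k i * j' l j * ?K k l)"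
    by (subst sum.swap) (simp add: K_sym mult_ac)
  have u'w: "?u' k = (\<Sum>l\<in>UNIV. ?K k l * w l)" for k using uv' by (simp add: w_def j'_def)
  have h: "?S2 (\<lambda>k l. H k i j * w l * ?K k l) = (\<Sum>k\<in>UNIV. H k i j * ?u' k)" for i j
    by (simp add: u'w sum_distrib_left mult_ac)
  have r1: "?S2 (\<lambda>k l. j' k j * w l * (\<Sum>m\<in>UNIV. ?dK m k l * j' m i))
      = ?S2 (\<lambda>k l. j' k i * j' l j * (\<Sum>n\<in>UNIV. ?dK k l n * w n))" for i j
  proof -
    have "?S2 (\<lambda>k l. j' k j * w l * (\<Sum>m\<in>UNIV. ?dK m k l * j' m i))
        = (\<Sum>k\<in>UNIV. \<Sum>l\<in>UNIV. \<Sum>m\<in>UNIV. j' m i * j' k j * (?dK m k l * w l))"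
      by (simp add: sum_distrib_left mult_ac)
    also have "\<dots> = (\<Sum>k\<in>UNIV. \<Sum>m\<in>UNIV. \<Sum>l\<in>UNIV. j' m i * j' k j * (?dK m k l * w l))"
      by (rule sum.cong[OF refl sum.swap])
    also have "\<dots> = (\<Sum>m\<in>UNIV. \<Sum>k\<in>UNIV. \<Sum>l\<in>UNIV. j' m i * j' k j * (?dK m k l * w l))"
      by (rule sum.swap)
    finally show ?thesis by (simp add: sum_distrib_left)
  qed
  have r2: "?S2 (\<lambda>k l. j' k j * j' l i * (\<Sum>n\<in>UNIV. ?dK k l n * w n))
      = ?S2 (\<lambda>k l. j' k i * j' l j * (\<Sum>n\<in>UNIV. ?dK l k n * w n))"
    by (subst sum.swap) (simp add: mult_ac)
  have L: "2 * (\<Sum>m\<in>UNIV. G.lower_christoffel i j m y * v $ m) = 2 * (\<Sum>k\<in>UNIV. H k i j * ?u' k)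
      + ?S2 (\<lambda>k l. j' k i * j' l j * (2 * (\<Sum>n\<in>UNIV. K.lower_christoffel k l n (\<phi> y) * w n)))"
  proof -
    have "2 * (\<Sum>m\<in>UNIV. G.lower_christoffel i j m y * v $ m)
        = (\<Sum>m\<in>UNIV. partial_deriv i (\<lambda>z. G z $ j $ m) y * v $ m)
        + (\<Sum>m\<in>UNIV. partial_deriv j (\<lambda>z. G z $ i $ m) y * v $ m)
        - (\<Sum>m\<in>UNIV. partial_deriv m (\<lambda>z. G z $ i $ j) y * v $ m)"
      by (simp add: G.lower_christoffel_def sum_distrib_left sum.distrib[symmetric] sum_subtractf[symmetric] algebra_simps)
    also have "\<dots> = 2 * (\<Sum>k\<in>UNIV. H k i j * ?u' k)
        + (?S2 (\<lambda>k l. j' k i * j' l j * (\<Sum>n\<in>UNIV. ?dK k l n * w n))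
         + ?S2 (\<lambda>k l. j' k i * j' l j * (\<Sum>n\<in>UNIV. ?dK l k n * w n))
         - ?S2 (\<lambda>k l. j' k i * j' l j * (\<Sum>m\<in>UNIV. ?dK m k l * w m)))"
      unfolding e1 e2 c h r1 r2 using H_sym[of _ j i] by simp
    also have "?S2 (\<lambda>k l. j' k i * j' l j * (\<Sum>n\<in>UNIV. ?dK k l n * w n))
         + ?S2 (\<lambda>k l. j' k i * j' l j * (\<Sum>n\<in>UNIV. ?dK l k n * w n))
         - ?S2 (\<lambda>k l. j' k i * j' l j * (\<Sum>m\<in>UNIV. ?dK m k l * w m))
       = ?S2 (\<lambda>k l. j' k i * j' l j * (2 * (\<Sum>n\<in>UNIV. K.lower_christoffel k l n (\<phi> y) * w n)))"
    proof -
      have "2 * (\<Sum>n\<in>UNIV. K.lower_christoffel k l n (\<phi> y) * w n) = (\<Sum>n\<in>UNIV. ?dK k l n * w n)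
          + (\<Sum>n\<in>UNIV. ?dK l k n * w n) - (\<Sum>n\<in>UNIV. ?dK n k l * w n)" for k l
        by (simp add: K.lower_christoffel_def sum_distrib_left sum.distrib[symmetric] sum_subtractf[symmetric] algebra_simps)
      then show ?thesis by (simp add: distrib_left right_diff_distrib sum.distrib sum_subtractf)
    qed
    finally show ?thesis .
  qed
  have GL: "(\<Sum>p\<in>UNIV. christoffel G i j p y * u p y) = (\<Sum>m\<in>UNIV. G.lower_christoffel i j m y * v $ m)"
  proof -
    have "(\<Sum>p\<in>UNIV. christoffel G i j p y * u p y)
        = (\<Sum>p\<in>UNIV. \<Sum>m\<in>UNIV. christoffel G i j p y * G y $ p $ m * v $ m)"
      by (simp add: uv sum_distrib_left mult.assoc)
    also have "\<dots> = (\<Sum>m\<in>UNIV. (\<Sum>p\<in>UNIV. christoffel G i j p y * G y $ p $ m) * v $ m)"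
      by (subst sum.swap) (simp add: sum_distrib_right)
    finally show ?thesis by (simp add: G.christoffel_lower[OF y])
  qed
  have KL: "(\<Sum>p\<in>UNIV. christoffel K k l p (\<phi> y) * ?u' p) = (\<Sum>n\<in>UNIV. K.lower_christoffel k l n (\<phi> y) * w n)" for k l
  proof -
    have "(\<Sum>p\<in>UNIV. christoffel K k l p (\<phi> y) * ?u' p)
        = (\<Sum>p\<in>UNIV. \<Sum>n\<in>UNIV. christoffel K k l p (\<phi> y) * ?K p n * w n)"
      by (simp add: u'w sum_distrib_left mult.assoc)
    also have "\<dots> = (\<Sum>n\<in>UNIV. (\<Sum>p\<in>UNIV. christoffel K k l p (\<phi> y) * ?K p n) * w n)"
      by (subst sum.swap) (simp add: sum_distrib_right)
    finally show ?thesis by (simp add: K.christoffel_lower[OF \<phi>y])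
  qed
  have du: "partial_deriv i (u j) y = (\<Sum>k\<in>UNIV. H k i j * ?u' k) + ?S2 (\<lambda>k l. j' k i * j' l j * ?du' k l)"
  proof -
    have "partial_deriv i (u j) y = partial_deriv i (\<lambda>z. \<Sum>k\<in>UNIV. J k j z * u' k (\<phi> z)) y"
      by (rule partial_deriv_cong[OF G.open_S y u_eq])
    also have "\<dots> = (\<Sum>k\<in>UNIV. partial_deriv i (\<lambda>z. J k j z * u' k (\<phi> z)) y)"
      by (intro partial_deriv_sum G.smooth_differentiable G.smooth_intros sJ comp[OF u'] y)
    also have "\<dots> = (\<Sum>k\<in>UNIV. j' k j * (\<Sum>m\<in>UNIV. ?du' m k * j' m i) + H k i j * ?u' k)"
      by (simp add: partial_deriv_mult dJ G.smooth_differentiable[OF comp[OF u'] y] chain[OF u'] H_def j'_def)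
    also have "\<dots> = (\<Sum>k\<in>UNIV. \<Sum>m\<in>UNIV. j' m i * j' k j * ?du' m k) + (\<Sum>k\<in>UNIV. H k i j * ?u' k)"
      by (simp add: sum.distrib sum_distrib_left mult_ac)
    also have "(\<Sum>k\<in>UNIV. \<Sum>m\<in>UNIV. j' m i * j' k j * ?du' m k) = ?S2 (\<lambda>k l. j' k i * j' l j * ?du' k l)"
      by (rule sum.swap)
    finally show ?thesis by simp
  qed
  have "(\<Sum>m\<in>UNIV. G.lower_christoffel i j m y * v $ m) = (\<Sum>k\<in>UNIV. H k i j * ?u' k)
      + ?S2 (\<lambda>k l. j' k i * j' l j * (\<Sum>n\<in>UNIV. K.lower_christoffel k l n (\<phi> y) * w n))"
  proof -
    have "?S2 (\<lambda>k l. j' k i * j' l j * (2 * (\<Sum>n\<in>UNIV. K.lower_christoffel k l n (\<phi> y) * w n)))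
        = 2 * ?S2 (\<lambda>k l. j' k i * j' l j * (\<Sum>n\<in>UNIV. K.lower_christoffel k l n (\<phi> y) * w n))"
      by (simp only: sum_distrib_left mult.left_commute[of _ 2])
    then show ?thesis using L by simp
  qed
  \<comment> \<open>The inhomogeneous terms, containing the second derivatives \<open>H\<close> of
    \<phi>, are the same in the derivative of \<open>u\<close> and in the Christoffel term, and
    cancel.\<close>
  then have "nabla_covector G u i j y = ?S2 (\<lambda>k l. j' k i * j' l j * ?du' k l)
      - ?S2 (\<lambda>k l. j' k i * j' l j * (\<Sum>n\<in>UNIV. K.lower_christoffel k l n (\<phi> y) * w n))"
    unfolding nabla_covector_def GL du by simp
  also have "\<dots> = ?S2 (\<lambda>k l. j' k i * j' l j * nabla_covector K u' k l (\<phi> y))"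
    unfolding nabla_covector_def KL by (simp add: right_diff_distrib sum_subtractf)
  finally show ?thesis by (simp add: j'_def)
qed

subsection \<open>Restricting charts and atlases\<close>

lemma jacobian_component:
  fixes \<phi> :: "real^'n::finite \<Rightarrow> real^'n"
  assumes "\<And>k. (\<lambda>y. \<phi> y $ k) differentiable at x"
  shows "jacobian \<phi> (at x) $ k $ i = partial_deriv i (\<lambda>y. \<phi> y $ k) x"
  using frechet_derivative_at[OF frechet_derivative_vec_nth[OF assms], symmetric]
  by (simp add: jacobian_def matrix_def partial_deriv_def)

definition restrict_chart :: "('a, 'n::finite) chart \<Rightarrow> 'a set \<Rightarrow> ('a, 'n) chart" where
  "restrict_chart c O' = (chart_dom c \<inter> O', chart_map c)"

lemma transition_apply: "transition c d y = chart_map d (chart_inv c y)"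
  by (simp add: transition_def)

section \<open>Charts, their restrictions and the transition maps\<close>

context smooth_manifold
begin

lemma chart_inj: "c \<in> A \<Longrightarrow> inj_on (chart_map c) (chart_dom c)"
  using charts[of c] homeomorphic_imp_injective_map
  unfolding is_chart_def by (fastforce dest: openin_subset simp: inf.absorb2)

lemma chart_inv_map: "c \<in> A \<Longrightarrow> x \<in> chart_dom c \<Longrightarrow> chart_inv c (chart_map c x) = x"
  using chart_inj by (simp add: chart_inv_def)

lemma chart_map_inv: "y \<in> chart_im c \<Longrightarrow> chart_map c (chart_inv c y) = y"
  by (simp add: chart_inv_def chart_im_def f_inv_into_f)

lemma chart_inv_dom: "y \<in> chart_im c \<Longrightarrow> chart_inv c y \<in> chart_dom c"
  by (simp add: chart_inv_def chart_im_def inv_into_into)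

lemma chart_map_im: "x \<in> chart_dom c \<Longrightarrow> chart_map c x \<in> chart_im c"
  by (simp add: chart_im_def)

lemma open_dom: "c \<in> A \<Longrightarrow> openin X (chart_dom c)"
  using charts is_chart_def by blast

lemma open_im: "c \<in> A \<Longrightarrow> open (chart_im c)"
  using charts is_chart_def by blast

lemma open_image:
  assumes c: "is_chart X c" and U: "openin X U"
  shows "open (chart_map c ` (chart_dom c \<inter> U))"
proof -
  have "openin (subtopology X (chart_dom c)) (chart_dom c \<inter> U)"
    using U by (metis inf_commute openin_subtopology)
  then have "openin (top_of_set (chart_im c)) (chart_map c ` (chart_dom c \<inter> U))"
    using c homeomorphic_map_openness_eq unfolding is_chart_def by blast
  then show ?thesis using c unfolding is_chart_def by (meson openin_open_trans)
qed

lemma open_overlap: "c \<in> A \<Longrightarrow> d \<in> A \<Longrightarrow> open (overlap c d)"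
  unfolding overlap_def by (intro open_image charts open_dom)

lemma open_preimage:
  assumes c: "c \<in> A" and V: "open V"
  shows "openin X {x \<in> chart_dom c. chart_map c x \<in> V}"
proof -
  have "continuous_map (subtopology X (chart_dom c)) (top_of_set (chart_im c)) (chart_map c)"
    using charts[OF c] homeomorphic_imp_continuous_map unfolding is_chart_def by blast
  then have "continuous_map (subtopology X (chart_dom c)) euclidean (chart_map c)"
    by (simp add: continuous_map_in_subtopology)
  then have "openin (subtopology X (chart_dom c)) {x \<in> topspace (subtopology X (chart_dom c)). chart_map c x \<in> V}"
    using V openin_continuous_map_preimage by fastforce
  moreover have "topspace (subtopology X (chart_dom c)) = chart_dom c"
    using open_dom[OF c] openin_subset by fastforce
  ultimately have "openin (subtopology X (chart_dom c)) {x \<in> chart_dom c. chart_map c x \<in> V}"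
    by (simp only:)
  then show ?thesis using open_dom[OF c] openin_trans_full by blast
qed

lemma mem_overlap:
  assumes c: "c \<in> A"
  shows "y \<in> overlap c d \<longleftrightarrow> y \<in> chart_im c \<and> chart_inv c y \<in> chart_dom d"
proof
  assume "y \<in> overlap c d"
  then obtain x where "x \<in> chart_dom c" "x \<in> chart_dom d" "y = chart_map c x"
    by (auto simp: overlap_def)
  then show "y \<in> chart_im c \<and> chart_inv c y \<in> chart_dom d"
    using chart_inv_map[OF c, of x] chart_map_im[of x c] by simp
next
  assume y: "y \<in> chart_im c \<and> chart_inv c y \<in> chart_dom d"
  then have "chart_inv c y \<in> chart_dom c \<inter> chart_dom d" using chart_inv_dom[of y c] by simp
  then have "chart_map c (chart_inv c y) \<in> overlap c d" unfolding overlap_def by (rule imageI)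
  then show "y \<in> overlap c d" using chart_map_inv[of y c] y by simp
qed

lemma restrict_chart_inv:
  assumes "is_chart X c" and y: "y \<in> chart_map c ` (chart_dom c \<inter> U)"
  shows "chart_inv (restrict_chart c U) y = chart_inv c y"
proof -
  obtain x where x: "x \<in> chart_dom c" "x \<in> U" "y = chart_map c x" using y by blast
  have inj: "inj_on (chart_map c) (chart_dom c)"
    using assms(1) homeomorphic_imp_injective_map
    unfolding is_chart_def by (fastforce dest: openin_subset simp: inf.absorb2)
  then have "inj_on (chart_map c) (chart_dom c \<inter> U)" by (rule inj_on_subset) blast
  then show ?thesis
    using x inj by (simp add: chart_inv_def restrict_chart_def)
qed

text \<open>Maximality of the atlas supplies the membership: overlaps and transition maps of the
  restricted chart are restrictions of those of \<open>c\<close>, hence smooth.\<close>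

lemma restrict_chart_in_atlas:
  assumes c: "c \<in> A" and U: "openin X U"
  shows "restrict_chart c U \<in> A"
proof (rule maximal)
  let ?r = "restrict_chart c U"
  have d: "chart_dom ?r = chart_dom c \<inter> U" "chart_map ?r = chart_map c" by (simp_all add: restrict_chart_def)
  have im: "chart_im ?r = chart_map c ` (chart_dom c \<inter> U)" by (simp add: chart_im_def d)
  have inj: "inj_on (chart_map c) (chart_dom c)" by (rule chart_inj[OF c])
  have sub: "chart_dom c \<subseteq> topspace X" using open_dom[OF c] openin_subset by blast
  have "homeomorphic_map (subtopology (subtopology X (chart_dom c)) (chart_dom c \<inter> U))
      (subtopology (top_of_set (chart_im c)) (chart_im ?r)) (chart_map c)"
  proof (rule homeomorphic_map_subtopologies)
    show "homeomorphic_map (subtopology X (chart_dom c)) (top_of_set (chart_im c)) (chart_map c)"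
      using charts[OF c] by (simp add: is_chart_def)
    show "chart_map c ` (topspace (subtopology X (chart_dom c)) \<inter> (chart_dom c \<inter> U))
        = topspace (top_of_set (chart_im c)) \<inter> chart_im ?r"
      unfolding im using sub by (auto simp: chart_im_def)
  qed
  moreover have "chart_im ?r \<subseteq> chart_im c" by (auto simp: im chart_im_def[of c])
  ultimately have "homeomorphic_map (subtopology X (chart_dom ?r)) (top_of_set (chart_im ?r)) (chart_map ?r)"
    by (simp add: d subtopology_subtopology inf.absorb2 Int_absorb1)
  then show "is_chart X ?r"
    using open_image[OF charts[OF c] U] open_dom[OF c] U by (simp add: is_chart_def im d openin_Int)
  fix e assume e: "e \<in> A"
  have o1: "overlap ?r e \<subseteq> overlap c e" "overlap e ?r \<subseteq> overlap e c"
    by (auto simp: overlap_def d)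
  have "chart_dom ?r \<inter> chart_dom e = chart_dom c \<inter> (U \<inter> chart_dom e)" by (auto simp: d)
  then have "open (overlap ?r e)"
    using open_image[OF charts[OF c], of "U \<inter> chart_dom e"] U open_dom[OF e]
    by (simp add: overlap_def d openin_Int)
  moreover have "transition ?r e y = transition c e y" if "y \<in> overlap ?r e" for y
  proof -
    have "y \<in> chart_map c ` (chart_dom c \<inter> U)" using that by (auto simp: overlap_def d)
    then show ?thesis by (simp add: transition_apply restrict_chart_inv[OF charts[OF c]])
  qed
  moreover have "smooth_on (overlap ?r e) (\<lambda>y. transition c e y $ k)" for k
    using compat[OF c e] o1 smooth_on_subset unfolding compatible_def by blast
  ultimately have "smooth_on (overlap ?r e) (\<lambda>y. transition ?r e y $ k)" for k
    using smooth_on_cong[of "overlap ?r e" "\<lambda>y. transition ?r e y $ k" "\<lambda>y. transition c e y $ k"] by simp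
  moreover have "transition e ?r = transition e c" by (simp add: transition_def d)
  then have "smooth_on (overlap e ?r) (\<lambda>y. transition e ?r y $ k)" for k
    using compat[OF c e] o1 smooth_on_subset unfolding compatible_def by metis
  ultimately show "compatible ?r e" by (simp add: compatible_def)
qed

lemma smooth_manifold_restrict:
  assumes U: "openin X U" "connectedin X U" "U \<noteq> {}"
  shows "smooth_manifold (subtopology X U) (restrict_atlas A U)"
proof
  have UX: "U \<subseteq> topspace X" using U openin_subset by blast
  have chart_iff: "is_chart (subtopology X U) c \<longleftrightarrow> is_chart X c \<and> chart_dom c \<subseteq> U" for c :: "('a, 'n) chart"
    using U by (auto simp: is_chart_def openin_open_subtopology subtopology_subtopology inf.absorb2)
  show "topspace (subtopology X U) \<noteq> {}" using U UX by (simp add: inf.absorb2)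
  show "connected_space (subtopology X U)" using U by (simp add: connectedin_def)
  show "Hausdorff_space (subtopology X U)" by (rule Hausdorff_space_subtopology[OF Hausdorff])
  show "is_chart (subtopology X U) c" if "c \<in> restrict_atlas A U" for c
    using that charts by (simp add: restrict_atlas_def chart_iff)
  show "(\<Union>c\<in>restrict_atlas A U. chart_dom c) = topspace (subtopology X U)"
  proof
    show "(\<Union>c\<in>restrict_atlas A U. chart_dom c) \<subseteq> topspace (subtopology X U)"
      using UX by (auto simp: restrict_atlas_def)
    show "topspace (subtopology X U) \<subseteq> (\<Union>c\<in>restrict_atlas A U. chart_dom c)"
    proof
      fix x assume x: "x \<in> topspace (subtopology X U)"
      then have "x \<in> (\<Union>c\<in>A. chart_dom c)" by (simp add: cover)
      then obtain c where c: "c \<in> A" "x \<in> chart_dom c" by blast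
      then have "restrict_chart c U \<in> restrict_atlas A U" "x \<in> chart_dom (restrict_chart c U)"
        using restrict_chart_in_atlas[OF c(1) U(1)] x by (auto simp: restrict_atlas_def restrict_chart_def)
      then show "x \<in> (\<Union>c\<in>restrict_atlas A U. chart_dom c)" by blast
    qed
  qed
  show "compatible c d" if "c \<in> restrict_atlas A U" "d \<in> restrict_atlas A U" for c d
    using that compat by (simp add: restrict_atlas_def)
  fix c :: "('a, 'n) chart"
  assume c: "is_chart (subtopology X U) c" and comp: "\<And>d. d \<in> restrict_atlas A U \<Longrightarrow> compatible c d"
  have cX: "is_chart X c" "chart_dom c \<subseteq> U" using c chart_iff by auto
  \<comment> \<open>A chart with domain in \<open>U\<close> meets any \<open>d\<close> only inside
    \<open>U\<close>, so its compatibility with \<open>d\<close> is that with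
    \<open>restrict_chart d U\<close>, a member of the restricted atlas.\<close>
  have "c \<in> A"
  proof (rule maximal[OF cX(1)])
    fix d assume d: "d \<in> A"
    let ?r = "restrict_chart d U"
    have r: "?r \<in> restrict_atlas A U"
      using restrict_chart_in_atlas[OF d U(1)] by (auto simp: restrict_atlas_def restrict_chart_def)
    have o: "overlap c ?r = overlap c d" "overlap ?r c = overlap d c"
      using cX(2) by (auto simp: overlap_def restrict_chart_def)
    have "open (overlap d c)"
      unfolding overlap_def using open_image[OF charts[OF d]] cX(1) is_chart_def by blast
    moreover have "transition d c y = transition ?r c y" if "y \<in> overlap d c" for y
    proof -
      have "y \<in> chart_map d ` (chart_dom d \<inter> U)" using that cX(2) by (auto simp: overlap_def)
      then show ?thesis by (simp add: transition_apply restrict_chart_inv[OF charts[OF d]])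
    qed
    ultimately have "smooth_on (overlap d c) (\<lambda>y. transition d c y $ k)
        \<longleftrightarrow> smooth_on (overlap d c) (\<lambda>y. transition ?r c y $ k)" for k
      by (intro smooth_on_cong) simp_all
    moreover have "transition c ?r = transition c d" by (simp add: transition_def restrict_chart_def)
    ultimately show "compatible c d"
      using comp[OF r] by (simp add: compatible_def o)
  qed
  then show "c \<in> restrict_atlas A U" using cX by (simp add: restrict_atlas_def)
qed

lemma smooth_transition: "c \<in> A \<Longrightarrow> d \<in> A \<Longrightarrow> smooth_on (overlap c d) (\<lambda>y. transition c d y $ k)"
  using compat unfolding compatible_def by blast

lemma transition_differentiable:
  "c \<in> A \<Longrightarrow> d \<in> A \<Longrightarrow> y \<in> overlap c d \<Longrightarrow> (\<lambda>y. transition c d y $ k) differentiable at y"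
  using smooth_transition open_overlap smooth_on_differentiable by blast

lemma jacobian_transition:
  "c \<in> A \<Longrightarrow> d \<in> A \<Longrightarrow> y \<in> overlap c d \<Longrightarrow>
    jacobian (transition c d) (at y) $ k $ i = partial_deriv i (\<lambda>y. transition c d y $ k) y"
  by (intro jacobian_component transition_differentiable)

lemma transition_mem:
  "c \<in> A \<Longrightarrow> d \<in> A \<Longrightarrow> y \<in> overlap c d \<Longrightarrow> transition c d y \<in> overlap d c"
  by (auto simp: overlap_def transition_apply chart_inv_map)

lemma transition_transition:
  "c \<in> A \<Longrightarrow> d \<in> A \<Longrightarrow> y \<in> overlap c d \<Longrightarrow> chart_inv c y \<in> chart_dom e \<Longrightarrow>
    transition d e (transition c d y) = transition c e y"
  by (auto simp: overlap_def transition_apply chart_inv_map)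

lemma transition_self: "c \<in> A \<Longrightarrow> y \<in> chart_im c \<Longrightarrow> transition c c y = y"
  by (simp add: transition_apply chart_map_inv)

text \<open>The chain rule for a double change of charts. Its case \<open>e = c\<close> inverts the
  Jacobian, see \<open>jacobian_inverse\<close>.\<close>

lemma jacobian_cocycle:
  assumes A: "c \<in> A" "d \<in> A" "e \<in> A" and y: "y \<in> overlap c d" "chart_inv c y \<in> chart_dom e"
  shows "jacobian (transition c e) (at y) =
    jacobian (transition d e) (at (transition c d y)) ** jacobian (transition c d) (at y)"
proof -
  let ?S = "overlap c d \<inter> overlap c e"
  have S: "open ?S" "y \<in> ?S"
    using A y open_overlap[OF A(1,2)] open_overlap[OF A(1,3)] mem_overlap[OF A(1)] by (auto intro: open_Int)
  have 1: "transition c d y \<in> overlap d e"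
    using y A by (auto simp: overlap_def transition_apply chart_inv_map)
  have "partial_deriv i (\<lambda>y. transition c e y $ k) y = (\<Sum>m\<in>UNIV.
      partial_deriv m (\<lambda>y. transition d e y $ k) (transition c d y) * partial_deriv i (\<lambda>y. transition c d y $ m) y)" for i k
  proof -
    have "partial_deriv i (\<lambda>y. transition c e y $ k) y = partial_deriv i (\<lambda>y. transition d e (transition c d y) $ k) y"
      by (rule partial_deriv_cong[OF S])
        (use A mem_overlap[OF A(1)] transition_transition in auto)
    also have "\<dots> = (\<Sum>m\<in>UNIV. partial_deriv m (\<lambda>y. transition d e y $ k) (transition c d y)
        * partial_deriv i (\<lambda>y. transition c d y $ m) y)"
      by (rule partial_deriv_compose[where f = "\<lambda>y. transition d e y $ k"])
        (use A y 1 transition_differentiable in auto)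
    finally show ?thesis .
  qed
  then show ?thesis
    using A y 1 S(2) by (simp add: vec_eq_iff matrix_matrix_mult_def jacobian_transition)
qed

lemma jacobian_self:
  assumes c: "c \<in> A" and y: "y \<in> chart_im c"
  shows "jacobian (transition c c) (at y) = mat 1"
proof -
  have "(transition c c has_derivative (\<lambda>h. h)) (at y)"
    by (rule has_derivative_transform_within_open[OF has_derivative_ident open_im[OF c] y])
       (simp add: transition_self[OF c])
  then have "frechet_derivative (transition c c) (at y) = (\<lambda>h. h)"
    by (metis frechet_derivative_at)
  then show ?thesis by (simp add: jacobian_def matrix_def mat_def axis_def vec_eq_iff)
qed

lemma jacobian_inverse:
  assumes A: "c \<in> A" "d \<in> A" and y: "y \<in> overlap c d"
  shows "jacobian (transition d c) (at (transition c d y)) ** jacobian (transition c d) (at y) = mat 1"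
proof -
  have im: "y \<in> chart_im c" using y mem_overlap[OF A(1)] by simp
  show ?thesis
    using jacobian_cocycle[OF A A(1) y chart_inv_dom[OF im]] jacobian_self[OF A(1) im] by simp
qed

text \<open>The new domain corresponds to a ball in coordinates: a ball is connected, as a manifold
  is required to be. Keeping the coordinate map leaves coordinate expressions unchanged.\<close>

lemma shrink_chart:
  assumes c: "c \<in> A" and x: "x \<in> chart_dom c" and V: "open V" "chart_map c x \<in> V"
  obtains c' where "c' \<in> A" "x \<in> chart_dom c'" "chart_dom c' \<subseteq> chart_dom c" "chart_map c' = chart_map c"
    "chart_im c' \<subseteq> V" "chart_im c' \<subseteq> chart_im c" "connectedin X (chart_dom c')"
    "\<And>y. y \<in> chart_im c' \<Longrightarrow> chart_inv c' y = chart_inv c y"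
proof -
  have "open (V \<inter> chart_im c)" "chart_map c x \<in> V \<inter> chart_im c"
    using V open_im[OF c] chart_map_im[OF x] by auto
  then obtain e where e: "e > 0" "ball (chart_map c x) e \<subseteq> V \<inter> chart_im c"
    using open_contains_ball by blast
  let ?B = "ball (chart_map c x) e"
  define O' where "O' = {x \<in> chart_dom c. chart_map c x \<in> ?B}"
  have O': "openin X O'" unfolding O'_def by (rule open_preimage[OF c]) simp
  let ?r = "restrict_chart c O'"
  have r: "?r \<in> A" by (rule restrict_chart_in_atlas[OF c O'])
  have sub: "O' \<subseteq> chart_dom c" and xO: "x \<in> O'" using x e(1) by (auto simp: O'_def)
  have d: "chart_dom ?r = O'" "chart_map ?r = chart_map c"
    using sub by (auto simp: restrict_chart_def)
  have im: "chart_im ?r = ?B"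
    unfolding chart_im_def[of ?r] d using e(2) by (auto simp: O'_def chart_im_def)
  have "connectedin X (chart_dom ?r)"
  proof -
    have top: "topspace (subtopology X (chart_dom ?r)) = chart_dom ?r"
      using open_dom[OF r] openin_subset by fastforce
    have h: "homeomorphic_map (subtopology X (chart_dom ?r)) (top_of_set (chart_im ?r)) (chart_map ?r)"
      using charts[OF r] by (simp add: is_chart_def)
    have "connectedin (top_of_set (chart_im ?r)) (chart_map ?r ` chart_dom ?r)"
      unfolding chart_im_def[symmetric] using im by (simp add: connectedin_subtopology)
    then have "connectedin (subtopology X (chart_dom ?r)) (chart_dom ?r)"
      using homeomorphic_map_connectedness[OF h, of "chart_dom ?r"] unfolding top by blast
    then show ?thesis by simp
  qed
  moreover have "chart_inv ?r y = chart_inv c y" if "y \<in> chart_im ?r" for y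
    using restrict_chart_inv[OF charts[OF c], of y O'] that sub
    by (simp add: chart_im_def d inf.absorb2)
  ultimately show thesis
    using that[OF r] xO sub im e(2) d by simp
qed

end

subsection \<open>The parallel null field\<close>

text \<open>Fixes one recurrence covector and one local conformal factor. The latter is controlled
  only in charts inside \<open>U\<close>, whereas \<alpha> and the metric are given on all of
  \<open>X\<close>.\<close>

locale lorentzian_recurrent_region =
  lorentzian_manifold X A g + conformally_recurrent_manifold X A g
  for X :: "'a topology" and A :: "('a, 'n::finite) chart set" and g +
  fixes \<alpha> :: "('a, 'n) vector_comps" and U :: "'a set" and \<sigma> :: "'a \<Rightarrow> real"
  assumes \<alpha>_form: "one_form A \<alpha>"
    and \<alpha>_recurrence: "c \<in> A \<Longrightarrow> y \<in> chart_im c \<Longrightarrow>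
      nabla_weyl (g c) i j k l m y = \<alpha> c y $ i * weyl (g c) j k l m y"
    and open_U: "openin X U"
    and \<sigma>_smooth: "scalar_field (restrict_atlas A U) \<sigma>"
    and \<sigma>_symmetric: "conformally_symmetric (restrict_atlas A U) (conformal_metric \<sigma> g)"
begin

abbreviation loc :: "('a, 'n) chart \<Rightarrow> real^'n \<Rightarrow> real" where
  "loc d \<equiv> (\<lambda>y. \<sigma> (chart_inv d y))"

text \<open>Needed because \<open>recurrent_chart\<close> asks for a nowhere vanishing \<alpha> in
  every chart to which it is applied.\<close>

lemma \<alpha>_nonzero_transfer:
  assumes "c \<in> A" "d \<in> A" "y \<in> overlap c d" "\<alpha> c y \<noteq> 0"
  shows "\<alpha> d (transition c d y) \<noteq> 0"
proof -
  have "\<alpha> c y = transpose (jacobian (transition c d) (at y)) *v \<alpha> d (transition c d y)"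
    using \<alpha>_form assms unfolding one_form_def by blast
  then show ?thesis using assms(4) by auto
qed

lemma metric_on_chart:
  assumes d: "d \<in> A"
  shows "metric_on (chart_im d) (g d)"
proof
  show "open (chart_im d)" by (rule open_im[OF d])
  show "smooth_on (chart_im d) (\<lambda>y. g d y $ i $ j)" for i j
    using metric_tensor d unfolding covariant_2_tensor_def by blast
qed (use metric_symmetric[OF d] metric_nondegenerate[OF d] in auto)

lemma recurrent_in_chart:
  assumes d: "d \<in> A" "chart_dom d \<subseteq> U" and \<alpha>: "\<And>y. y \<in> chart_im d \<Longrightarrow> \<alpha> d y \<noteq> 0"
  shows "lorentzian_recurrent_chart (chart_im d) (g d) (loc d) (\<alpha> d)"
proof -
  have dU: "d \<in> restrict_atlas A U" using d by (simp add: restrict_atlas_def)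
  interpret metric_on "chart_im d" "g d" by (rule metric_on_chart[OF d(1)])
  interpret conformal_change "chart_im d" "g d" "loc d"
  proof
    show "smooth_on (chart_im d) (loc d)" using \<sigma>_smooth dU unfolding scalar_field_def by blast
  qed
  have "conformal_metric \<sigma> g d = G'" by (rule ext) (simp add: conformal_metric_def G'_def)
  then have sym: "nabla_weyl G' i j k l m y = 0" if "y \<in> chart_im d" for i j k l m y
    using \<sigma>_symmetric dU that unfolding conformally_symmetric_def by metis
  show ?thesis
  proof
    show "4 \<le> CARD('n)" by (rule dim_ge_4)
  qed (use d \<alpha> sym \<alpha>_recurrence weyl_nonzero lorentzian in auto)
qed

section \<open>Transport of the parallel field to all charts inside one chart domain\<close>

context
  fixes c :: "('a, 'n) chart" and u :: "'n \<Rightarrow> real^'n \<Rightarrow> real"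
  assumes c: "c \<in> A" "chart_dom c \<subseteq> U"
    and \<alpha>_c: "\<And>y. y \<in> chart_im c \<Longrightarrow> \<alpha> c y \<noteq> 0"
    and u_smooth: "\<And>j. smooth_on (chart_im c) (u j)"
    and u_parallel: "\<And>y j k. y \<in> chart_im c \<Longrightarrow> nabla_covector (g c) u j k y = 0"
    and u_eq: "\<And>y. y \<in> chart_im c \<Longrightarrow> \<exists>r. r \<noteq> 0 \<and> (\<forall>j. u j y = r * partial_deriv j (loc c) y)"
begin

definition chart_vector :: "real^'n \<Rightarrow> real^'n" where
  "chart_vector z = matrix_inv (g c z) *v (\<chi> j. u j z)"

text \<open>The push-forward from \<open>c\<close> to \<open>d\<close> of the vector with covector
  \<open>u\<close>; a vector, because \<open>brinkmann_wave\<close> asks for a vector field.\<close>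

definition transported :: "('a, 'n) vector_comps" where
  "transported d y = jacobian (transition c d) (at (transition d c y)) *v chart_vector (transition d c y)"

lemma subchart:
  assumes d: "d \<in> restrict_atlas A (chart_dom c)"
  shows "d \<in> A" "chart_dom d \<subseteq> chart_dom c" "overlap d c = chart_im d"
    "y \<in> chart_im d \<Longrightarrow> transition d c y \<in> overlap c d"
    "y \<in> chart_im d \<Longrightarrow> transition d c y \<in> chart_im c"
    "y \<in> chart_im d \<Longrightarrow> transition c d (transition d c y) = y"
proof -
  show dA: "d \<in> A" "chart_dom d \<subseteq> chart_dom c" using d by (auto simp: restrict_atlas_def)
  then show o: "overlap d c = chart_im d" by (auto simp: overlap_def chart_im_def)
  show 1: "transition d c y \<in> overlap c d" if "y \<in> chart_im d"
    using transition_mem[OF dA(1) c(1)] that o by blast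
  show "transition d c y \<in> chart_im c" if "y \<in> chart_im d"
    using 1[OF that] mem_overlap[OF c(1)] by blast
  show "transition c d (transition d c y) = y" if "y \<in> chart_im d"
    using transition_transition[OF dA(1) c(1), of y d] that o chart_inv_dom[OF that] transition_self[OF dA(1) that]
    by simp
qed

lemma subchart_recurrent:
  assumes d: "d \<in> restrict_atlas A (chart_dom c)"
  shows "lorentzian_recurrent_chart (chart_im d) (g d) (loc d) (\<alpha> d)"
proof (rule recurrent_in_chart)
  show "d \<in> A" "chart_dom d \<subseteq> U" using subchart[OF d] c by auto
  show "\<alpha> d y \<noteq> 0" if "y \<in> chart_im d" for y
    using \<alpha>_nonzero_transfer[OF c(1) subchart(1)[OF d] subchart(4)[OF d that] \<alpha>_c[OF subchart(5)[OF d that]]]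
      subchart(6)[OF d that] by simp
qed

lemma jacobian_subchart:
  assumes d: "d \<in> restrict_atlas A (chart_dom c)" and y: "y \<in> chart_im d"
  shows "jacobian (transition d c) (at y) ** jacobian (transition c d) (at (transition d c y)) = mat 1"
  using jacobian_inverse[OF c(1) subchart(1)[OF d] subchart(4)[OF d y]] subchart(6)[OF d y] by simp

lemma transported_chart_vector:
  assumes d: "d \<in> restrict_atlas A (chart_dom c)" and y: "y \<in> chart_im d"
  shows "jacobian (transition d c) (at y) *v transported d y = chart_vector (transition d c y)"
  by (simp add: transported_def matrix_vector_mul_assoc jacobian_subchart[OF d y])

lemma lower_chart_vector: "z \<in> chart_im c \<Longrightarrow> g c z *v chart_vector z = (\<chi> j. u j z)"
  using matrix_inv_inverse(1)[OF metric_nondegenerate[OF c(1)]]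
  by (simp add: chart_vector_def matrix_vector_mul_assoc)

text \<open>Lowering commutes with the change of charts: the Jacobian pushing the vector forward is
  undone by one of those in the transformation law of the metric, and the other pulls
  \<open>u\<close> back.\<close>

lemma lower_transported:
  assumes d: "d \<in> restrict_atlas A (chart_dom c)" and y: "y \<in> chart_im d"
  shows "lower_index (g d) (transported d) j y =
    (\<Sum>k\<in>UNIV. partial_deriv j (\<lambda>y. transition d c y $ k) y * u k (transition d c y))"
proof -
  let ?J = "jacobian (transition d c) (at y)" and ?z = "transition d c y"
  have yo: "y \<in> overlap d c" using subchart(3)[OF d] y by simp
  have "g d y = transpose ?J ** g c ?z ** ?J"
    using metric_tensor c(1) subchart(1)[OF d] yo unfolding covariant_2_tensor_def by blast
  then have "g d y *v transported d y = transpose ?J *v (g c ?z *v (?J *v transported d y))"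
    by (simp add: matrix_vector_mul_assoc matrix_mul_assoc)
  also have "\<dots> = transpose ?J *v (\<chi> k. u k ?z)"
    by (simp add: transported_chart_vector[OF d y] lower_chart_vector[OF subchart(5)[OF d y]])
  finally have "(g d y *v transported d y) $ j = (transpose ?J *v (\<chi> k. u k ?z)) $ j" by simp
  then show ?thesis
    by (simp add: lower_index_def matrix_vector_mult_def transpose_def
        jacobian_transition[OF subchart(1)[OF d] c(1) yo])
qed

text \<open>The pull-back of \<open>u\<close> and the differential of \<sigma> obey the same chain
  rule, so the factor \<open>r\<close> is inherited. This makes \<open>ds_null\<close> and
  \<open>riemann_product_zero\<close> available in every smaller chart.\<close>

lemma lower_transported_eq:
  assumes d: "d \<in> restrict_atlas A (chart_dom c)" and y: "y \<in> chart_im d"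
  shows "\<exists>r. r \<noteq> 0 \<and> (\<forall>j. lower_index (g d) (transported d) j y = r * partial_deriv j (loc d) y)"
proof -
  let ?z = "transition d c y"
  obtain r where r: "r \<noteq> 0" "\<And>k. u k ?z = r * partial_deriv k (loc c) ?z"
    using u_eq[OF subchart(5)[OF d y]] by blast
  have "partial_deriv j (loc d) y = (\<Sum>k\<in>UNIV. partial_deriv k (loc c) ?z * partial_deriv j (\<lambda>y. transition d c y $ k) y)" for j
  proof -
    have "partial_deriv j (loc d) y = partial_deriv j (\<lambda>y. loc c (transition d c y)) y"
    proof (rule partial_deriv_cong[OF open_im[OF subchart(1)[OF d]] y])
      fix x assume "x \<in> chart_im d"
      then have "chart_inv d x \<in> chart_dom c" using chart_inv_dom subchart(2)[OF d] by blast
      then show "loc d x = loc c (transition d c x)"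
        by (simp add: transition_apply chart_inv_map[OF c(1)])
    qed
    also have "\<dots> = (\<Sum>k\<in>UNIV. partial_deriv k (loc c) ?z * partial_deriv j (\<lambda>y. transition d c y $ k) y)"
    proof (rule partial_deriv_compose)
      have "smooth_on (chart_im c) (loc c)"
        using \<sigma>_smooth c unfolding scalar_field_def restrict_atlas_def by blast
      then show "loc c differentiable at ?z"
        using smooth_on_differentiable open_im[OF c(1)] subchart(5)[OF d y] by blast
      show "(\<lambda>y. transition d c y $ k) differentiable at y" for k
        using transition_differentiable[OF subchart(1)[OF d] c(1)] subchart(3)[OF d] y by simp
    qed
    finally show ?thesis .
  qed
  then have "lower_index (g d) (transported d) j y = r * partial_deriv j (loc d) y" for j
    by (simp add: lower_transported[OF d y] r(2) sum_distrib_left mult_ac)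
  with r(1) show ?thesis by blast
qed

lemma lower_transported_parallel:
  assumes d: "d \<in> restrict_atlas A (chart_dom c)" and y: "y \<in> chart_im d"
  shows "nabla_covector (g d) (lower_index (g d) (transported d)) i j y = 0"
proof -
  let ?J = "jacobian (transition d c)" and ?z = "transition d c y"
  note dA = subchart(1)[OF d]
  have yo: "y \<in> overlap d c" if "y \<in> chart_im d" for y using subchart(3)[OF d] that by simp
  have J: "partial_deriv i (\<lambda>y. transition d c y $ k) y = ?J (at y) $ k $ i" if "y \<in> chart_im d" for i k y
    using jacobian_transition[OF dA c(1) yo[OF that]] by simp
  have "nabla_covector (g d) (lower_index (g d) (transported d)) i j y =
    (\<Sum>k\<in>UNIV. \<Sum>l\<in>UNIV. partial_deriv i (\<lambda>y. transition d c y $ k) y * partial_deriv j (\<lambda>y. transition d c y $ l) y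
      * nabla_covector (g c) u k l ?z)"
  proof (rule nabla_covector_transform[where S = "chart_im d" and T = "chart_im c" and v = "transported d y"])
    show "metric_on (chart_im d) (g d)" "metric_on (chart_im c) (g c)"
      by (rule metric_on_chart[OF dA], rule metric_on_chart[OF c(1)])
    show "transition d c ` chart_im d \<subseteq> chart_im c" using subchart(5)[OF d] by blast
    show "smooth_on (chart_im d) (\<lambda>y. transition d c y $ k)" for k
      using smooth_transition[OF dA c(1)] subchart(3)[OF d] by simp
    show "smooth_on (chart_im c) (u k)" for k by (rule u_smooth)
    show "y \<in> chart_im d" by (rule y)
    show "g d x $ a $ b = (\<Sum>k\<in>UNIV. \<Sum>l\<in>UNIV. partial_deriv a (\<lambda>y. transition d c y $ k) x
        * partial_deriv b (\<lambda>y. transition d c y $ l) x * g c (transition d c x) $ k $ l)"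
      if x: "x \<in> chart_im d" for x a b
    proof -
      have "g d x = transpose (?J (at x)) ** g c (transition d c x) ** ?J (at x)"
        using metric_tensor c(1) dA yo[OF x] unfolding covariant_2_tensor_def by blast
      then have "g d x $ a $ b = (\<Sum>l\<in>UNIV. (\<Sum>k\<in>UNIV. ?J (at x) $ k $ a * g c (transition d c x) $ k $ l) * ?J (at x) $ l $ b)"
        by (simp add: matrix_matrix_mult_def transpose_def)
      also have "\<dots> = (\<Sum>l\<in>UNIV. \<Sum>k\<in>UNIV. ?J (at x) $ k $ a * ?J (at x) $ l $ b * g c (transition d c x) $ k $ l)"
        by (simp add: sum_distrib_left sum_distrib_right mult_ac)
      also have "\<dots> = (\<Sum>k\<in>UNIV. \<Sum>l\<in>UNIV. ?J (at x) $ k $ a * ?J (at x) $ l $ b * g c (transition d c x) $ k $ l)"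
        by (rule sum.swap)
      finally show ?thesis by (simp add: J[OF x])
    qed
    show "lower_index (g d) (transported d) b x
        = (\<Sum>k\<in>UNIV. partial_deriv b (\<lambda>y. transition d c y $ k) x * u k (transition d c x))" if "x \<in> chart_im d" for x b
      by (rule lower_transported[OF d that])
    show "lower_index (g d) (transported d) p y = (\<Sum>m\<in>UNIV. g d y $ p $ m * transported d y $ m)" for p
      by (simp add: lower_index_def)
    show "u k ?z = (\<Sum>l\<in>UNIV. g c ?z $ k $ l * (\<Sum>m\<in>UNIV. partial_deriv m (\<lambda>y. transition d c y $ l) y * transported d y $ m))" for k
    proof -
      have "(g c ?z *v (?J (at y) *v transported d y)) $ k = u k ?z"
        by (simp add: transported_chart_vector[OF d y] lower_chart_vector[OF subchart(5)[OF d y]])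
      then show ?thesis by (simp add: matrix_vector_mult_def J[OF y])
    qed
  qed
  then show ?thesis using u_parallel[OF subchart(5)[OF d y]] by simp
qed

lemma smooth_transported:
  assumes d: "d \<in> restrict_atlas A (chart_dom c)"
  shows "smooth_on (chart_im d) (\<lambda>y. transported d y $ k)"
proof -
  interpret C: metric_on "chart_im c" "g c" by (rule metric_on_chart[OF c(1)])
  note dA = subchart(1)[OF d]
  have o: "open (overlap c d)" "overlap c d \<subseteq> chart_im c"
    using open_overlap[OF c(1) dA] by (auto simp: overlap_def chart_im_def)
  have "smooth_on (chart_im c) (\<lambda>z. \<Sum>j\<in>UNIV. metric_inv (g c) i j z * u j z)" for i
    by (intro C.smooth_intros C.smooth_metric_inv u_smooth)
  then have "smooth_on (chart_im c) (\<lambda>z. chart_vector z $ i)" for i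
    by (simp add: chart_vector_def matrix_vector_mult_def metric_inv_def)
  then have "smooth_on (overlap c d) (\<lambda>z. chart_vector z $ i)" for i
    using o(2) smooth_on_subset by blast
  then have "smooth_on (overlap c d) (\<lambda>z. \<Sum>i\<in>UNIV. partial_deriv i (\<lambda>y. transition c d y $ k) z * chart_vector z $ i)"
    by (intro smooth_on_sum smooth_on_mult smooth_on_partial_deriv smooth_transition o(1) c(1) dA)
  then have "smooth_on (chart_im d) (\<lambda>y. (\<lambda>z. \<Sum>i\<in>UNIV. partial_deriv i (\<lambda>y. transition c d y $ k) z
      * chart_vector z $ i) (transition d c y))"
    by (rule smooth_on_compose[OF open_im[OF dA] o(1), rotated 2])
       (use subchart(3,4)[OF d] smooth_transition[OF dA c(1)] in auto)
  moreover have "transported d y $ k = (\<lambda>z. \<Sum>i\<in>UNIV. partial_deriv i (\<lambda>y. transition c d y $ k) z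
      * chart_vector z $ i) (transition d c y)" if "y \<in> chart_im d" for y
    by (simp add: transported_def matrix_vector_mult_def jacobian_transition[OF c(1) dA subchart(4)[OF d that]])
  ultimately show ?thesis
    by (subst smooth_on_cong[OF open_im[OF dA]])
qed

lemma vector_field_transported: "vector_field (restrict_atlas A (chart_dom c)) transported"
proof -
  have "transported e (transition d e y) = jacobian (transition d e) (at y) *v transported d y"
    if d: "d \<in> restrict_atlas A (chart_dom c)" and e: "e \<in> restrict_atlas A (chart_dom c)" and y: "y \<in> overlap d e"
    for d e y
  proof -
    note dA = subchart(1)[OF d] and eA = subchart(1)[OF e]
    have y': "y \<in> chart_im d" "chart_inv d y \<in> chart_dom e" "chart_inv d y \<in> chart_dom c"
      using y mem_overlap[OF dA] subchart(2)[OF e] by auto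
    let ?z = "transition d c y"
    have z: "transition e c (transition d e y) = ?z"
      by (rule transition_transition[OF dA eA y y'(3)])
    have "chart_inv c ?z = chart_inv d y"
      using y' by (simp add: transition_apply chart_inv_map[OF c(1)])
    then have "jacobian (transition c e) (at ?z) = jacobian (transition d e) (at y) ** jacobian (transition c d) (at ?z)"
      using jacobian_cocycle[OF c(1) dA eA subchart(4)[OF d y'(1)]] y' subchart(6)[OF d y'(1)] by simp
    then show ?thesis unfolding transported_def z by (simp add: matrix_vector_mul_assoc)
  qed
  then show ?thesis using smooth_transported by (simp add: vector_field_def)
qed

text \<open>All conditions are verified in an arbitrary chart \<open>d\<close> inside the domain:
  \<open>subchart_recurrent\<close> turns it into a recurrent chart of its own, in which the raised
  form of the transported covector is a multiple of the null gradient of \<sigma>.\<close>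

lemma pp_wave_chart_dom:
  assumes conn: "connectedin X (chart_dom c)" and ne: "chart_dom c \<noteq> {}"
  shows "pp_wave (subtopology X (chart_dom c)) (restrict_atlas A (chart_dom c)) g"
proof (intro pp_wave.intro pp_wave_axioms.intro brinkmann_wave.intro brinkmann_wave_axioms.intro
    lorentzian_manifold.intro lorentzian_manifold_axioms.intro
    pseudo_riemannian_manifold.intro pseudo_riemannian_manifold_axioms.intro)
  let ?R = "restrict_atlas A (chart_dom c)"
  have RA: "d \<in> A" if "d \<in> ?R" for d using that by (simp add: restrict_atlas_def)
  show "smooth_manifold (subtopology X (chart_dom c)) ?R"
    by (rule smooth_manifold_restrict[OF open_dom[OF c(1)] conn ne])
  show "covariant_2_tensor ?R g"
    using metric_tensor unfolding covariant_2_tensor_def restrict_atlas_def by blast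
  show "transpose (g d y) = g d y" "invertible (g d y)" "lorentzian_form (g d y)"
    if "d \<in> ?R" "y \<in> chart_im d" for d y
    using that RA metric_symmetric metric_nondegenerate lorentzian by blast+
  have "transported d y \<noteq> 0 \<and> (\<Sum>i\<in>UNIV. transported d y $ i * lower_index (g d) (transported d) i y) = 0"
    if d: "d \<in> ?R" and y: "y \<in> chart_im d" for d y
  proof -
    interpret D: lorentzian_recurrent_chart "chart_im d" "g d" "loc d" "\<alpha> d"
      by (rule subchart_recurrent[OF d])
    obtain r where r: "r \<noteq> 0" "\<And>j. lower_index (g d) (transported d) j y = r * D.ds j y"
      using lower_transported_eq[OF d y] by blast
    obtain i where i: "D.ds i y \<noteq> 0" using D.ds_nonzero[OF y] by blast
    have "transported d y \<noteq> 0"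
    proof
      assume "transported d y = 0"
      then have "lower_index (g d) (transported d) i y = 0" by (simp add: lower_index_def)
      then show False using r i by simp
    qed
    moreover have "transported d y $ i = r * D.ds_up i y" for i
    proof -
      have "transported d y = matrix_inv (g d y) *v (g d y *v transported d y)"
        using matrix_inv_inverse(2)[OF metric_nondegenerate[OF RA[OF d] y]] by (simp add: matrix_vector_mul_assoc)
      moreover have "g d y *v transported d y = (\<chi> j. r * D.ds j y)"
        using r(2) by (simp add: lower_index_def matrix_vector_mult_def vec_eq_iff)
      ultimately have "transported d y $ i = (matrix_inv (g d y) *v (\<chi> j. r * D.ds j y)) $ i" by simp
      then show ?thesis
        by (simp add: matrix_vector_mult_def D.ds_up_def metric_inv_def sum_distrib_left mult_ac)
    qed
    then have "(\<Sum>i\<in>UNIV. transported d y $ i * lower_index (g d) (transported d) i y)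
        = r * r * (\<Sum>i\<in>UNIV. D.ds i y * D.ds_up i y)"
      by (simp add: r(2) sum_distrib_left mult_ac)
    then have "(\<Sum>i\<in>UNIV. transported d y $ i * lower_index (g d) (transported d) i y) = 0"
      using D.ds_null[OF y] by simp
    ultimately show ?thesis by blast
  qed
  then show "\<exists>v. vector_field ?R v \<and> (\<forall>d\<in>?R. \<forall>y\<in>chart_im d. v d y \<noteq> 0 \<and>
      (\<Sum>i\<in>UNIV. v d y $ i * lower_index (g d) (v d) i y) = 0 \<and>
      (\<forall>j k. nabla_covector (g d) (lower_index (g d) (v d)) j k y = 0))"
    using vector_field_transported lower_transported_parallel by blast
  show "(\<Sum>p\<in>UNIV. \<Sum>q\<in>UNIV. riemann_up2 (g d) j k p q y * riemann_down (g d) p q l m y) = 0"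
    if d: "d \<in> ?R" and y: "y \<in> chart_im d" for d y j k l m
  proof -
    interpret D: lorentzian_recurrent_chart "chart_im d" "g d" "loc d" "\<alpha> d"
      by (rule subchart_recurrent[OF d])
    obtain r where r: "r \<noteq> 0" "\<And>j. lower_index (g d) (transported d) j y = r * D.ds j y"
      using lower_transported_eq[OF d y] by blast
    have "smooth_on (chart_im d) (lower_index (g d) (transported d) k)" for k
      unfolding lower_index_def[abs_def] by (intro D.smooth_intros smooth_transported[OF d])
    then show ?thesis
      by (rule D.riemann_product_zero[OF y _ lower_transported_parallel[OF d] r(2,1)])
  qed
qed

end

text \<open>The chart is shrunk twice, because the second choice depends on the first: only where
  \<alpha> has no zero is d\<sigma> known to be non-zero, and only then can a component of d\<sigma>
  be selected that has no zero on a smaller ball.\<close>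

lemma pp_wave_exists:
  assumes x: "x \<in> U" and c0: "c0 \<in> A" "x \<in> chart_dom c0" and \<alpha>0: "\<alpha> c0 (chart_map c0 x) \<noteq> 0"
  shows "\<exists>c\<in>A. pp_wave (subtopology X (chart_dom c)) (restrict_atlas A (chart_dom c)) g"
proof -
  have nz: "\<alpha> d (chart_map d x') \<noteq> 0"
    if "c \<in> A" "d \<in> A" "x' \<in> chart_dom c" "x' \<in> chart_dom d" "\<alpha> c (chart_map c x') \<noteq> 0" for c d x'
    using \<alpha>_nonzero_transfer[OF that(1,2), of "chart_map c x'"] that
    by (auto simp: overlap_def transition_apply chart_inv_map)
  have im_mem: "\<alpha> d y \<noteq> 0" if "c \<in> A" "d \<in> A" "chart_dom d \<subseteq> chart_dom c" "chart_map d = chart_map c"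
    "y \<in> chart_im d" "\<alpha> c y \<noteq> 0" for c d y
    using nz[OF that(1,2), of "chart_inv d y"] that(3-) chart_inv_dom[OF that(5)] chart_map_inv[OF that(5)] by auto
  have cont: "open {y \<in> S. f y \<noteq> 0}" if "open S" "continuous_on S f" for S and f :: "real^'n \<Rightarrow> real"
  proof -
    have "{y \<in> S. f y \<noteq> 0} = S \<inter> f -` (- {0})" by auto
    moreover have "open (- {0 :: real})" by (intro open_Compl closed_singleton)
    ultimately show ?thesis using continuous_open_preimage[OF that(2,1)] by simp
  qed
  obtain i where i: "\<alpha> c0 (chart_map c0 x) $ i \<noteq> 0" using \<alpha>0 by (auto simp: vec_eq_iff)
  \<comment> \<open>Requiring one fixed component of \<alpha> to be non-zero gives an open set; the
    second set keeps the chart where \<sigma> is defined.\<close>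
  define V1 where "V1 = {y \<in> chart_im c0. \<alpha> c0 y $ i \<noteq> 0} \<inter> chart_map c0 ` (chart_dom c0 \<inter> U)"
  have "continuous_on (chart_im c0) (\<lambda>y. \<alpha> c0 y $ i)"
    using \<alpha>_form c0 smooth_on_continuous_on unfolding one_form_def by blast
  then have "open V1"
    unfolding V1_def by (intro open_Int cont open_im[OF c0(1)] open_image[OF charts[OF c0(1)] open_U])
  moreover have "chart_map c0 x \<in> V1" using i x c0 chart_map_im[OF c0(2)] by (auto simp: V1_def)
  ultimately obtain c1 where c1: "c1 \<in> A" "x \<in> chart_dom c1" "chart_dom c1 \<subseteq> chart_dom c0"
    "chart_map c1 = chart_map c0" "chart_im c1 \<subseteq> V1"
    using shrink_chart[OF c0] by metis
  have c1U: "chart_dom c1 \<subseteq> U"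
  proof
    fix x' assume x': "x' \<in> chart_dom c1"
    then have "chart_map c0 x' \<in> chart_map c0 ` (chart_dom c0 \<inter> U)"
      using chart_map_im[OF x'] c1(4,5) by (auto simp: V1_def)
    then obtain x2 where "x2 \<in> chart_dom c0" "x2 \<in> U" "chart_map c0 x' = chart_map c0 x2" by blast
    then show "x' \<in> U" using inj_onD[OF chart_inj[OF c0(1)]] x' c1(3) by blast
  qed
  have \<alpha>1: "\<alpha> c1 y \<noteq> 0" if "y \<in> chart_im c1" for y
  proof (rule im_mem[OF c0(1) c1(1) c1(3,4) that])
    have "\<alpha> c0 y $ i \<noteq> 0" using that c1(5) by (auto simp: V1_def)
    then show "\<alpha> c0 y \<noteq> 0" by auto
  qed
  interpret C1: lorentzian_recurrent_chart "chart_im c1" "g c1" "loc c1" "\<alpha> c1"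
    by (rule recurrent_in_chart[OF c1(1) c1U \<alpha>1])
  obtain a where a: "C1.ds a (chart_map c1 x) \<noteq> 0"
    using C1.ds_nonzero[OF chart_map_im[OF c1(2)]] by blast
  \<comment> \<open>On this set \<open>weyl_square a a a a\<close> is positive, so the power with
    exponent -3/4 in \<open>parallel_covector\<close> is smooth.\<close>
  define V2 where "V2 = {y \<in> chart_im c1. C1.ds a y \<noteq> 0}"
  have "open V2"
    unfolding V2_def
    by (intro cont open_im[OF c1(1)] smooth_on_continuous_on smooth_on_partial_deriv C1.smooth_s)
  moreover have "chart_map c1 x \<in> V2" using a chart_map_im[OF c1(2)] by (simp add: V2_def)
  ultimately obtain c2 where c2: "c2 \<in> A" "x \<in> chart_dom c2" "chart_dom c2 \<subseteq> chart_dom c1"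
    "chart_map c2 = chart_map c1" "chart_im c2 \<subseteq> V2" "connectedin X (chart_dom c2)"
    "\<And>y. y \<in> chart_im c2 \<Longrightarrow> chart_inv c2 y = chart_inv c1 y"
    using shrink_chart[OF c1(1,2)] by metis
  have c2U: "chart_dom c2 \<subseteq> U" using c2 c1U by blast
  have \<alpha>2: "\<alpha> c2 y \<noteq> 0" if "y \<in> chart_im c2" for y
    using im_mem[OF c1(1) c2(1) c2(3,4) that] \<alpha>1 that c2(5) by (auto simp: V2_def)
  interpret C2: lorentzian_recurrent_chart "chart_im c2" "g c2" "loc c2" "\<alpha> c2"
    by (rule recurrent_in_chart[OF c2(1) c2U \<alpha>2])
  have ds: "C2.ds a y \<noteq> 0" if y: "y \<in> chart_im c2" for y
  proof -
    have "C2.ds a y = C1.ds a y"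
      by (rule partial_deriv_cong[OF open_im[OF c2(1)] y]) (simp add: c2(7))
    then show ?thesis using y c2(5) by (auto simp: V2_def)
  qed
  have "pp_wave (subtopology X (chart_dom c2)) (restrict_atlas A (chart_dom c2)) g"
    by (rule pp_wave_chart_dom[where u = "C2.parallel_covector a"])
      (use c2(1,2,6) c2U \<alpha>2 C2.smooth_parallel_covector[OF ds] C2.nabla_parallel_covector[OF ds] C2.parallel_covector_eq[OF ds] in auto)
  then show ?thesis using c2(1) by blast
qed

end

theorem theorem3p9:
  fixes X :: "'a topology" and A :: "('a, 'n::finite) chart set" and g :: "('a, 'n) matrix_comps"
  assumes "CARD('n) \<ge> 4"
    and "lorentzian_manifold X A g"
    and "simple_conformally_recurrent_manifold X A g"
  shows "\<exists>c\<in>A. pp_wave (subtopology X (chart_dom c)) (restrict_atlas A (chart_dom c)) g"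
proof -
  interpret L: lorentzian_manifold X A g by (rule assms(2))
  interpret R: simple_conformally_recurrent_manifold X A g by (rule assms(3))
  \<comment> \<open>The point at which \<alpha> is non-zero decides where the coordinate domain is
    to be found; the conformal factor is then chosen around it.\<close>
  obtain \<alpha> c0 y0 where \<alpha>: "one_form A \<alpha>" "c0 \<in> A" "y0 \<in> chart_im c0" "\<alpha> c0 y0 \<noteq> 0"
    and rec: "\<forall>c\<in>A. \<forall>y\<in>chart_im c. \<forall>i j k l m.
         nabla_weyl (g c) i j k l m y = \<alpha> c y $ i * weyl (g c) j k l m y"
    using R.recurrence by blast
  define x where "x = chart_inv c0 y0"
  have x: "x \<in> chart_dom c0" "chart_map c0 x = y0"
    using L.chart_inv_dom[OF \<alpha>(3)] L.chart_map_inv[OF \<alpha>(3)] by (simp_all add: x_def)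
  then have "x \<in> topspace X" using L.open_dom[OF \<alpha>(2)] openin_subset by blast
  then obtain U \<sigma> where U: "openin X U" "x \<in> U" "scalar_field (restrict_atlas A U) \<sigma>"
    "conformally_symmetric (restrict_atlas A U) (conformal_metric \<sigma> g)"
    using R.simple by blast
  interpret lorentzian_recurrent_region X A g \<alpha> U \<sigma>
    by unfold_locales (use \<alpha>(1) rec U in auto)
  show ?thesis using pp_wave_exists[OF U(2) \<alpha>(2) x(1)] \<alpha>(4) x(2) by simp
qed

end
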